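(* Let $n=2$ and $\sigma\in(0,1]$. There exist a function $\Phi_0:[0,+\infty)\to[0,+\infty)$ which is nondecreasing, lower semicontinuous and satisfies $\lim_{t\to+\infty}\Phi_0(t)=+\infty$, and radii $R_0>r_0>0$, such that there is a minimizer $u$ of $$\mathcal{E}_\Omega(v):=\int_\Omega|\nabla v(x)|^2\,dx+\Phi_0\Big(\mathrm{Per}_\sigma\big(\{v>0\},\Omega\big)\Big)$$ in $\Omega=B_{R_0}$ whose restriction to $B_{r_0}$ is not a minimizer of $\mathcal{E}_\Omega$ in $\Omega=B_{r_0}$.
   Context: $B_r$ is the open ball of radius $r$ centered at the origin in $\mathbb{R}^n$. For $\sigma\in(0,1)$: $\mathrm{Per}_\sigma(E,\Omega):=\mathcal{S}_\sigma(E,E^c\cap\Omega)+\mathcal{S}_\sigma(E\cap\Omega,E^c\cap\Omega^c)$ with $E^c=\mathbb{R}^n\setminus E$ and $\mathcal{S}_\sigma(E,F):=\sigma(1-\sigma)\iint_{E\times F}|x-y|^{-n-\sigma}\,dx\,dy$; for $\sigma=1$, $\mathrm{Per}_1(E,\Omega)$ is the classical (De Giorgi) perimeter of $E$ in $\Omega$. A minimizer of $\mathcal{E}_\Omega$ in $\Omega$ is a function $u$ with $\mathcal{E}_\Omega(u)<\infty$ and $\mathcal{E}_\Omega(u)\le\mathcal{E}_\Omega(v)$ for every $v$ with $v-u\in H^1_0(\Omega)$ (for $\sigma\in(0,1)$ also $v=u$ outside $\Omega$). *)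

theory Defs
  imports "HOL-Analysis.Analysis"
begin

type_synonym R2 = "real ^ 2"

definition lsc_on :: "real set \<Rightarrow> (real \<Rightarrow> real) \<Rightarrow> bool" where
  "lsc_on S f \<longleftrightarrow> (\<forall>x\<in>S. \<forall>e>0. \<forall>\<^sub>F y in at x within S. f x - e < f y)"

definition C1c :: "R2 set \<Rightarrow> (R2 \<Rightarrow> real) \<Rightarrow> bool" where
  "C1c \<Omega> \<phi> \<longleftrightarrow>
     (\<exists>D :: R2 \<Rightarrow> (R2 \<Rightarrow>\<^sub>L real).
        (\<forall>x. (\<phi> has_derivative blinfun_apply (D x)) (at x)) \<and> continuous_on UNIV D) \<and>
     compact (closure {x. \<phi> x \<noteq> 0}) \<and> closure {x. \<phi> x \<noteq> 0} \<subseteq> \<Omega>"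

definition cgrad :: "(R2 \<Rightarrow> real) \<Rightarrow> R2 \<Rightarrow> R2" where
  "cgrad \<phi> x = (\<chi> i. frechet_derivative \<phi> (at x) (axis i 1))"

definition cdiv :: "(R2 \<Rightarrow> R2) \<Rightarrow> R2 \<Rightarrow> real" where
  "cdiv \<phi> x = (\<Sum>j\<in>UNIV. cgrad (\<lambda>y. \<phi> y $ j) x $ j)"

definition weak_grad :: "R2 set \<Rightarrow> (R2 \<Rightarrow> real) \<Rightarrow> (R2 \<Rightarrow> R2) \<Rightarrow> bool" where
  "weak_grad \<Omega> u g \<longleftrightarrow>
     (\<forall>K. compact K \<and> K \<subseteq> \<Omega> \<longrightarrow>
        set_integrable lebesgue K u \<and> set_integrable lebesgue K g) \<and>
     (\<forall>\<phi>. C1c \<Omega> \<phi> \<longrightarrow> (\<forall>i.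
        (LINT x:\<Omega>|lebesgue. u x * cgrad \<phi> x $ i) = - (LINT x:\<Omega>|lebesgue. g x $ i * \<phi> x)))"

definition dirichlet :: "R2 set \<Rightarrow> (R2 \<Rightarrow> real) \<Rightarrow> ennreal" where
  "dirichlet \<Omega> u =
     (if \<exists>g. weak_grad \<Omega> u g
      then (\<integral>\<^sup>+ x\<in>\<Omega>. ennreal ((norm ((SOME g. weak_grad \<Omega> u g) x))\<^sup>2) \<partial>lebesgue)
      else \<infinity>)"

definition H10 :: "R2 set \<Rightarrow> (R2 \<Rightarrow> real) \<Rightarrow> bool" where
  "H10 \<Omega> w \<longleftrightarrow> w \<in> borel_measurable lebesgue \<and>
     (\<exists>g. weak_grad \<Omega> w g \<and>
       (\<exists>\<phi> :: nat \<Rightarrow> R2 \<Rightarrow> real. (\<forall>k. C1c \<Omega> (\<phi> k)) \<and>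
          (\<lambda>k. \<integral>\<^sup>+ x\<in>\<Omega>. ennreal ((\<phi> k x - w x)\<^sup>2 + (norm (cgrad (\<phi> k) x - g x))\<^sup>2) \<partial>lebesgue)
            \<longlonglongrightarrow> 0))"

definition Per1 :: "R2 set \<Rightarrow> R2 set \<Rightarrow> ennreal" where
  "Per1 E \<Omega> = (SUP \<phi> \<in> {\<phi> :: R2 \<Rightarrow> R2. (\<forall>j. C1c \<Omega> (\<lambda>x. \<phi> x $ j)) \<and> (\<forall>x. norm (\<phi> x) \<le> 1)}.
                   ennreal (LINT x:(E \<inter> \<Omega>)|lebesgue. cdiv \<phi> x))"

definition Sint :: "real \<Rightarrow> R2 set \<Rightarrow> R2 set \<Rightarrow> ennreal" where
  "Sint \<sigma> E F = ennreal (\<sigma> * (1 - \<sigma>)) *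
     (\<integral>\<^sup>+ x. \<integral>\<^sup>+ y. indicator E x * indicator F y * ennreal (dist x y powr (- (2 + \<sigma>))) \<partial>lebesgue \<partial>lebesgue)"

definition Per_frac :: "real \<Rightarrow> R2 set \<Rightarrow> R2 set \<Rightarrow> ennreal" where
  "Per_frac \<sigma> E \<Omega> = Sint \<sigma> E (- E \<inter> \<Omega>) + Sint \<sigma> (E \<inter> \<Omega>) (- E \<inter> - \<Omega>)"

definition Per :: "real \<Rightarrow> R2 set \<Rightarrow> R2 set \<Rightarrow> ennreal" where
  "Per \<sigma> E \<Omega> = (if \<sigma> = 1 then Per1 E \<Omega> else Per_frac \<sigma> E \<Omega>)"

definition energy :: "(real \<Rightarrow> real) \<Rightarrow> real \<Rightarrow> R2 set \<Rightarrow> (R2 \<Rightarrow> real) \<Rightarrow> ennreal" where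
  "energy \<Phi> \<sigma> \<Omega> v = dirichlet \<Omega> v +
     (let P = Per \<sigma> {x. v x > 0} \<Omega> in if P = \<infinity> then \<infinity> else ennreal (\<Phi> (enn2real P)))"

definition minimizer :: "(real \<Rightarrow> real) \<Rightarrow> real \<Rightarrow> R2 set \<Rightarrow> (R2 \<Rightarrow> real) \<Rightarrow> bool" where
  "minimizer \<Phi> \<sigma> \<Omega> u \<longleftrightarrow> u \<in> borel_measurable lebesgue \<and> energy \<Phi> \<sigma> \<Omega> u < \<infinity> \<and>
     (\<forall>v. H10 \<Omega> (\<lambda>x. v x - u x) \<and> (\<sigma> < 1 \<longrightarrow> (\<forall>x. x \<notin> \<Omega> \<longrightarrow> v x = u x))
          \<longrightarrow> energy \<Phi> \<sigma> \<Omega> u \<le> energy \<Phi> \<sigma> \<Omega> v)"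

end

theory Submission
  imports Defs
begin

text \<open>
  Take the harmonic function \<open>u = exp (k x\<^sub>1) sin (k x\<^sub>2)\<close>, whose positivity set is a union of stripes
  of width \<open>\<pi> / k\<close>. For large \<open>k\<close> the stripes have so much perimeter inside the square
  \<open>Q = [-1, 1]\<^sup>2\<close> that removing \<open>Q\<close> from them lowers the perimeter in the ball \<open>B\<^sub>3\<close>, say to \<open>a\<close>.
  The cost function jumps at \<open>a\<close> from \<open>0\<close> to a number \<open>M\<close> exceeding the Dirichlet energy in \<open>B\<^sub>3\<close>
  of some \<open>v\<close> with positivity set \<open>{u > 0} - Q\<close> and \<open>v - u \<in> C\<^sub>c\<^sup>1(B\<^sub>3)\<close>; it stays
  equal to \<open>M\<close> up to the perimeter of the stripes in \<open>B\<^sub>R\<close>. Then \<open>v\<close> beats \<open>u\<close> in \<open>B\<^sub>3\<close>.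

  In \<open>B\<^sub>R\<close> a competitor \<open>u + w\<close> has Dirichlet energy \<open>D(u) + D(w)\<close>, because \<open>u\<close> is harmonic. It
  can only win if its perimeter is at most \<open>a\<close> and \<open>D(w) < M\<close>, which is impossible for large \<open>R\<close>:
  if \<open>\<sigma> = 1\<close>, the Poincare inequality makes \<open>w\<close> negligible compared with the exponentially
  large \<open>u\<close>, so the stripes on the right of \<open>B\<^sub>R\<close> survive; if \<open>\<sigma> < 1\<close>, the interaction
  with the prescribed exterior stripes alone contributes a multiple of \<open>R\<^bsup>1 - \<sigma>\<^esup>\<close>.

  All estimates of classical perimeters reduce to \<open>\<integral> \<partial>\<^sub>i f = 0\<close> for \<open>f \<in> C\<^sub>c\<^sup>1\<close>.
\<close>

section \<open>Continuously differentiable functions and integration by parts\<close>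

text \<open>The obstacle is that a competitor is constrained only through its boundary data, so the
  lower bound on its perimeter has to be extracted from those data. For \<sigma> < 1 two boxes of
  size R by pi/k outside the ball, one in a stripe and one in a gap, are at distance of order R from
  every point of the ball: each point interacts with one of them, and the total has order
  R^(3-(2+\<sigma>)). This stops growing at \<sigma> = 1, where moreover the perimeter in an open
  ball sees no exterior at all. There the exponential factor, which makes sin(k x2) harmonic, also
  protects the sign pattern: \<open>w\<close> is bounded in L2 by a multiple of R only.

  The parameters are fixed in a definite order: \<open>k\<close> from the price of cutting out the
  square, \<open>a\<close> and \<open>M\<close> from the ball of radius 3, then R, and only then
  \<open>T\<close>, the perimeter of the stripes in the large ball. In the large ball
  \<open>u\<close> pays at most M for its perimeter, whatever that perimeter is; in the small ball
  it pays at least M.\<close>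

definition has_C1_grad :: "(R2 \<Rightarrow> real) \<Rightarrow> (R2 \<Rightarrow> R2) \<Rightarrow> bool" where
  "has_C1_grad f G \<longleftrightarrow>
     (\<forall>x. (f has_derivative (\<lambda>h. G x \<bullet> h)) (at x)) \<and> continuous_on UNIV G"

lemma has_C1_grad_cgrad:
  assumes "has_C1_grad f G"
  shows "cgrad f = G"
proof
  fix x
  have "frechet_derivative f (at x) = (\<lambda>h. G x \<bullet> h)"
    using assms unfolding has_C1_grad_def by (intro frechet_derivative_at[symmetric]) blast
  then show "cgrad f x = G x"
    by (simp add: cgrad_def vec_eq_iff inner_axis)
qed

lemma has_C1_grad_imp_cgrad:
  "has_C1_grad f G \<Longrightarrow> has_C1_grad f (cgrad f)"
  using has_C1_grad_cgrad by blast

lemma has_C1_grad_continuous: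
  assumes "has_C1_grad f G"
  shows "continuous_on UNIV f"
proof (rule continuous_at_imp_continuous_on, rule ballI)
  fix x
  have "(f has_derivative (\<lambda>h. G x \<bullet> h)) (at x)" using assms unfolding has_C1_grad_def by blast
  then show "isCont f x" by (rule has_derivative_continuous)
qed

text \<open>\<open>C1c\<close> stores the derivative as a bounded operator; a gradient vector
  carries the same information and is what the product rule and \<open>cgrad\<close> compute
  with.\<close>

lemma C1c_iff:
  "C1c \<Omega> \<phi> \<longleftrightarrow> (\<exists>G. has_C1_grad \<phi> G) \<and> compact (closure {x. \<phi> x \<noteq> 0}) \<and>
     closure {x. \<phi> x \<noteq> 0} \<subseteq> \<Omega>"
proof -
  have "(\<exists>D :: R2 \<Rightarrow> (R2 \<Rightarrow>\<^sub>L real).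
        (\<forall>x. (\<phi> has_derivative blinfun_apply (D x)) (at x)) \<and> continuous_on UNIV D)
      \<longleftrightarrow> (\<exists>G. has_C1_grad \<phi> G)" (is "?L \<longleftrightarrow> ?R")
  proof
    assume ?L
    then obtain D where D: "\<And>x. (\<phi> has_derivative blinfun_apply (D x)) (at x)"
      "continuous_on UNIV D" by blast
    define G :: "R2 \<Rightarrow> R2" where "G x = (\<chi> i. blinfun_apply (D x) (axis i 1))" for x
    have "blinfun_apply (D x) h = G x \<bullet> h" for x h
    proof -
      have "blinfun_apply (D x) h = blinfun_apply (D x) (\<Sum>i\<in>UNIV. h $ i *\<^sub>R axis i 1)"
        by (simp add: basis_expansion flip: scalar_mult_eq_scaleR)
      also have "\<dots> = (\<Sum>i\<in>UNIV. h $ i * blinfun_apply (D x) (axis i 1))"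
        by (simp add: blinfun.sum_right blinfun.scaleR_right)
      also have "\<dots> = G x \<bullet> h"
        by (simp add: G_def inner_vec_def mult.commute)
      finally show ?thesis .
    qed
    then have "blinfun_apply (D x) = (\<lambda>h. G x \<bullet> h)" for x by auto
    moreover have "continuous_on UNIV G"
      unfolding G_def by (intro continuous_intros D)
    ultimately show ?R using D(1) unfolding has_C1_grad_def by (metis)
  next
    assume ?R
    then obtain G where G: "\<And>x. (\<phi> has_derivative (\<lambda>h. G x \<bullet> h)) (at x)"
      "continuous_on UNIV G" unfolding has_C1_grad_def by blast
    have "(\<phi> has_derivative blinfun_apply (blinfun_inner_left (G x))) (at x)" for x
      using G(1)[of x] by (simp add: inner_commute)
    moreover have "continuous_on UNIV (\<lambda>x. blinfun_inner_left (G x))"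
      by (intro continuous_intros G)
    ultimately show ?L by (intro exI[of _ "\<lambda>x. blinfun_inner_left (G x)"]) blast
  qed
  then show ?thesis unfolding C1c_def by blast
qed

lemma C1c_has_grad: "C1c \<Omega> \<phi> \<Longrightarrow> has_C1_grad \<phi> (cgrad \<phi>)"
  using C1c_iff has_C1_grad_imp_cgrad by blast

lemma C1c_mono: "C1c \<Omega> \<phi> \<Longrightarrow> \<Omega> \<subseteq> \<Omega>' \<Longrightarrow> C1c \<Omega>' \<phi>"
  unfolding C1c_def by blast

lemma C1cI:
  assumes "has_C1_grad \<phi> G" "compact K" "K \<subseteq> \<Omega>" "\<And>x. x \<notin> K \<Longrightarrow> \<phi> x = 0"
  shows "C1c \<Omega> \<phi>"
proof -
  have "closure {x. \<phi> x \<noteq> 0} \<subseteq> K"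
    using assms by (intro closure_minimal compact_imp_closed) auto
  moreover from this have "compact (closure {x. \<phi> x \<noteq> 0})"
    using compact_Int_closed[OF assms(2) closed_closure, of "{x. \<phi> x \<noteq> 0}"] by (simp add: inf.absorb2)
  ultimately show ?thesis
    unfolding C1c_iff using assms(1,3) by blast
qed

text \<open>The complement of the closed support is open, so the function vanishes near each of its
  points and the gradient is 0 there too. One compact set thus serves both in the integrability
  arguments.\<close>

lemma C1c_support:
  assumes "C1c \<Omega> \<phi>"
  obtains K where "compact K" "K \<subseteq> \<Omega>" "\<And>x. x \<notin> K \<Longrightarrow> \<phi> x = 0" "\<And>x. x \<notin> K \<Longrightarrow> cgrad \<phi> x = 0"
proof (rule that)
  let ?K = "closure {x. \<phi> x \<noteq> 0}"
  show "compact ?K" "?K \<subseteq> \<Omega>" using assms unfolding C1c_def by auto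
  show z: "\<phi> x = 0" if "x \<notin> ?K" for x using that closure_subset[of "{x. \<phi> x \<noteq> 0}"] by blast
  show "cgrad \<phi> x = 0" if "x \<notin> ?K" for x
  proof -
    have "((\<lambda>x. 0 :: real) has_derivative (\<lambda>h. 0)) (at x)" by simp
    then have "(\<phi> has_derivative (\<lambda>h. 0)) (at x)"
    proof (rule has_derivative_transform_within_open[of _ _ x UNIV "- ?K"])
      show "open (- ?K)" by (simp add: open_Compl)
      show "x \<in> - ?K" using that by simp
      show "0 = \<phi> y" if "y \<in> - ?K" for y using z[of y] that by (metis ComplD)
    qed
    then have "frechet_derivative \<phi> (at x) = (\<lambda>h. 0)"
      by (rule frechet_derivative_at[symmetric])
    then show ?thesis by (simp add: cgrad_def vec_eq_iff)
  qed
qed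

lemma has_C1_grad_mult:
  assumes "has_C1_grad f F" "has_C1_grad g G"
  shows "has_C1_grad (\<lambda>x. f x * g x) (\<lambda>x. f x *\<^sub>R G x + g x *\<^sub>R F x)"
proof -
  have "((\<lambda>x. f x * g x) has_derivative (\<lambda>h. (f x *\<^sub>R G x + g x *\<^sub>R F x) \<bullet> h)) (at x)" for x
  proof -
    have "((\<lambda>x. f x * g x) has_derivative (\<lambda>h. f x * (G x \<bullet> h) + (F x \<bullet> h) * g x)) (at x)"
      using assms unfolding has_C1_grad_def by (intro has_derivative_mult) auto
    then show ?thesis by (simp add: inner_add_left mult.commute)
  qed
  moreover have "continuous_on UNIV (\<lambda>x. f x *\<^sub>R G x + g x *\<^sub>R F x)"
    using assms by (intro continuous_intros) (auto simp: has_C1_grad_def intro: has_C1_grad_continuous[OF assms(1)] has_C1_grad_continuous[OF assms(2)])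
  ultimately show ?thesis unfolding has_C1_grad_def by blast
qed

lemma has_C1_grad_add:
  assumes "has_C1_grad f F" "has_C1_grad g G"
  shows "has_C1_grad (\<lambda>x. f x + g x) (\<lambda>x. F x + G x)"
  unfolding has_C1_grad_def inner_add_left
proof (intro conjI allI)
  show "((\<lambda>x. f x + g x) has_derivative (\<lambda>h. F x \<bullet> h + G x \<bullet> h)) (at x)" for x
    by (rule has_derivative_add) (use assms in \<open>simp_all only: has_C1_grad_def\<close>)
  show "continuous_on UNIV (\<lambda>x. F x + G x)"
    by (rule continuous_on_add) (use assms in \<open>simp_all only: has_C1_grad_def\<close>)
qed

lemma has_C1_grad_const: "has_C1_grad (\<lambda>x. c) (\<lambda>x. 0)"
  unfolding has_C1_grad_def by (simp add: inner_zero_left[abs_def])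

lemma has_C1_grad_minus:
  assumes "has_C1_grad f F"
  shows "has_C1_grad (\<lambda>x. - f x) (\<lambda>x. - F x)"
  using has_C1_grad_mult[OF has_C1_grad_const assms, of "-1"] by simp

lemma has_C1_grad_compose:
  assumes "has_C1_grad f F" "\<And>t. (p has_real_derivative p' t) (at t)" "continuous_on UNIV p'"
  shows "has_C1_grad (\<lambda>x. p (f x)) (\<lambda>x. p' (f x) *\<^sub>R F x)"
proof -
  have "((\<lambda>x. p (f x)) has_derivative (\<lambda>h. (p' (f x) *\<^sub>R F x) \<bullet> h)) (at x)" for x
  proof -
    have "((\<lambda>x. p (f x)) has_derivative (\<lambda>h. p' (f x) * (F x \<bullet> h))) (at x)"
      using assms(1,2) unfolding has_C1_grad_def has_field_derivative_def
      by (intro has_derivative_compose[of f _ x UNIV p]) auto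
    then show ?thesis by simp
  qed
  moreover have "continuous_on UNIV (\<lambda>x. p' (f x) *\<^sub>R F x)"
    using assms has_C1_grad_continuous[OF assms(1)]
    by (intro continuous_intros continuous_on_compose2[OF assms(3)]) (auto simp: has_C1_grad_def)
  ultimately show ?thesis unfolding has_C1_grad_def by blast
qed

lemma has_C1_grad_component: "has_C1_grad (\<lambda>x. x $ i) (\<lambda>x. axis i 1)"
  unfolding has_C1_grad_def
proof (intro conjI allI)
  fix x :: R2
  show "((\<lambda>x. x $ i) has_derivative (\<lambda>h. axis i 1 \<bullet> h)) (at x)"
    using bounded_linear_vec_nth[of i] bounded_linear_imp_has_derivative
    by (simp add: inner_axis inner_commute)
qed auto

lemma C1c_mult:
  assumes "has_C1_grad f F" "C1c \<Omega> \<phi>"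
  shows "C1c \<Omega> (\<lambda>x. f x * \<phi> x)"
proof -
  obtain K where "compact K" "K \<subseteq> \<Omega>" "\<And>x. x \<notin> K \<Longrightarrow> \<phi> x = 0"
    using C1c_support[OF assms(2)] by metis
  then show ?thesis
    using has_C1_grad_mult[OF assms(1) C1c_has_grad[OF assms(2)]] by (intro C1cI) auto
qed

lemma C1c_0: "C1c \<Omega> (\<lambda>x. 0)"
  by (rule C1cI[OF has_C1_grad_const, of "{}"]) auto

lemma C1c_minus: "C1c \<Omega> \<phi> \<Longrightarrow> C1c \<Omega> (\<lambda>x. - \<phi> x)"
  using C1c_mult[OF has_C1_grad_const, of \<Omega> \<phi> "-1"] by simp

lemma C1c_add:
  assumes "C1c \<Omega> \<phi>" "C1c \<Omega> \<psi>"
  shows "C1c \<Omega> (\<lambda>x. \<phi> x + \<psi> x)"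
proof -
  obtain K where K: "compact K" "K \<subseteq> \<Omega>" "\<And>x. x \<notin> K \<Longrightarrow> \<phi> x = 0"
    using C1c_support[OF assms(1)] by metis
  obtain L where L: "compact L" "L \<subseteq> \<Omega>" "\<And>x. x \<notin> L \<Longrightarrow> \<psi> x = 0"
    using C1c_support[OF assms(2)] by metis
  show ?thesis
    by (rule C1cI[OF has_C1_grad_add[OF C1c_has_grad[OF assms(1)] C1c_has_grad[OF assms(2)]], of "K \<union> L"])
      (use K L in auto)
qed

section \<open>Integrability of continuous functions with compact support\<close>

lemma integrable_cont_compact_support:
  fixes f :: "R2 \<Rightarrow> 'b::euclidean_space"
  assumes "continuous_on UNIV f" "compact K" "\<And>x. x \<notin> K \<Longrightarrow> f x = 0"
  shows "integrable lebesgue f"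
proof -
  obtain a where a: "K \<subseteq> cbox (- a) a"
    using assms(2) compact_imp_bounded bounded_subset_cbox_symmetric by metis
  have "f absolutely_integrable_on cbox (- a) a"
    using assms(1) by (intro absolutely_integrable_continuous) (auto intro: continuous_on_subset)
  moreover have "(\<lambda>x. indicat_real (cbox (- a) a) x *\<^sub>R f x) = f"
    using assms(3) a by (fastforce simp: indicator_def)
  ultimately show ?thesis unfolding set_integrable_def by simp
qed

lemma continuous_cgrad: "has_C1_grad f G \<Longrightarrow> continuous_on UNIV (cgrad f)"
  using has_C1_grad_imp_cgrad unfolding has_C1_grad_def by blast

lemma continuous_cgrad_nth: "has_C1_grad f G \<Longrightarrow> continuous_on UNIV (\<lambda>x. cgrad f x $ i)"
  by (intro continuous_intros continuous_cgrad)

lemma C1c_integrable: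
  assumes \<phi>: "C1c \<Omega> \<phi>"
  shows "continuous_on UNIV f \<Longrightarrow> integrable lebesgue (\<lambda>x. f x * \<phi> x)"
    and "continuous_on UNIV f \<Longrightarrow> integrable lebesgue (\<lambda>x. f x * cgrad \<phi> x $ i)"
    and "integrable lebesgue \<phi>"
    and "integrable lebesgue (\<lambda>x. \<bar>cgrad \<phi> x $ i\<bar>)"
proof -
  obtain K where K: "compact K" "\<And>x. x \<notin> K \<Longrightarrow> \<phi> x = 0" "\<And>x. x \<notin> K \<Longrightarrow> cgrad \<phi> x = 0"
    using C1c_support[OF \<phi>] by metis
  have c: "continuous_on UNIV \<phi>" "continuous_on UNIV (cgrad \<phi>)"
    using C1c_has_grad[OF \<phi>] by (auto intro: has_C1_grad_continuous continuous_cgrad)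
  show "integrable lebesgue (\<lambda>x. f x * \<phi> x)" "integrable lebesgue (\<lambda>x. f x * cgrad \<phi> x $ i)"
    if "continuous_on UNIV f"
    using that K by (auto intro!: integrable_cont_compact_support[OF _ K(1)] continuous_intros c)
  show "integrable lebesgue \<phi>" "integrable lebesgue (\<lambda>x. \<bar>cgrad \<phi> x $ i\<bar>)"
    using K by (auto intro!: integrable_cont_compact_support[OF _ K(1)] continuous_intros c)
qed

lemma lebesgue_measurable_continuous:
  fixes f :: "R2 \<Rightarrow> 'b::euclidean_space"
  shows "continuous_on UNIV f \<Longrightarrow> f \<in> borel_measurable lebesgue"
  by (intro measurable_completion) (simp add: borel_measurable_continuous_onI)

text \<open>Continuity gives Borel measurability, which reduces the claim to the translation
  invariance of \<open>lborel\<close>.\<close>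

lemma integral_shift_lebesgue:
  fixes f :: "R2 \<Rightarrow> real"
  assumes "continuous_on UNIV f"
  shows "(LINT x|lebesgue. f (c + x)) = (LINT x|lebesgue. f x)"
proof -
  have m: "f \<in> borel_measurable borel" using assms by (rule borel_measurable_continuous_onI)
  have "(LINT x|lebesgue. f x) = (LINT x|distr lborel borel ((+) c). f x)"
    unfolding lborel_distr_plus using m by (intro integral_completion) auto
  also have "\<dots> = (LINT x|lborel. f (c + x))"
    using m by (subst integral_distr) auto
  also have "\<dots> = (LINT x|lebesgue. f (c + x))"
    using m by (intro integral_completion[symmetric]) (auto intro!: measurable_compose[OF _ m])
  finally show ?thesis by simp
qed

lemma bounded_cont_compact_support:
  fixes f :: "'a::topological_space \<Rightarrow> 'b::real_normed_vector"
  assumes "continuous_on UNIV f" "compact K" "\<And>x. x \<notin> K \<Longrightarrow> f x = 0"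
  obtains C where "\<And>x. norm (f x) \<le> C"
proof -
  have "compact (f ` K)"
    using assms(1,2) by (intro compact_continuous_image) (auto intro: continuous_on_subset)
  then obtain C where C: "\<And>y. y \<in> f ` K \<Longrightarrow> norm y \<le> C"
    using compact_imp_bounded bounded_iff by metis
  have "norm (f x) \<le> max C 0" for x
    using C[of "f x"] assms(3)[of x] by (cases "x \<in> K") (auto simp: max.coboundedI1)
  then show ?thesis using that by blast
qed

lemma integrable_mult_cont_compact_support:
  fixes f \<phi> :: "R2 \<Rightarrow> real"
  assumes f: "set_integrable lebesgue K f"
    and \<phi>: "continuous_on UNIV \<phi>" "compact K" "\<And>x. x \<notin> K \<Longrightarrow> \<phi> x = 0"
  shows "integrable lebesgue (\<lambda>x. f x * \<phi> x)"
proof -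
  obtain C where C: "\<And>x. norm (\<phi> x) \<le> C" using bounded_cont_compact_support[OF \<phi>] by metis
  let ?f = "\<lambda>x. indicat_real K x *\<^sub>R f x"
  have int: "integrable lebesgue ?f" using f unfolding set_integrable_def .
  have "integrable lebesgue (\<lambda>x. ?f x * \<phi> x)"
  proof (rule Bochner_Integration.integrable_bound)
    show "integrable lebesgue (\<lambda>x. C * ?f x)" using int by (rule integrable_mult_right)
    show "(\<lambda>x. ?f x * \<phi> x) \<in> borel_measurable lebesgue"
      by (intro borel_measurable_times borel_measurable_integrable[OF int] measurable_completion)
        (simp add: borel_measurable_continuous_onI \<phi>(1))
    show "AE x in lebesgue. norm (?f x * \<phi> x) \<le> norm (C * ?f x)"
    proof (rule AE_I2)
      fix x
      have "norm (\<phi> x) \<le> \<bar>C\<bar>" using C[of x] by linarith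
      then show "norm (?f x * \<phi> x) \<le> norm (C * ?f x)"
        by (simp add: abs_mult mult.commute mult_right_mono)
    qed
  qed
  moreover have "(\<lambda>x. ?f x * \<phi> x) = (\<lambda>x. f x * \<phi> x)"
    using \<phi>(3) by (auto simp: fun_eq_iff indicator_def)
  ultimately show ?thesis by simp
qed

lemma set_integral_support:
  assumes "\<And>x. x \<notin> A \<Longrightarrow> f x = 0"
  shows "(LINT x:A|M. f x) = (LINT x|M. f x)"
  unfolding set_lebesgue_integral_def
  by (rule arg_cong[where f = "integral\<^sup>L M"]) (use assms in \<open>auto simp: indicator_def fun_eq_iff\<close>)

text \<open>The integral is translation invariant, so all difference quotients have integral zero.\<close>
lemma integral_cgrad_eq_0:
  assumes "C1c \<Omega> f"
  shows "(LINT x|lebesgue. cgrad f x $ i) = 0"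
proof -
  obtain K where K: "compact K" "\<And>x. x \<notin> K \<Longrightarrow> f x = 0" "\<And>x. x \<notin> K \<Longrightarrow> cgrad f x = 0"
    using C1c_support[OF assms] by metis
  have C1: "has_C1_grad f (cgrad f)" using assms by (rule C1c_has_grad)
  have cf: "continuous_on UNIV f" using C1 by (rule has_C1_grad_continuous)
  have int_f: "integrable lebesgue f"
    using integrable_cont_compact_support[OF cf K(1,2)] .
  obtain B where B: "\<And>x. x \<in> K \<Longrightarrow> norm x \<le> B"
    using K(1) compact_imp_bounded bounded_iff by metis
  obtain C where C: "\<And>x. norm (cgrad f x) \<le> C"
    using bounded_cont_compact_support[OF continuous_cgrad[OF C1] K(1,3)] by metis
  let ?e = "axis i 1 :: R2"
  define q where "q n x = real (Suc n) * (f (inverse (real (Suc n)) *\<^sub>R ?e + x) - f x)" for n x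
  have cs: "continuous_on UNIV (\<lambda>x. f (c + x))" for c
    by (intro continuous_on_compose2[OF cf] continuous_intros) auto
  have "integrable lebesgue (\<lambda>x. f (c + x))" for c
    using cs
  proof (rule integrable_cont_compact_support)
    show "compact ((\<lambda>x. x - c) ` K)" using K(1) by (intro compact_continuous_image continuous_intros)
    show "f (c + x) = 0" if "x \<notin> (\<lambda>x. x - c) ` K" for x
    proof (rule K(2), rule)
      assume "c + x \<in> K"
      then show False using that by (auto simp: image_iff dest!: bspec[of _ _ "c + x"])
    qed
  qed
  then have "(LINT x|lebesgue. q n x) = 0" for n
    unfolding q_def using int_f integral_shift_lebesgue[OF cf] by simp
  moreover have "(\<lambda>n. LINT x|lebesgue. q n x) \<longlonglongrightarrow> (LINT x|lebesgue. cgrad f x $ i)"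
  proof (rule integral_dominated_convergence)
    show "(\<lambda>x. cgrad f x $ i) \<in> borel_measurable lebesgue"
      using continuous_cgrad_nth[OF C1] by (rule lebesgue_measurable_continuous)
    show "q n \<in> borel_measurable lebesgue" for n
      unfolding q_def by (intro lebesgue_measurable_continuous continuous_intros cs cf)
    \<comment> \<open>One dominating function for all difference quotients: the shifts have length
      at most 1, so every \<open>q n\<close> vanishes outside the ball of radius
      \<open>B + 1\<close>, and the mean value inequality bounds it by \<open>C\<close>.\<close>
    show "integrable lebesgue (\<lambda>x::R2. indicat_real (cball 0 (B + 1)) x *\<^sub>R C)"
      using absolutely_integrable_on_const[of "cball 0 (B + 1) :: R2 set" C]
      unfolding set_integrable_def by (simp add: lmeasurable_cball)
    show "AE x in lebesgue. (\<lambda>n. q n x) \<longlonglongrightarrow> cgrad f x $ i"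
    proof (rule AE_I2)
      fix x
      have "((\<lambda>t. f (t *\<^sub>R ?e + x)) has_derivative (\<lambda>t. cgrad f x \<bullet> (t *\<^sub>R ?e))) (at 0)"
      proof (rule has_derivative_compose[of "\<lambda>t. t *\<^sub>R ?e + x" _ 0 UNIV f])
        show "((\<lambda>t. t *\<^sub>R ?e + x) has_derivative (\<lambda>t. t *\<^sub>R ?e)) (at 0)"
          by (auto intro!: derivative_eq_intros)
      qed (use C1 in \<open>auto simp: has_C1_grad_def\<close>)
      then have "((\<lambda>t. f (t *\<^sub>R ?e + x)) has_real_derivative cgrad f x $ i) (at 0)"
        unfolding has_field_derivative_def by (simp add: inner_axis mult_commute_abs)
      then have "((\<lambda>h. (f (h *\<^sub>R ?e + x) - f x) / h) \<longlongrightarrow> cgrad f x $ i) (at 0)"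
        by (simp add: DERIV_def)
      moreover have "filterlim (\<lambda>n. inverse (real (Suc n))) (at 0) sequentially"
        using LIMSEQ_inverse_real_of_nat by (auto simp: filterlim_at)
      ultimately have "(\<lambda>n. (f (inverse (real (Suc n)) *\<^sub>R ?e + x) - f x) / inverse (real (Suc n))) \<longlonglongrightarrow> cgrad f x $ i"
        using filterlim_compose by blast
      then show "(\<lambda>n. q n x) \<longlonglongrightarrow> cgrad f x $ i"
        unfolding q_def by (simp add: field_simps)
    qed
    show "AE x in lebesgue. norm (q n x) \<le> indicat_real (cball 0 (B + 1)) x *\<^sub>R C" for n
    proof (rule AE_I2)
      fix x
      let ?h = "inverse (real (Suc n)) *\<^sub>R ?e"
      have nh: "norm ?h = inverse (real (Suc n))" by simp
      have "norm (f (?h + x) - f x) \<le> C * norm ((?h + x) - x)"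
      proof (rule differentiable_bound[of UNIV f "\<lambda>x h. cgrad f x \<bullet> h"])
        show "onorm ((\<bullet>) (cgrad f y)) \<le> C" for y
        proof (rule onorm_le)
          fix h
          have "\<bar>cgrad f y \<bullet> h\<bar> \<le> norm (cgrad f y) * norm h" by (rule Cauchy_Schwarz_ineq2)
          also have "\<dots> \<le> C * norm h" by (intro mult_right_mono C) simp
          finally show "norm (cgrad f y \<bullet> h) \<le> C * norm h" by simp
        qed
      qed (use C1 in \<open>auto simp: has_C1_grad_def intro: has_derivative_at_withinI\<close>)
      then have "norm (q n x) \<le> C"
        unfolding q_def using nh by (simp add: abs_mult del: of_nat_Suc) (simp add: field_simps del: of_nat_Suc)
      moreover have "q n x = 0" if "x \<notin> cball 0 (B + 1)"
      proof -
        have x: "norm x > B + 1" using that by simp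
        have "norm ?h \<le> 1" unfolding nh by (simp add: inverse_le_1_iff)
        then have "norm (?h + x) > B" using x norm_triangle_ineq4[of "?h + x" ?h] by auto
        then have "?h + x \<notin> K" "x \<notin> K" using B x by fastforce+
        then show ?thesis unfolding q_def using K(2) by simp
      qed
      ultimately show "norm (q n x) \<le> indicat_real (cball 0 (B + 1)) x *\<^sub>R C"
        by (auto simp: indicator_def)
    qed
  qed
  ultimately show ?thesis by (simp add: LIMSEQ_const_iff)
qed

text \<open>\<open>integral_cgrad_eq_0\<close> applied to the product, whose support is compact
  because that of one factor is.\<close>

lemma integral_by_parts:
  assumes "has_C1_grad f F" "C1c \<Omega> \<phi>"
  shows "(LINT x|lebesgue. f x * cgrad \<phi> x $ i) = - (LINT x|lebesgue. F x $ i * \<phi> x)"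
    and "integrable lebesgue (\<lambda>x. f x * cgrad \<phi> x $ i)"
    and "integrable lebesgue (\<lambda>x. F x $ i * \<phi> x)"
proof -
  have \<phi>: "has_C1_grad \<phi> (cgrad \<phi>)" using assms(2) by (rule C1c_has_grad)
  show 1: "integrable lebesgue (\<lambda>x. f x * cgrad \<phi> x $ i)"
    by (rule C1c_integrable(2)[OF assms(2) has_C1_grad_continuous[OF assms(1)]])
  show 2: "integrable lebesgue (\<lambda>x. F x $ i * \<phi> x)"
    using assms(1) by (intro C1c_integrable[OF assms(2)] continuous_intros) (simp add: has_C1_grad_def)
  have "cgrad (\<lambda>x. f x * \<phi> x) = (\<lambda>x. f x *\<^sub>R cgrad \<phi> x + \<phi> x *\<^sub>R F x)"
    using has_C1_grad_mult[OF assms(1) \<phi>] by (rule has_C1_grad_cgrad)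
  then have "(LINT x|lebesgue. f x * cgrad \<phi> x $ i + F x $ i * \<phi> x) = 0"
    using integral_cgrad_eq_0[OF C1c_mult[OF assms], of i] by (simp add: mult.commute)
  then show "(LINT x|lebesgue. f x * cgrad \<phi> x $ i) = - (LINT x|lebesgue. F x $ i * \<phi> x)"
    using 1 2 by simp
qed

section \<open>Cutoff functions\<close>

text \<open>Squaring makes the positive part continuously differentiable. Test functions are C1, so
  piecewise polynomials can serve as cutoffs.\<close>

definition sq_pos :: "real \<Rightarrow> real" where "sq_pos t = (max 0 t)\<^sup>2"

lemma sq_pos_deriv: "(sq_pos has_real_derivative 2 * max 0 t) (at t)"
proof -
  consider "t < 0" | "t = 0" | "t > 0" by linarith
  then show ?thesis
  proof cases
    case 1
    have "((\<lambda>x. 0) has_real_derivative 2 * max 0 t) (at t)" using 1 by simp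
    then show ?thesis
      by (rule has_field_derivative_transform_within_open[of _ _ _ "{..<0}"])
        (use 1 in \<open>auto simp: sq_pos_def\<close>)
  next
    case 2
    have "((\<lambda>h. (sq_pos (0 + h) - sq_pos 0) / h) \<longlongrightarrow> 0) (at 0)"
    proof (rule tendsto_0_le[of "\<lambda>h. h" _ _ 1])
      show "\<forall>\<^sub>F x in at 0. norm ((sq_pos (0 + x) - sq_pos 0) / x) \<le> norm x * (1::real)"
        by (rule always_eventually) (auto simp: sq_pos_def power2_eq_square max_def)
    qed (auto intro: tendsto_ident_at)
    then show ?thesis using 2 by (simp add: DERIV_def)
  next
    case 3
    have "((\<lambda>x. x\<^sup>2) has_real_derivative 2 * max 0 t) (at t)"
      using 3 by (auto intro!: derivative_eq_intros)
    then show ?thesis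
      by (rule has_field_derivative_transform_within_open[of _ _ _ "{0<..}"])
        (use 3 in \<open>auto simp: sq_pos_def\<close>)
  qed
qed

text \<open>A C1 step from 0 on the nonpositive axis to 1 beyond 1. It is positive at every positive
  argument, so its zero set is known exactly; the shape of the hole dug into the stripes relies on
  that.\<close>

definition sstep :: "real \<Rightarrow> real" where "sstep t = 1 - sq_pos (1 - sq_pos t)"

definition sstep' :: "real \<Rightarrow> real" where
  "sstep' t = 4 * max 0 (1 - sq_pos t) * max 0 t"

lemma sstep_deriv: "(sstep has_real_derivative sstep' t) (at t)"
proof -
  have "((\<lambda>x. sq_pos (1 - sq_pos x)) has_real_derivative
      (2 * max 0 (1 - sq_pos t)) * (- (2 * max 0 t))) (at t)"
    by (rule DERIV_chain2[OF sq_pos_deriv]) (auto intro!: derivative_eq_intros sq_pos_deriv)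
  then show ?thesis
    unfolding sstep_def[abs_def] sstep'_def by (auto intro!: derivative_eq_intros)
qed

lemma continuous_sstep': "continuous_on UNIV sstep'"
  unfolding sstep'_def[abs_def] sq_pos_def by (intro continuous_intros)

lemma sstep_eq_0: "t \<le> 0 \<Longrightarrow> sstep t = 0"
  by (simp add: sstep_def sq_pos_def)

lemma sstep_eq_1:
  assumes "t \<ge> 1" shows "sstep t = 1"
proof -
  have "t\<^sup>2 \<ge> 1" using assms by simp
  then show ?thesis using assms by (simp add: sstep_def sq_pos_def)
qed

lemma sstep_pos: "t > 0 \<Longrightarrow> sstep t > 0"
proof -
  assume "t > 0"
  then have "max 0 (1 - t\<^sup>2) < 1" by simp
  then have "(max 0 (1 - t\<^sup>2))\<^sup>2 < 1\<^sup>2" by (intro power_strict_mono) auto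
  then show ?thesis using \<open>t > 0\<close> by (simp add: sstep_def sq_pos_def)
qed

lemma sstep_nonneg: "0 \<le> sstep t"
  using sstep_pos[of t] sstep_eq_0[of t] by fastforce

lemma sstep_le_1: "sstep t \<le> 1"
  by (simp add: sstep_def sq_pos_def)

lemma sstep'_nonneg: "0 \<le> sstep' t"
  by (simp add: sstep'_def)

lemma sstep'_eq_0: "t \<le> 0 \<or> t \<ge> 1 \<Longrightarrow> sstep' t = 0"
proof -
  assume "t \<le> 0 \<or> t \<ge> 1"
  moreover have "t\<^sup>2 \<ge> 1" if "t \<ge> 1" using that by simp
  ultimately show ?thesis by (auto simp: sstep'_def sq_pos_def)
qed

lemma sstep'_le: "sstep' t \<le> 4"
proof (cases "0 < t \<and> t < 1")
  case True
  have "max 0 (1 - sq_pos t) * max 0 t \<le> 1 * 1"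
    using True by (intro mult_mono) (auto simp: sq_pos_def)
  then show ?thesis by (simp add: sstep'_def)
next
  case False
  then have "t \<le> 0 \<or> t \<ge> 1" by linarith
  then show ?thesis using sstep'_eq_0 by simp
qed

lemma has_C1_grad_sstep:
  "has_C1_grad f F \<Longrightarrow> has_C1_grad (\<lambda>x. sstep (f x)) (\<lambda>x. sstep' (f x) *\<^sub>R F x)"
  by (rule has_C1_grad_compose) (auto intro: sstep_deriv continuous_sstep')

lemma has_C1_grad_affine:
  "has_C1_grad (\<lambda>x. c * (x $ i - d)) (\<lambda>x. c *\<^sub>R axis i 1)"
proof -
  have "((\<lambda>t. c * (t - d)) has_real_derivative c) (at t)" for t
    by (auto intro!: derivative_eq_intros)
  from has_C1_grad_compose[OF has_C1_grad_component this, of i] show ?thesis by simp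
qed

text \<open>The transition layers have width \<open>1 / m\<close> and lie inside the box, so the
  support stays in the closed box for every steepness \<open>m\<close> > 0.\<close>

definition box_cutoff :: "R2 \<Rightarrow> R2 \<Rightarrow> real \<Rightarrow> R2 \<Rightarrow> real" where
  "box_cutoff a b m x = (sstep (m * (x $ 1 - a $ 1)) * sstep (m * (b $ 1 - x $ 1))) *
     (sstep (m * (x $ 2 - a $ 2)) * sstep (m * (b $ 2 - x $ 2)))"

lemma box_cutoff_bounds: "0 \<le> box_cutoff a b m x" "box_cutoff a b m x \<le> 1"
  unfolding box_cutoff_def by (auto intro!: mult_le_one mult_nonneg_nonneg sstep_nonneg sstep_le_1)

lemma mem_box_2: "x \<in> box a (b::R2) \<longleftrightarrow> a $ 1 < x $ 1 \<and> x $ 1 < b $ 1 \<and> a $ 2 < x $ 2 \<and> x $ 2 < b $ 2"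
  by (auto simp: mem_box_cart forall_2)

lemma mem_cbox_2: "x \<in> cbox a (b::R2) \<longleftrightarrow> a $ 1 \<le> x $ 1 \<and> x $ 1 \<le> b $ 1 \<and> a $ 2 \<le> x $ 2 \<and> x $ 2 \<le> b $ 2"
  by (auto simp: mem_box_cart forall_2)

lemma box_cutoff_C1c:
  assumes "cbox a b \<subseteq> \<Omega>" "m > 0"
  shows "C1c \<Omega> (box_cutoff a b m)"
proof (rule C1cI)
  have *: "has_C1_grad (\<lambda>x. m * (b $ i - x $ i)) (\<lambda>x. (- m) *\<^sub>R axis i 1)" for i
    using has_C1_grad_affine[of "-m" i "b $ i"] by (simp add: algebra_simps)
  show "has_C1_grad (box_cutoff a b m) (cgrad (box_cutoff a b m))"
    unfolding box_cutoff_def[abs_def]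
    by (rule has_C1_grad_imp_cgrad, (rule has_C1_grad_affine * has_C1_grad_sstep has_C1_grad_mult)+)
  show "box_cutoff a b m x = 0" if "x \<notin> cbox a b" for x
  proof -
    have "m * (x $ 1 - a $ 1) \<le> 0 \<or> m * (b $ 1 - x $ 1) \<le> 0 \<or> m * (x $ 2 - a $ 2) \<le> 0 \<or> m * (b $ 2 - x $ 2) \<le> 0"
      using that assms(2) by (auto simp: mem_cbox_2 mult_le_0_iff)
    then show ?thesis unfolding box_cutoff_def by (auto simp: sstep_eq_0)
  qed
qed (use assms in auto)

text \<open>At \<open>t = 0\<close> every term is 0, so such limits are indicators of open sets:
  open boxes first, the open stripes later.\<close>

lemma tendsto_sstep_mult:
  "(\<lambda>n. sstep (real n * t)) \<longlonglongrightarrow> (if t > 0 then 1 else 0)"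
proof (cases "t > 0")
  case True
  then obtain N :: nat where N: "1 / t < N" using reals_Archimedean2 by blast
  have "\<forall>\<^sub>F n in sequentially. sstep (real n * t) = 1"
    unfolding eventually_sequentially
  proof (intro exI allI impI)
    fix n assume "N \<le> n"
    then have "1 / t \<le> real n" using N by linarith
    then show "sstep (real n * t) = 1" using True by (intro sstep_eq_1) (simp add: field_simps)
  qed
  then show ?thesis using True by (simp add: tendsto_eventually)
next
  case False
  then have "sstep (real n * t) = 0" for n by (intro sstep_eq_0) (simp add: mult_nonneg_nonpos)
  then show ?thesis using False by simp
qed

lemma tendsto_box_cutoff: "(\<lambda>n. box_cutoff a b (real n) x) \<longlonglongrightarrow> indicator (box a b) x"
proof -
  have "(\<lambda>n. box_cutoff a b (real n) x) \<longlonglongrightarrow>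
    ((if x $ 1 - a $ 1 > 0 then 1 else 0) * (if b $ 1 - x $ 1 > 0 then 1 else 0)) *
    ((if x $ 2 - a $ 2 > 0 then 1 else 0) * (if b $ 2 - x $ 2 > 0 then 1 else 0))"
    unfolding box_cutoff_def by (intro tendsto_mult tendsto_sstep_mult)
  then show ?thesis by (auto simp: indicator_def mem_box_2 split: if_splits)
qed

text \<open>Open boxes generate the Borel sets and are stable under intersection, so a Dynkin
  argument spreads the vanishing to all Borel sets; up to null sets these are all Lebesgue
  sets.\<close>

lemma integral_0_on_boxes_imp_AE_0:
  fixes h :: "R2 \<Rightarrow> real"
  assumes int: "integrable lebesgue h"
    and box0: "\<And>a b. (LINT x:box a b|lebesgue. h x) = 0"
  shows "AE x in lebesgue. h x = 0"
proof -
  have meas0: "(LINT x:A|lebesgue. h x) = 0" if "A \<in> sets borel" for A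
  proof -
    let ?G = "range (\<lambda>(a, b). box a b :: R2 set)"
    have si: "set_integrable lebesgue A h" if "A \<in> sets lebesgue" for A
      unfolding set_integrable_def using int that by (rule integrable_mult_indicator[rotated])
    have sub: "A \<in> sets lebesgue" if "A \<in> sigma_sets UNIV ?G" for A
      using that sets_completionI_sets[of A lborel] by (simp add: borel_eq_box)
    have st: "Int_stable ?G"
    proof (rule Int_stableI)
      fix A B assume "A \<in> ?G" "B \<in> ?G"
      then obtain a b c d where "A = box a b" "B = box c d" by auto
      then have "A \<inter> B = box (\<chi> i. max (a $ i) (c $ i)) (\<chi> i. min (b $ i) (d $ i))"
        by (auto simp: mem_box_2)
      then show "A \<inter> B \<in> ?G" by auto
    qed
    have G: "?G \<subseteq> Pow UNIV" "A \<in> sigma_sets UNIV ?G" using that by (auto simp: borel_eq_box)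
    from st G show ?thesis
    proof (induction rule: sigma_sets_induct_disjoint)
      case (basic A)
      then show ?case using box0 by auto
    next
      case empty
      show ?case by (simp add: set_lebesgue_integral_def)
    next
      case (compl A)
      \<comment> \<open>Passing to complements requires the integral over the whole plane, which is
        the limit over growing boxes.\<close>
      have "(\<lambda>n. LINT x:box (- (\<chi> i. real n)) (\<chi> i. real n)|lebesgue. h x) \<longlonglongrightarrow>
        (LINT x:(\<Union>n. box (- (\<chi> i. real n)) (\<chi> i. real n))|lebesgue. h x)"
      proof (rule set_integral_cont_up)
        show "incseq (\<lambda>n. box (- (\<chi> i. real n)) (\<chi> i. real n) :: R2 set)"
          by (auto simp: incseq_def mem_box_2)
      qed (auto intro!: si)
      moreover have "(\<Union>n. box (- (\<chi> i. real n)) (\<chi> i. real n) :: R2 set) = UNIV"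
      proof -
        have "\<exists>n. x \<in> box (- (\<chi> i. real n)) (\<chi> i. real n)" for x :: R2
        proof -
          obtain n :: nat where "max \<bar>x $ 1\<bar> \<bar>x $ 2\<bar> < n" using reals_Archimedean2 by blast
          then show ?thesis by (intro exI[of _ n]) (auto simp: mem_box_2)
        qed
        then show ?thesis by auto
      qed
      ultimately have "(LINT x:UNIV|lebesgue. h x) = 0"
        using box0 by (simp add: LIMSEQ_const_iff)
      moreover have "(LINT x:UNIV|lebesgue. h x) =
          (LINT x:A|lebesgue. h x) + (LINT x:UNIV - A|lebesgue. h x)"
        using set_integral_Un[of A "UNIV - A" lebesgue h] si sub[OF compl(1)]
        by (simp add: sets.compl_sets[of _ lebesgue, simplified] Compl_eq_Diff_UNIV)
      ultimately show ?case using compl(2) by simp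
    next
      case (union A)
      have "(LINT x:(\<Union>i. A i)|lebesgue. h x) = (\<Sum>i. LINT x:A i|lebesgue. h x)"
      proof (rule lebesgue_integral_countable_add)
        show "A i \<in> sets lebesgue" for i using union(2) sub by blast
        then show "set_integrable lebesgue (\<Union>i. A i) h" by (intro si) blast
        show "i \<noteq> j \<Longrightarrow> A i \<inter> A j = {}" for i j
          using union(1) by (auto simp: disjoint_family_on_def)
      qed
      then show ?case using union(3) by simp
    qed
  qed
  have "AE x in lebesgue. h x = (\<lambda>x. 0) x"
  proof (rule density_unique_real[OF int])
    show "integrable lebesgue (\<lambda>x::R2. 0::real)" by simp
    fix A :: "R2 set" assume "A \<in> sets lebesgue"
    then obtain S N N' where A: "A = S \<union> N" "N \<subseteq> N'" "N' \<in> null_sets lborel" "S \<in> sets lborel"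
      by (rule sets_completionE) auto
    have N: "N \<in> null_sets lebesgue" using A(2,3) null_sets_completion_subset null_sets_completionI by blast
    have "(LINT x:A|lebesgue. h x) = (LINT x:S|lebesgue. h x)"
    proof (rule set_integral_cong_set)
      have "AE x in lebesgue. x \<notin> N" using N by (rule AE_not_in)
      then show "AE x in lebesgue. (x \<in> S) = (x \<in> A)" using A(1) by auto
      have "S \<in> sets lebesgue" using A(4) by (rule sets_completionI_sets)
      then show "set_borel_measurable lebesgue S h" "set_borel_measurable lebesgue A h"
        unfolding set_borel_measurable_def using \<open>A \<in> sets lebesgue\<close>
        by (intro borel_measurable_scaleR borel_measurable_indicator borel_measurable_integrable[OF int]; simp)+
    qed
    then show "(LINT x:A|lebesgue. h x) = (LINT x:A|lebesgue. 0)"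
      using meas0[of S] A(4) by (simp add: set_lebesgue_integral_def)
  qed
  then show ?thesis by simp
qed

section \<open>Weak gradients and the Dirichlet energy\<close>

lemma set_integrable_nth:
  fixes f :: "R2 \<Rightarrow> R2"
  shows "set_integrable M K f \<Longrightarrow> set_integrable M K (\<lambda>x. f x $ i)"
  using integrable_bounded_linear[OF bounded_linear_vec_nth[of i]]
  unfolding set_integrable_def by fastforce

lemma set_integral_C1c:
  assumes "C1c \<Omega> \<phi>"
  shows "(LINT x:\<Omega>|lebesgue. u x * \<phi> x) = (LINT x|lebesgue. u x * \<phi> x)"
    and "(LINT x:\<Omega>|lebesgue. u x * cgrad \<phi> x $ i) = (LINT x|lebesgue. u x * cgrad \<phi> x $ i)"
proof -
  obtain K where K: "K \<subseteq> \<Omega>" "\<And>x. x \<notin> K \<Longrightarrow> \<phi> x = 0" "\<And>x. x \<notin> K \<Longrightarrow> cgrad \<phi> x = 0"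
    using C1c_support[OF assms] by metis
  show "(LINT x:\<Omega>|lebesgue. u x * \<phi> x) = (LINT x|lebesgue. u x * \<phi> x)"
    by (rule set_integral_support) (use K(1,2) in auto)
  show "(LINT x:\<Omega>|lebesgue. u x * cgrad \<phi> x $ i) = (LINT x|lebesgue. u x * cgrad \<phi> x $ i)"
    by (rule set_integral_support) (use K(1,3) in \<open>metis mult_zero_right subsetD zero_index\<close>)
qed

text \<open>Box cutoffs are enough as test functions: they converge to indicators of boxes, so
  \<open>h\<close> has integral 0 over every box whose closure lies in the domain. Box boundaries
  are null sets, and countably many closed boxes exhaust an open set.\<close>

lemma fundamental_lemma_calculus_variations:
  fixes h :: "R2 \<Rightarrow> real"
  assumes "open \<Omega>"
    and loc: "\<And>K. compact K \<Longrightarrow> K \<subseteq> \<Omega> \<Longrightarrow> set_integrable lebesgue K h"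
    and test: "\<And>\<phi>. C1c \<Omega> \<phi> \<Longrightarrow> (LINT x:\<Omega>|lebesgue. h x * \<phi> x) = 0"
  shows "AE x in lebesgue. x \<in> \<Omega> \<longrightarrow> h x = 0"
proof -
  have box0: "(LINT x:box p q|lebesgue. h x) = 0" if pq: "cbox p q \<subseteq> \<Omega>" for p q
  proof -
    let ?h = "\<lambda>x. indicat_real (cbox p q) x *\<^sub>R h x"
    have int: "integrable lebesgue ?h"
      using loc[OF compact_cbox pq] unfolding set_integrable_def .
    have "(\<lambda>n. LINT x|lebesgue. ?h x * box_cutoff p q (real (Suc n)) x)
        \<longlonglongrightarrow> (LINT x|lebesgue. indicat_real (box p q) x *\<^sub>R h x)"
    proof (rule integral_dominated_convergence[where w = "\<lambda>x. norm (?h x)"])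
      show "(\<lambda>x. indicat_real (box p q) x *\<^sub>R h x) \<in> borel_measurable lebesgue"
      proof -
        have "(\<lambda>x. indicat_real (box p q) x *\<^sub>R h x) = (\<lambda>x. indicat_real (box p q) x *\<^sub>R ?h x)"
          using box_subset_cbox[of p q] by (auto simp: indicator_def fun_eq_iff)
        moreover have "integrable lebesgue (\<lambda>x. indicat_real (box p q) x *\<^sub>R ?h x)"
          by (rule integrable_mult_indicator[OF _ int]) simp
        ultimately show ?thesis by (metis borel_measurable_integrable)
      qed
      show "(\<lambda>x. ?h x * box_cutoff p q (real (Suc n)) x) \<in> borel_measurable lebesgue" for n
        using borel_measurable_integrable[OF int]
          lebesgue_measurable_continuous[OF has_C1_grad_continuous[OF C1c_has_grad[OF box_cutoff_C1c[OF pq, of "real (Suc n)"]]]]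
        by (intro borel_measurable_times) auto
      show "integrable lebesgue (\<lambda>x. norm (?h x))" using int by (rule integrable_norm)
      show "AE x in lebesgue. (\<lambda>n. ?h x * box_cutoff p q (real (Suc n)) x) \<longlonglongrightarrow> indicat_real (box p q) x *\<^sub>R h x"
      proof (rule AE_I2)
        fix x
        have "(\<lambda>n. ?h x * box_cutoff p q (real (Suc n)) x) \<longlonglongrightarrow> ?h x * indicator (box p q) x"
          by (intro tendsto_mult tendsto_const LIMSEQ_Suc[OF tendsto_box_cutoff])
        moreover have "?h x * indicator (box p q) x = indicat_real (box p q) x *\<^sub>R h x"
          using box_subset_cbox[of p q] by (auto simp: indicator_def)
        ultimately show "(\<lambda>n. ?h x * box_cutoff p q (real (Suc n)) x) \<longlonglongrightarrow> indicat_real (box p q) x *\<^sub>R h x"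
          by (simp only:)
      qed
      show "AE x in lebesgue. norm (?h x * box_cutoff p q (real (Suc n)) x) \<le> norm (?h x)" for n
        using box_cutoff_bounds[of p q "real (Suc n)"]
        by (intro AE_I2) (auto simp: abs_mult intro!: mult_right_le_one_le)
    qed
    moreover have "(LINT x|lebesgue. ?h x * box_cutoff p q (real (Suc n)) x) = 0" for n
    proof -
      have C: "C1c (cbox p q) (box_cutoff p q (real (Suc n)))" by (intro box_cutoff_C1c) auto
      have "(LINT x:\<Omega>|lebesgue. h x * box_cutoff p q (real (Suc n)) x) = 0"
        using C1c_mono[OF C pq] by (rule test)
      moreover have "box_cutoff p q (real (Suc n)) x = 0" if "x \<notin> cbox p q" for x
        using C1c_support[OF C] that by (metis subsetD)
      then have "(\<lambda>x. indicat_real \<Omega> x *\<^sub>R (h x * box_cutoff p q (real (Suc n)) x)) =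
          (\<lambda>x. ?h x * box_cutoff p q (real (Suc n)) x)"
        using pq by (auto simp: fun_eq_iff indicator_def)
      ultimately show ?thesis unfolding set_lebesgue_integral_def by simp
    qed
    ultimately show ?thesis unfolding set_lebesgue_integral_def by (simp add: LIMSEQ_const_iff)
  qed
  have on_box: "AE x in lebesgue. x \<in> box c d \<longrightarrow> h x = 0" if cd: "cbox c d \<subseteq> \<Omega>" for c d
  proof -
    let ?h = "\<lambda>x. indicat_real (box c d) x *\<^sub>R h x"
    have "AE x in lebesgue. ?h x = 0"
    proof (rule integral_0_on_boxes_imp_AE_0)
      have "set_integrable lebesgue (box c d) h"
        using set_integrable_subset[OF loc[OF compact_cbox cd] _ box_subset_cbox] by simp
      then show "integrable lebesgue ?h" unfolding set_integrable_def .
      fix a b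
      \<comment> \<open>The intersection of the two boxes is again a box, and its closure stays
        inside the domain.\<close>
      define p q where "p = (\<chi> i. max (a $ i) (c $ i))" and "q = (\<chi> i. min (b $ i) (d $ i))"
      have "cbox p q \<subseteq> cbox c d" by (auto simp: p_def q_def mem_cbox_2)
      then have "(LINT x:box p q|lebesgue. h x) = 0" using cd by (intro box0) auto
      moreover have "(\<lambda>x. indicat_real (box p q) x *\<^sub>R h x) = (\<lambda>x. indicat_real (box a b) x *\<^sub>R ?h x)"
        by (auto simp: p_def q_def mem_box_2 indicator_def fun_eq_iff)
      ultimately show "(LINT x:box a b|lebesgue. ?h x) = 0"
        unfolding set_lebesgue_integral_def by simp
    qed
    then show ?thesis by (rule AE_mp) (auto intro!: AE_I2 simp: indicator_def)
  qed
  have on_cbox: "AE x in lebesgue. x \<in> cbox c d \<longrightarrow> h x = 0" if cd: "cbox c d \<subseteq> \<Omega>" for c d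
  proof -
    have "cbox c d - box c d \<in> null_sets lebesgue"
      using negligible_frontier_interval[of c d] by (simp add: negligible_iff_null_sets)
    then have "AE x in lebesgue. x \<notin> cbox c d - box c d" by (rule AE_not_in)
    with on_box[OF cd] show ?thesis by eventually_elim auto
  qed
  obtain D where D: "countable D" "D \<subseteq> Pow \<Omega>" "\<And>X. X \<in> D \<Longrightarrow> \<exists>a b. X = cbox a b" "\<Union>D = \<Omega>"
    using open_countable_Union_open_cbox[OF assms(1)] by metis
  have "AE x in lebesgue. \<forall>X\<in>D. x \<in> X \<longrightarrow> h x = 0"
    using D(1)
  proof (rule AE_ball_countable[THEN iffD2], intro ballI)
    fix X assume "X \<in> D"
    then show "AE x in lebesgue. x \<in> X \<longrightarrow> h x = 0" using D(2,3) on_cbox by (metis PowD subsetD)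
  qed
  then show ?thesis by (rule AE_mp) (use D(4) in \<open>auto intro!: AE_I2\<close>)
qed

lemma weak_grad_test:
  assumes u: "weak_grad \<Omega> u f" and \<phi>: "C1c \<Omega> \<phi>"
  shows "integrable lebesgue (\<lambda>x. u x * cgrad \<phi> x $ i)" and "integrable lebesgue (\<lambda>x. f x $ i * \<phi> x)"
    and "(LINT x|lebesgue. u x * cgrad \<phi> x $ i) = - (LINT x|lebesgue. f x $ i * \<phi> x)"
proof -
  obtain K where K: "compact K" "K \<subseteq> \<Omega>" "\<And>x. x \<notin> K \<Longrightarrow> \<phi> x = 0" "\<And>x. x \<notin> K \<Longrightarrow> cgrad \<phi> x = 0"
    using C1c_support[OF \<phi>] by metis
  have l: "set_integrable lebesgue K u" "set_integrable lebesgue K f"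
    using u K unfolding weak_grad_def by auto
  show "integrable lebesgue (\<lambda>x. u x * cgrad \<phi> x $ i)"
    using K by (intro integrable_mult_cont_compact_support[OF l(1)] continuous_cgrad_nth[OF C1c_has_grad[OF \<phi>]]) auto
  show "integrable lebesgue (\<lambda>x. f x $ i * \<phi> x)"
    using K by (intro integrable_mult_cont_compact_support[OF set_integrable_nth[OF l(2)]] has_C1_grad_continuous[OF C1c_has_grad[OF \<phi>]]) auto
  have "(LINT x:\<Omega>|lebesgue. u x * cgrad \<phi> x $ i) = - (LINT x:\<Omega>|lebesgue. f x $ i * \<phi> x)"
    using u \<phi> unfolding weak_grad_def by blast
  then show "(LINT x|lebesgue. u x * cgrad \<phi> x $ i) = - (LINT x|lebesgue. f x $ i * \<phi> x)"
    unfolding set_integral_C1c[OF \<phi>] .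
qed

lemma weak_grad_unique:
  assumes "open \<Omega>" "weak_grad \<Omega> u g" "weak_grad \<Omega> u g'"
  shows "AE x in lebesgue. x \<in> \<Omega> \<longrightarrow> g x = g' x"
proof -
  have comp: "AE x in lebesgue. x \<in> \<Omega> \<longrightarrow> g x $ i - g' x $ i = 0" for i
  proof (rule fundamental_lemma_calculus_variations[OF assms(1)])
    show "set_integrable lebesgue K (\<lambda>x. g x $ i - g' x $ i)" if "compact K" "K \<subseteq> \<Omega>" for K
      using assms(2,3) that unfolding weak_grad_def by (intro set_integral_diff set_integrable_nth) auto
    fix \<phi> assume \<phi>: "C1c \<Omega> \<phi>"
    note 1 = weak_grad_test[OF assms(2) \<phi>, of i] and 2 = weak_grad_test[OF assms(3) \<phi>, of i]
    show "(LINT x:\<Omega>|lebesgue. (g x $ i - g' x $ i) * \<phi> x) = 0"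
      unfolding set_integral_C1c[OF \<phi>] using 1 2 by (simp add: left_diff_distrib)
  qed
  from comp[of 1] comp[of 2] show ?thesis
    by eventually_elim (auto simp: vec_eq_iff forall_2)
qed

text \<open>\<open>dirichlet\<close> selects its weak gradient by choice; uniqueness almost
  everywhere makes the energy computable from any weak gradient at hand.\<close>

lemma dirichlet_eq:
  assumes "open \<Omega>" "weak_grad \<Omega> u g"
  shows "dirichlet \<Omega> u = (\<integral>\<^sup>+ x\<in>\<Omega>. ennreal ((norm (g x))\<^sup>2) \<partial>lebesgue)"
proof -
  let ?g = "SOME g. weak_grad \<Omega> u g"
  have "weak_grad \<Omega> u ?g" using assms(2) by (rule someI[of "weak_grad \<Omega> u"])
  from weak_grad_unique[OF assms(1) this assms(2)]
  have "AE x in lebesgue. ennreal ((norm (?g x))\<^sup>2) * indicator \<Omega> x = ennreal ((norm (g x))\<^sup>2) * indicator \<Omega> x"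
    by eventually_elim (auto simp: indicator_def)
  then have "(\<integral>\<^sup>+ x\<in>\<Omega>. ennreal ((norm (?g x))\<^sup>2) \<partial>lebesgue) = (\<integral>\<^sup>+ x\<in>\<Omega>. ennreal ((norm (g x))\<^sup>2) \<partial>lebesgue)"
    by (rule nn_integral_cong_AE)
  then show ?thesis using assms(2) unfolding dirichlet_def by auto
qed

lemma weak_grad_C1:
  assumes "has_C1_grad f F"
  shows "weak_grad \<Omega> f F"
  unfolding weak_grad_def
proof (intro conjI allI impI)
  fix K :: "R2 set" assume K: "compact K \<and> K \<subseteq> \<Omega>"
  then obtain a where a: "K \<subseteq> cbox (- a) a"
    using compact_imp_bounded bounded_subset_cbox_symmetric by metis
  have "K \<in> sets lebesgue" using K by (simp add: compact_imp_closed)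
  then show "set_integrable lebesgue K f" "set_integrable lebesgue K F"
    using assms has_C1_grad_continuous[OF assms] a unfolding has_C1_grad_def
    by (auto intro!: set_integrable_subset[of _ "cbox (- a) a"] absolutely_integrable_continuous
        intro: continuous_on_subset)
next
  fix \<phi> i assume \<phi>: "C1c \<Omega> \<phi>"
  show "(LINT x:\<Omega>|lebesgue. f x * cgrad \<phi> x $ i) = - (LINT x:\<Omega>|lebesgue. F x $ i * \<phi> x)"
    unfolding set_integral_C1c[OF \<phi>] by (rule integral_by_parts(1)[OF assms \<phi>])
qed

lemma weak_grad_add:
  assumes "weak_grad \<Omega> u f" "weak_grad \<Omega> v g"
  shows "weak_grad \<Omega> (\<lambda>x. u x + v x) (\<lambda>x. f x + g x)"
  unfolding weak_grad_def
proof (intro conjI allI impI)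
  fix K :: "R2 set" assume K: "compact K \<and> K \<subseteq> \<Omega>"
  show "set_integrable lebesgue K (\<lambda>x. u x + v x)" "set_integrable lebesgue K (\<lambda>x. f x + g x)"
    using assms K unfolding weak_grad_def by (auto intro!: set_integral_add)
next
  fix \<phi> i assume \<phi>: "C1c \<Omega> \<phi>"
  note 1 = weak_grad_test[OF assms(1) \<phi>, of i] and 2 = weak_grad_test[OF assms(2) \<phi>, of i]
  show "(LINT x:\<Omega>|lebesgue. (u x + v x) * cgrad \<phi> x $ i) = - (LINT x:\<Omega>|lebesgue. (f x + g x) $ i * \<phi> x)"
    unfolding set_integral_C1c[OF \<phi>] using 1 2 by (simp add: distrib_right)
qed

lemma nn_integral_ball_bounded:
  fixes f :: "R2 \<Rightarrow> real"
  assumes "continuous_on UNIV f"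
  shows "(\<integral>\<^sup>+ x\<in>ball 0 r. ennreal (f x) \<partial>lebesgue) < \<infinity>"
proof -
  have "compact (f ` cball 0 r)"
    using assms by (intro compact_continuous_image) (auto intro: continuous_on_subset)
  then obtain C where C: "\<And>y. y \<in> f ` cball 0 r \<Longrightarrow> norm y \<le> C"
    using compact_imp_bounded bounded_iff by metis
  have "(\<integral>\<^sup>+ x\<in>ball 0 r. ennreal (f x) \<partial>lebesgue) \<le> (\<integral>\<^sup>+ x\<in>ball (0::R2) r. ennreal C \<partial>lebesgue)"
  proof (intro nn_integral_mono)
    fix x :: R2
    show "ennreal (f x) * indicator (ball 0 r) x \<le> ennreal C * indicator (ball 0 r) x"
    proof (cases "x \<in> ball 0 r")
      case True
      then have "norm (f x) \<le> C" by (intro C) auto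
      then show ?thesis by (intro mult_right_mono ennreal_leI) auto
    qed simp
  qed
  also have "\<dots> = ennreal C * emeasure lebesgue (ball (0::R2) r)"
    by (subst nn_integral_cmult_indicator) auto
  also have "\<dots> < \<infinity>"
    using emeasure_bounded_finite[OF bounded_ball[of "0::R2" r]] by (simp add: ennreal_mult_less_top)
  finally show ?thesis .
qed

lemma dirichlet_C1_ball:
  assumes "has_C1_grad f F"
  shows "dirichlet (ball 0 r) f = (\<integral>\<^sup>+ x\<in>ball 0 r. ennreal ((norm (F x))\<^sup>2) \<partial>lebesgue)"
    and "dirichlet (ball 0 r) f < \<infinity>"
proof -
  show *: "dirichlet (ball 0 r) f = (\<integral>\<^sup>+ x\<in>ball 0 r. ennreal ((norm (F x))\<^sup>2) \<partial>lebesgue)"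
    by (intro dirichlet_eq weak_grad_C1 assms open_ball)
  show "dirichlet (ball 0 r) f < \<infinity>"
    unfolding * using assms by (intro nn_integral_ball_bounded continuous_intros) (simp add: has_C1_grad_def)
qed

section \<open>The Poincare inequality and the energy of competitors\<close>

lemma H10_C1c:
  assumes "C1c \<Omega> w"
  shows "H10 \<Omega> w"
proof -
  have w: "has_C1_grad w (cgrad w)" using assms by (rule C1c_has_grad)
  show ?thesis unfolding H10_def
  proof (intro conjI exI[of _ "cgrad w"] exI[of _ "\<lambda>k. w"])
    show "w \<in> borel_measurable lebesgue"
      by (intro lebesgue_measurable_continuous has_C1_grad_continuous[OF w])
  qed (use assms weak_grad_C1[OF w] in auto)
qed

text \<open>Writing 1 as the derivative of \<open>x $ 1\<close> turns the integral of the square of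
  \<phi> into minus the integral of \<open>x $ 1\<close> times the first partial derivative of that
  square. On the ball \<bar>\<open>x $ 1\<close>\<bar> is at most R, and Young's inequality lets
  half of the left side be absorbed.\<close>

lemma C1c_poincare:
  assumes \<phi>: "C1c (ball 0 R) \<phi>" and "R > 0"
  shows "(LINT x|lebesgue. (\<phi> x)\<^sup>2) \<le> 4 * R\<^sup>2 * (LINT x|lebesgue. (norm (cgrad \<phi> x))\<^sup>2)"
    and "integrable lebesgue (\<lambda>x. (\<phi> x)\<^sup>2)"
    and "integrable lebesgue (\<lambda>x. (norm (cgrad \<phi> x))\<^sup>2)"
proof -
  have g: "has_C1_grad \<phi> (cgrad \<phi>)" using \<phi> by (rule C1c_has_grad)
  obtain K where K: "compact K" "K \<subseteq> ball 0 R" "\<And>x. x \<notin> K \<Longrightarrow> \<phi> x = 0" "\<And>x. x \<notin> K \<Longrightarrow> cgrad \<phi> x = 0"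
    using C1c_support[OF \<phi>] by metis
  note cont = has_C1_grad_continuous[OF g] continuous_cgrad[OF g]
  show i1: "integrable lebesgue (\<lambda>x. (\<phi> x)\<^sup>2)"
    using K by (intro integrable_cont_compact_support[OF _ K(1)] continuous_intros cont) auto
  show i2: "integrable lebesgue (\<lambda>x. (norm (cgrad \<phi> x))\<^sup>2)"
    using K by (intro integrable_cont_compact_support[OF _ K(1)] continuous_intros cont) auto
  have cg: "cgrad (\<lambda>x. \<phi> x * \<phi> x) = (\<lambda>x. \<phi> x *\<^sub>R cgrad \<phi> x + \<phi> x *\<^sub>R cgrad \<phi> x)"
    by (rule has_C1_grad_cgrad[OF has_C1_grad_mult[OF g g]])
  note p = integral_by_parts[OF has_C1_grad_component[of 1] C1c_mult[OF g \<phi>], of 1]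
  have ptw: "- (x $ 1 * cgrad (\<lambda>x. \<phi> x * \<phi> x) x $ 1) \<le> (\<phi> x)\<^sup>2 / 2 + 2 * R\<^sup>2 * (norm (cgrad \<phi> x))\<^sup>2" for x
  proof (cases "x \<in> K")
    case True
    define t where "t = cgrad \<phi> x $ 1"
    have "\<bar>x $ 1\<bar> \<le> R" using True K(2) component_le_norm_cart[of x 1] by fastforce
    then have "(x $ 1)\<^sup>2 \<le> R\<^sup>2" using assms(2) by (simp add: abs_le_square_iff[symmetric])
    moreover have "t\<^sup>2 \<le> (norm (cgrad \<phi> x))\<^sup>2"
      unfolding t_def using component_le_norm_cart[of "cgrad \<phi> x" 1] by (simp add: abs_le_square_iff[symmetric])
    ultimately have "2 * ((x $ 1)\<^sup>2 * t\<^sup>2) \<le> 2 * (R\<^sup>2 * (norm (cgrad \<phi> x))\<^sup>2)"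
      by (intro mult_left_mono mult_mono) auto
    moreover have "0 \<le> (\<phi> x / 2 + x $ 1 * t)\<^sup>2" by simp
    then have "- (2 * x $ 1 * t * \<phi> x) \<le> (\<phi> x)\<^sup>2 / 2 + 2 * ((x $ 1)\<^sup>2 * t\<^sup>2)"
      by (simp add: power2_eq_square algebra_simps)
    ultimately show ?thesis unfolding cg t_def[symmetric] by (simp add: t_def algebra_simps)
  next
    case False
    then show ?thesis unfolding cg using K by simp
  qed
  have "(LINT x|lebesgue. (\<phi> x)\<^sup>2) = (LINT x|lebesgue. - (x $ 1 * cgrad (\<lambda>x. \<phi> x * \<phi> x) x $ 1))"
    using p(1) by (simp add: axis_def power2_eq_square)
  also have "\<dots> \<le> (LINT x|lebesgue. (\<phi> x)\<^sup>2 / 2 + 2 * R\<^sup>2 * (norm (cgrad \<phi> x))\<^sup>2)"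
    using p(2) i1 i2 ptw by (intro integral_mono) auto
  also have "\<dots> = (LINT x|lebesgue. (\<phi> x)\<^sup>2) / 2 + 2 * R\<^sup>2 * (LINT x|lebesgue. (norm (cgrad \<phi> x))\<^sup>2)"
    using i1 i2 by simp
  finally show "(LINT x|lebesgue. (\<phi> x)\<^sup>2) \<le> 4 * R\<^sup>2 * (LINT x|lebesgue. (norm (cgrad \<phi> x))\<^sup>2)" by simp
qed

text \<open>A weak gradient is controlled only on compact subsets of the ball and is arbitrary
  outside. Closed balls exhausting the ball give measurability of its truncation on the
  plane.\<close>

lemma ball_measurable_of_local:
  fixes g :: "R2 \<Rightarrow> 'b::euclidean_space"
  assumes "\<And>K. compact K \<Longrightarrow> K \<subseteq> ball 0 R \<Longrightarrow> set_integrable lebesgue K g"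
  shows "(\<lambda>x. indicat_real (ball 0 R) x *\<^sub>R g x) \<in> borel_measurable lebesgue"
proof (rule borel_measurable_LIMSEQ_metric)
  let ?r = "\<lambda>n. R - inverse (real (Suc n))"
  show "(\<lambda>x. indicat_real (cball 0 (?r n)) x *\<^sub>R g x) \<in> borel_measurable lebesgue" for n
  proof -
    have "set_integrable lebesgue (cball 0 (?r n)) g"
    proof (rule assms)
      show "cball 0 (?r n) \<subseteq> (ball 0 R :: R2 set)"
        using inverse_positive_iff_positive[of "real (Suc n)"] by (auto simp del: inverse_positive_iff_positive)
    qed simp
    then show ?thesis unfolding set_integrable_def by (rule borel_measurable_integrable)
  qed
  show "(\<lambda>n. indicat_real (cball 0 (?r n)) x *\<^sub>R g x) \<longlonglongrightarrow> indicat_real (ball 0 R) x *\<^sub>R g x" for x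
  proof (cases "x \<in> ball 0 R")
    case True
    then obtain N where N: "inverse (real (Suc N)) < R - norm x"
      using reals_Archimedean[of "R - norm x"] by auto
    have "\<forall>\<^sub>F n in sequentially. indicat_real (cball 0 (?r n)) x *\<^sub>R g x = indicat_real (ball 0 R) x *\<^sub>R g x"
      unfolding eventually_sequentially
    proof (intro exI[of _ N] allI impI)
      fix n assume "N \<le> n"
      then have "inverse (real (Suc n)) \<le> inverse (real (Suc N))" by (intro le_imp_inverse_le) auto
      then have "norm x \<le> ?r n" using N by linarith
      then show "indicat_real (cball 0 (?r n)) x *\<^sub>R g x = indicat_real (ball 0 R) x *\<^sub>R g x"
        using True by simp
    qed
    then show ?thesis by (rule tendsto_eventually)
  next
    case False
    have "x \<notin> cball 0 (?r n)" for n
    proof -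
      have "inverse (real (Suc n)) > 0" by simp
      then show ?thesis using False by (simp del: inverse_positive_iff_positive)
    qed
    then show ?thesis using False by simp
  qed
qed

text \<open>The mixed term of the Dirichlet energy vanishes against C1c functions by harmonicity,
  hence against \<open>w\<close> by approximation; \<open>D\<close> is therefore the Dirichlet
  energy of \<open>w\<close>. The L2 bound is the Poincare inequality for one approximant,
  transferred to \<open>w\<close>.\<close>

lemma H10_competitor_energy:
  assumes U: "has_C1_grad U F"
    and harm: "\<And>\<phi>. C1c (ball 0 R) \<phi> \<Longrightarrow> (LINT x|lebesgue. F x \<bullet> cgrad \<phi> x) = 0"
    and w: "H10 (ball 0 R) w" and "R > 0"
  obtains D :: real where "D \<ge> 0"
    "dirichlet (ball 0 R) (\<lambda>x. U x + w x) = dirichlet (ball 0 R) U + ennreal D"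
    "(\<integral>\<^sup>+ x\<in>ball 0 R. ennreal ((w x)\<^sup>2) \<partial>lebesgue) \<le> ennreal (16 * R\<^sup>2 * (D + 1) + 2)"
proof -
  let ?B = "ball 0 R :: R2 set"
  obtain g \<phi> where g: "weak_grad ?B w g" and \<phi>: "\<And>k. C1c ?B (\<phi> k)"
    and lim: "(\<lambda>k. \<integral>\<^sup>+ x\<in>?B. ennreal ((\<phi> k x - w x)\<^sup>2 + (norm (cgrad (\<phi> k) x - g x))\<^sup>2) \<partial>lebesgue) \<longlonglongrightarrow> 0"
    using w unfolding H10_def by blast
  have wm: "w \<in> borel_measurable lebesgue" using w unfolding H10_def by blast
  \<comment> \<open>Truncation to the ball: nothing is known about \<open>g\<close> outside it,
    whereas the approximants vanish there.\<close>
  define G where "G x = indicat_real ?B x *\<^sub>R g x" for x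
  define FB where "FB x = indicat_real ?B x *\<^sub>R F x" for x
  have Gm: "G \<in> borel_measurable lebesgue"
    unfolding G_def using g by (intro ball_measurable_of_local) (auto simp: weak_grad_def)
  have Fc: "continuous_on UNIV F" using U unfolding has_C1_grad_def by blast
  have Fm: "FB \<in> borel_measurable lebesgue"
    unfolding FB_def by (intro borel_measurable_scaleR borel_measurable_indicator lebesgue_measurable_continuous Fc) simp
  have pm: "cgrad (\<phi> k) \<in> borel_measurable lebesgue" "\<phi> k \<in> borel_measurable lebesgue" for k
    using has_C1_grad_continuous[OF C1c_has_grad[OF \<phi>]] continuous_cgrad[OF C1c_has_grad[OF \<phi>]]
    by (auto intro: lebesgue_measurable_continuous)
  have out: "cgrad (\<phi> k) x = 0" "\<phi> k x = 0" if "x \<notin> ?B" for k x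
    using C1c_support[OF \<phi>] that by (metis subsetD)+
  let ?d = "\<lambda>k x. (norm (cgrad (\<phi> k) x - G x))\<^sup>2"
  let ?N = "\<lambda>k. \<integral>\<^sup>+ x\<in>?B. ennreal ((\<phi> k x - w x)\<^sup>2 + (norm (cgrad (\<phi> k) x - g x))\<^sup>2) \<partial>lebesgue"
  let ?W = "\<lambda>k. \<integral>\<^sup>+ x\<in>?B. ennreal ((\<phi> k x - w x)\<^sup>2) \<partial>lebesgue"
  \<comment> \<open>A single index serves both parts of the norm, so the same approximant controls
    the gradient and the function.\<close>
  have small: "\<exists>k. integrable lebesgue (\<lambda>x. ?d k x) \<and>
      (LINT x|lebesgue. ?d k x) \<le> e \<and>
      ?W k \<le> ennreal e" if e: "e > 0" for e
  proof -
    have "\<forall>\<^sub>F k in sequentially. ?N k < ennreal e"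
      using lim e by (intro order_tendstoD(2)[OF lim]) simp
    then obtain k where k: "?N k < ennreal e"
      using eventually_sequentially by auto
    have "(\<integral>\<^sup>+ x. ennreal (?d k x) \<partial>lebesgue) \<le>
       ?N k"
      using out by (intro nn_integral_mono) (auto simp: G_def indicator_def intro!: ennreal_leI)
    then have le: "(\<integral>\<^sup>+ x. ennreal (?d k x) \<partial>lebesgue) \<le> ennreal e" using k by simp
    have int: "integrable lebesgue (\<lambda>x. ?d k x)"
    proof (rule integrableI_bounded)
      show "(\<lambda>x. ?d k x) \<in> borel_measurable lebesgue"
        using pm Gm by measurable
      show "(\<integral>\<^sup>+ x. ennreal (norm (?d k x)) \<partial>lebesgue) < \<infinity>"
        using le by (simp add: order_le_less_trans)
    qed
    then have "(LINT x|lebesgue. ?d k x) \<le> e"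
      using le nn_integral_eq_integral[OF int] e by simp
    moreover have "?W k \<le>
       ?N k"
      by (intro nn_integral_mono) (auto simp: indicator_def intro!: ennreal_leI)
    ultimately show ?thesis using int k by (intro exI[of _ k]) auto
  qed
  have two: "(norm (a + b))\<^sup>2 \<le> 2 * (norm a)\<^sup>2 + 2 * (norm b)\<^sup>2" for a b :: R2
  proof -
    have "(norm (a + b))\<^sup>2 \<le> (norm a + norm b)\<^sup>2" by (intro power_mono norm_triangle_ineq) simp
    also have "\<dots> \<le> 2 * (norm a)\<^sup>2 + 2 * (norm b)\<^sup>2"
      using sum_squares_bound[of "norm a" "norm b"] by (simp add: power2_sum)
    finally show ?thesis .
  qed
  note poin = C1c_poincare[OF \<phi> \<open>R > 0\<close>]
  have G2: "integrable lebesgue (\<lambda>x. (norm (G x))\<^sup>2)"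
  proof -
    obtain k where k: "integrable lebesgue (\<lambda>x. ?d k x)" using small[of 1] by auto
    show ?thesis
    proof (rule Bochner_Integration.integrable_bound)
      show "integrable lebesgue (\<lambda>x. 2 * (norm (cgrad (\<phi> k) x))\<^sup>2 + 2 * ?d k x)"
        using k poin(3)[of k] by simp
      show "(\<lambda>x. (norm (G x))\<^sup>2) \<in> borel_measurable lebesgue" using Gm by measurable
      show "AE x in lebesgue. norm ((norm (G x))\<^sup>2) \<le> norm (2 * (norm (cgrad (\<phi> k) x))\<^sup>2 + 2 * ?d k x)"
      proof (rule AE_I2)
        fix x
        show "norm ((norm (G x))\<^sup>2) \<le> norm (2 * (norm (cgrad (\<phi> k) x))\<^sup>2 + 2 * ?d k x)"
          using two[of "cgrad (\<phi> k) x" "G x - cgrad (\<phi> k) x"] by (simp add: norm_minus_commute)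
      qed
    qed
  qed
  have F2: "integrable lebesgue (\<lambda>x. (norm (FB x))\<^sup>2)"
  proof (rule integrableI_bounded)
    show "(\<lambda>x. (norm (FB x))\<^sup>2) \<in> borel_measurable lebesgue" using Fm by measurable
    have "(\<integral>\<^sup>+ x. ennreal (norm ((norm (FB x))\<^sup>2)) \<partial>lebesgue) = (\<integral>\<^sup>+ x\<in>?B. ennreal ((norm (F x))\<^sup>2) \<partial>lebesgue)"
      by (intro nn_integral_cong) (auto simp: FB_def indicator_def)
    also have "\<dots> < \<infinity>" by (intro nn_integral_ball_bounded continuous_intros Fc)
    finally show "(\<integral>\<^sup>+ x. ennreal (norm ((norm (FB x))\<^sup>2)) \<partial>lebesgue) < \<infinity>" .
  qed
  have amgm: "\<bar>a \<bullet> b\<bar> \<le> t * (norm a)\<^sup>2 + (norm b)\<^sup>2 / t" if "t > 0" for a b :: R2 and t :: real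
  proof -
    have "\<bar>a \<bullet> b\<bar> \<le> norm a * norm b" by (rule Cauchy_Schwarz_ineq2)
    also have "\<dots> \<le> t * (norm a)\<^sup>2 + (norm b)\<^sup>2 / t"
    proof -
      have "0 \<le> (t * norm a - norm b)\<^sup>2 + t * norm a * norm b" using that by simp
      then show ?thesis using that by (simp add: power2_eq_square field_simps)
    qed
    finally show ?thesis .
  qed
  have FG: "integrable lebesgue (\<lambda>x. FB x \<bullet> H x)"
    if "integrable lebesgue (\<lambda>x. (norm (H x))\<^sup>2)" "H \<in> borel_measurable lebesgue" for H :: "R2 \<Rightarrow> R2"
  proof (rule Bochner_Integration.integrable_bound)
    show "integrable lebesgue (\<lambda>x. (norm (FB x))\<^sup>2 + (norm (H x))\<^sup>2)" using F2 that(1) by simp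
    show "(\<lambda>x. FB x \<bullet> H x) \<in> borel_measurable lebesgue" using Fm that(2) by measurable
    show "AE x in lebesgue. norm (FB x \<bullet> H x) \<le> norm ((norm (FB x))\<^sup>2 + (norm (H x))\<^sup>2)"
      using amgm[of 1] by (intro AE_I2) simp
  qed
  define A where "A = (LINT x|lebesgue. (norm (FB x))\<^sup>2)"
  have "A \<ge> 0" unfolding A_def by simp
  \<comment> \<open>Young's inequality with weight \<open>t\<close>, against an approximant whose
    squared gradient error is at most \<open>t\<^sup>2\<close>, gives
    \<open>t * A + t\<^sup>2 / t\<close>. Since \<open>t\<close> is arbitrary, the mixed term is
    0.\<close>
  have "\<bar>LINT x|lebesgue. FB x \<bullet> G x\<bar> \<le> t * (A + 1)" if t: "t > 0" for t
  proof -
    obtain k where k: "integrable lebesgue (\<lambda>x. ?d k x)"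
      "(LINT x|lebesgue. ?d k x) \<le> t\<^sup>2" using small[of "t\<^sup>2"] t by auto
    have "(LINT x|lebesgue. FB x \<bullet> cgrad (\<phi> k) x) = 0"
    proof -
      have "(\<lambda>x. FB x \<bullet> cgrad (\<phi> k) x) = (\<lambda>x. F x \<bullet> cgrad (\<phi> k) x)"
        using out by (auto simp: FB_def fun_eq_iff indicator_def)
      then show ?thesis using harm[OF \<phi>] by simp
    qed
    then have "(LINT x|lebesgue. FB x \<bullet> G x) = (LINT x|lebesgue. FB x \<bullet> G x) - (LINT x|lebesgue. FB x \<bullet> cgrad (\<phi> k) x)" by simp
    also have "\<dots> = (LINT x|lebesgue. FB x \<bullet> G x - FB x \<bullet> cgrad (\<phi> k) x)"
      using FG[OF G2 Gm] FG[OF poin(3) pm(1)] by simp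
    also have "\<bar>\<dots>\<bar> \<le> (LINT x|lebesgue. \<bar>FB x \<bullet> G x - FB x \<bullet> cgrad (\<phi> k) x\<bar>)"
      by (rule integral_abs_bound)
    also have "\<dots> \<le> (LINT x|lebesgue. t * (norm (FB x))\<^sup>2 + ?d k x / t)"
    proof (rule integral_mono)
      show "\<bar>FB x \<bullet> G x - FB x \<bullet> cgrad (\<phi> k) x\<bar> \<le> t * (norm (FB x))\<^sup>2 + ?d k x / t" for x
        using amgm[OF t, of "FB x" "G x - cgrad (\<phi> k) x"] by (simp add: inner_diff_right norm_minus_commute)
    qed (use FG[OF G2 Gm] FG[OF poin(3) pm(1)] F2 k in auto)
    also have "\<dots> = t * A + (LINT x|lebesgue. ?d k x) / t"
      unfolding A_def using F2 k by simp
    also have "\<dots> \<le> t * A + t\<^sup>2 / t" using k(2) t by (intro add_left_mono divide_right_mono) auto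
    also have "\<dots> = t * (A + 1)" using t by (simp add: power2_eq_square algebra_simps)
    finally show ?thesis .
  qed
  then have zero: "(LINT x|lebesgue. FB x \<bullet> G x) = 0"
  proof -
    assume *: "\<And>t. t > 0 \<Longrightarrow> \<bar>LINT x|lebesgue. FB x \<bullet> G x\<bar> \<le> t * (A + 1)"
    have "\<bar>LINT x|lebesgue. FB x \<bullet> G x\<bar> \<le> 0 + e" if "e > 0" for e
      using *[of "e / (A + 1)"] that \<open>A \<ge> 0\<close> by simp
    then have "\<bar>LINT x|lebesgue. FB x \<bullet> G x\<bar> \<le> 0" by (rule field_le_epsilon)
    then show ?thesis by simp
  qed
  define D where "D = (LINT x|lebesgue. (norm (G x))\<^sup>2)"
  have D0: "D \<ge> 0" unfolding D_def by simp
  have "dirichlet ?B (\<lambda>x. U x + w x) = (\<integral>\<^sup>+ x\<in>?B. ennreal ((norm (F x + g x))\<^sup>2) \<partial>lebesgue)"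
    by (intro dirichlet_eq weak_grad_add weak_grad_C1 U g open_ball)
  also have "\<dots> = (\<integral>\<^sup>+ x. ennreal ((norm (FB x))\<^sup>2 + 2 * (FB x \<bullet> G x) + (norm (G x))\<^sup>2) \<partial>lebesgue)"
  proof (intro nn_integral_cong)
    fix x
    have "(norm (F x + g x))\<^sup>2 = (norm (F x))\<^sup>2 + 2 * (F x \<bullet> g x) + (norm (g x))\<^sup>2"
      by (simp add: power2_norm_eq_inner inner_add_left inner_add_right inner_commute)
    then show "ennreal ((norm (F x + g x))\<^sup>2) * indicator ?B x = ennreal ((norm (FB x))\<^sup>2 + 2 * (FB x \<bullet> G x) + (norm (G x))\<^sup>2)"
      by (cases "x \<in> ?B") (auto simp: FB_def G_def indicator_def)
  qed
  also have "\<dots> = ennreal (LINT x|lebesgue. (norm (FB x))\<^sup>2 + 2 * (FB x \<bullet> G x) + (norm (G x))\<^sup>2)"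
  proof (rule nn_integral_eq_integral)
    show "AE x in lebesgue. 0 \<le> (norm (FB x))\<^sup>2 + 2 * (FB x \<bullet> G x) + (norm (G x))\<^sup>2"
    proof (rule AE_I2)
      fix x
      have "0 \<le> (norm (FB x + G x))\<^sup>2" by simp
      also have "\<dots> = (norm (FB x))\<^sup>2 + 2 * (FB x \<bullet> G x) + (norm (G x))\<^sup>2"
        by (simp add: power2_norm_eq_inner inner_add_left inner_add_right inner_commute)
      finally show "0 \<le> (norm (FB x))\<^sup>2 + 2 * (FB x \<bullet> G x) + (norm (G x))\<^sup>2" .
    qed
  qed (use FG[OF G2 Gm] F2 G2 in auto)
  also have "\<dots> = ennreal (A + D)"
    unfolding A_def D_def using FG[OF G2 Gm] F2 G2 zero by simp
  also have "\<dots> = ennreal A + ennreal D" using D0 \<open>A \<ge> 0\<close> by simp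
  also have "ennreal A = dirichlet ?B U"
  proof -
    have "dirichlet ?B U = (\<integral>\<^sup>+ x. ennreal ((norm (FB x))\<^sup>2) \<partial>lebesgue)"
      unfolding dirichlet_C1_ball(1)[OF U]
      by (intro nn_integral_cong) (auto simp: FB_def indicator_def)
    then show ?thesis unfolding A_def using nn_integral_eq_integral[OF F2] by simp
  qed
  finally have e: "dirichlet ?B (\<lambda>x. U x + w x) = dirichlet ?B U + ennreal D" .
  \<comment> \<open>An approximant with error 1 has gradient energy at most
    \<open>2 * D + 2\<close>, so its squared L2 norm is at most
    \<open>4 * R\<^sup>2 * (2 * D + 2)\<close>. Doubling this and adding twice the error 1 gives the
    constant.\<close>
  have "(\<integral>\<^sup>+ x\<in>?B. ennreal ((w x)\<^sup>2) \<partial>lebesgue) \<le> ennreal (16 * R\<^sup>2 * (D + 1) + 2)"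
  proof -
    obtain k where k: "integrable lebesgue (\<lambda>x. ?d k x)"
      "(LINT x|lebesgue. ?d k x) \<le> 1"
      "?W k \<le> ennreal 1" using small[of 1] by auto
    have "(LINT x|lebesgue. (norm (cgrad (\<phi> k) x))\<^sup>2) \<le> (LINT x|lebesgue. 2 * (norm (G x))\<^sup>2 + 2 * ?d k x)"
    proof (rule integral_mono)
      show "(norm (cgrad (\<phi> k) x))\<^sup>2 \<le> 2 * (norm (G x))\<^sup>2 + 2 * ?d k x" for x
        using two[of "G x" "cgrad (\<phi> k) x - G x"] by simp
    qed (use poin(3)[of k] G2 k(1) in auto)
    also have "\<dots> \<le> 2 * D + 2" unfolding D_def using G2 k by simp
    finally have P: "(LINT x|lebesgue. (norm (cgrad (\<phi> k) x))\<^sup>2) \<le> 2 * D + 2" .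
    have "(LINT x|lebesgue. (\<phi> k x)\<^sup>2) \<le> 4 * R\<^sup>2 * (2 * D + 2)"
      using poin(1)[of k] mult_left_mono[OF P, of "4 * R\<^sup>2"] by simp
    then have P2: "(\<integral>\<^sup>+ x. ennreal ((\<phi> k x)\<^sup>2) \<partial>lebesgue) \<le> ennreal (4 * R\<^sup>2 * (2 * D + 2))"
      using nn_integral_eq_integral[OF poin(2)] by (simp add: ennreal_leI)
    have "(\<integral>\<^sup>+ x\<in>?B. ennreal ((w x)\<^sup>2) \<partial>lebesgue) \<le>
       (\<integral>\<^sup>+ x. 2 * ennreal ((\<phi> k x)\<^sup>2) + 2 * (ennreal ((\<phi> k x - w x)\<^sup>2) * indicator ?B x) \<partial>lebesgue)"
    proof (intro nn_integral_mono)
      fix x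
      have "(w x)\<^sup>2 \<le> 2 * (\<phi> k x)\<^sup>2 + 2 * (\<phi> k x - w x)\<^sup>2"
        using zero_le_power2[of "w x - 2 * \<phi> k x"] by (simp add: power2_eq_square algebra_simps)
      then have "ennreal ((w x)\<^sup>2) \<le> 2 * ennreal ((\<phi> k x)\<^sup>2) + 2 * ennreal ((\<phi> k x - w x)\<^sup>2)"
        by (simp add: ennreal_leI flip: ennreal_plus ennreal_numeral ennreal_mult)
      then show "ennreal ((w x)\<^sup>2) * indicator ?B x \<le> 2 * ennreal ((\<phi> k x)\<^sup>2) + 2 * (ennreal ((\<phi> k x - w x)\<^sup>2) * indicator ?B x)"
        by (auto simp: indicator_def)
    qed
    also have "\<dots> = 2 * (\<integral>\<^sup>+ x. ennreal ((\<phi> k x)\<^sup>2) \<partial>lebesgue) + 2 * ?W k"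
    proof -
      have m1: "(\<lambda>x. ennreal ((\<phi> k x)\<^sup>2)) \<in> borel_measurable lebesgue"
        using pm(2)[of k] by measurable
      have "(\<lambda>x. ennreal ((\<phi> k x - w x)\<^sup>2)) \<in> borel_measurable lebesgue"
        using pm(2)[of k] wm by measurable
      then have m2: "(\<lambda>x. ennreal ((\<phi> k x - w x)\<^sup>2) * indicator ?B x) \<in> borel_measurable lebesgue"
        by (intro borel_measurable_times_ennreal borel_measurable_indicator) simp_all
      show ?thesis using m1 m2 by (subst nn_integral_add) (simp_all add: nn_integral_cmult)
    qed
    also have "\<dots> \<le> 2 * ennreal (4 * R\<^sup>2 * (2 * D + 2)) + 2 * ennreal 1"
      by (intro add_mono mult_left_mono P2 k(3)) auto
    also have "\<dots> = ennreal (16 * R\<^sup>2 * (D + 1) + 2)"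
      using D0 by (simp add: algebra_simps flip: ennreal_plus ennreal_numeral ennreal_mult)
    finally show ?thesis .
  qed
  then show ?thesis using that D0 e by blast
qed

section \<open>The harmonic function and its stripes\<close>

lemma has_C1_grad_of_coordinate:
  assumes "\<And>t. (p has_real_derivative p' t) (at t)" "continuous_on UNIV p'"
  shows "has_C1_grad (\<lambda>x. p (x $ i)) (\<lambda>x. p' (x $ i) *\<^sub>R axis i 1)"
  by (rule has_C1_grad_compose[OF has_C1_grad_component assms])

lemma has_C1_grad_sin: "has_C1_grad (\<lambda>x. sin (k * x $ 2)) (\<lambda>x. (k * cos (k * x $ 2)) *\<^sub>R axis 2 1)"
  by (rule has_C1_grad_of_coordinate[where p = "\<lambda>t. sin (k * t)"])
    (auto intro!: derivative_eq_intros continuous_intros)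

lemma has_C1_grad_cos: "has_C1_grad (\<lambda>x. cos (k * x $ 2)) (\<lambda>x. (- k * sin (k * x $ 2)) *\<^sub>R axis 2 1)"
  by (rule has_C1_grad_of_coordinate[where p = "\<lambda>t. cos (k * t)"])
    (auto intro!: derivative_eq_intros continuous_intros)

lemma has_C1_grad_exp: "has_C1_grad (\<lambda>x. exp (k * x $ 1)) (\<lambda>x. (k * exp (k * x $ 1)) *\<^sub>R axis 1 1)"
  by (rule has_C1_grad_of_coordinate[where p = "\<lambda>t. exp (k * t)"])
    (auto intro!: derivative_eq_intros continuous_intros)

definition stripe_fun :: "real \<Rightarrow> R2 \<Rightarrow> real" where
  "stripe_fun k x = exp (k * x $ 1) * sin (k * x $ 2)"

definition stripes :: "real \<Rightarrow> R2 set" where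
  "stripes k = {x. sin (k * x $ 2) > 0}"

lemma stripe_fun_pos: "{x. stripe_fun k x > 0} = stripes k"
  by (auto simp: stripe_fun_def stripes_def zero_less_mult_iff)

definition stripe_grad :: "real \<Rightarrow> R2 \<Rightarrow> R2" where
  "stripe_grad k x = (k * exp (k * x $ 1) * cos (k * x $ 2)) *\<^sub>R axis 2 1
     + (k * exp (k * x $ 1) * sin (k * x $ 2)) *\<^sub>R axis 1 1"

lemma has_C1_grad_stripe_fun: "has_C1_grad (stripe_fun k) (stripe_grad k)"
  using has_C1_grad_mult[OF has_C1_grad_exp[of k] has_C1_grad_sin[of k]]
  unfolding stripe_fun_def[abs_def] stripe_grad_def[abs_def] by (simp add: mult_ac)

text \<open>Weak harmonicity: by parts, the first direction leaves -k^2 times the integral of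
  \<open>stripe_fun k\<close> against the test function, the second leaves +k^2 times it.\<close>

lemma stripe_fun_harmonic:
  assumes "C1c \<Omega> \<phi>"
  shows "(LINT x|lebesgue. stripe_grad k x \<bullet> cgrad \<phi> x) = 0"
proof -
  note 1 = integral_by_parts[OF has_C1_grad_mult[OF has_C1_grad_exp[of k] has_C1_grad_sin[of k]] assms, of 1]
  note 2 = integral_by_parts[OF has_C1_grad_mult[OF has_C1_grad_exp[of k] has_C1_grad_cos[of k]] assms, of 2]
  have "(LINT x|lebesgue. stripe_grad k x \<bullet> cgrad \<phi> x) =
    (LINT x|lebesgue. k * (exp (k * x $ 1) * sin (k * x $ 2) * cgrad \<phi> x $ 1) +
      k * (exp (k * x $ 1) * cos (k * x $ 2) * cgrad \<phi> x $ 2))"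
    by (rule Bochner_Integration.integral_cong)
      (simp_all add: stripe_grad_def inner_add_left inner_axis' mult_ac add_ac)
  also have "\<dots> = k * (LINT x|lebesgue. exp (k * x $ 1) * sin (k * x $ 2) * cgrad \<phi> x $ 1) +
      k * (LINT x|lebesgue. exp (k * x $ 1) * cos (k * x $ 2) * cgrad \<phi> x $ 2)"
    using 1(2) 2(2) by simp
  also have "\<dots> = 0"
    unfolding 1(1) 2(1) by (simp add: axis_def mult_ac)
  finally show ?thesis .
qed

lemma stripes_borel: "stripes k \<in> sets borel"
  unfolding stripes_def by (intro borel_open open_Collect_less continuous_intros)

lemma stripes_lebesgue: "stripes k \<in> sets lebesgue"
  using stripes_borel sets_completionI_sets[of _ lborel] by simp

text \<open>For s = sin in [-1, 1] the positive part is at least s/2 + s^2/2, and s^2 is 1/2 minus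
  half of cos^2 - sin^2. The constant part gives k/4. Multiplied by k, both s and cos^2 - sin^2 are,
  up to sign, derivatives of functions bounded by 1, so integration by parts costs 1/2 + 1/4 = 3/4
  of the L1 norm of the derivative of \<eta>.\<close>

lemma C1c_stripe_sin_integral:
  assumes \<eta>: "C1c \<Omega> \<eta>" "\<And>x. 0 \<le> \<eta> x" and "k > 0"
  shows "(LINT x|lebesgue. k * max 0 (sin (k * x $ 2)) * \<eta> x) \<ge>
     k / 4 * (LINT x|lebesgue. \<eta> x) - 3 / 4 * (LINT x|lebesgue. \<bar>cgrad \<eta> x $ 2\<bar>)"
    and "integrable lebesgue (\<lambda>x. k * max 0 (sin (k * x $ 2)) * \<eta> x)"
    and "integrable lebesgue \<eta>" and "integrable lebesgue (\<lambda>x. \<bar>cgrad \<eta> x $ 2\<bar>)"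
proof -
  let ?s = "\<lambda>x::R2. sin (k * x $ 2)" and ?c = "\<lambda>x::R2. cos (k * x $ 2)"
  show i1: "integrable lebesgue (\<lambda>x. k * max 0 (?s x) * \<eta> x)"
    by (intro C1c_integrable[OF \<eta>(1)] continuous_intros)
  show i2: "integrable lebesgue \<eta>" and i3: "integrable lebesgue (\<lambda>x. \<bar>cgrad \<eta> x $ 2\<bar>)"
    by (rule C1c_integrable[OF \<eta>(1)])+
  note p1 = integral_by_parts[OF has_C1_grad_cos[of k] \<eta>(1), of 2]
  note p2 = integral_by_parts[OF has_C1_grad_mult[OF has_C1_grad_sin[of k] has_C1_grad_cos[of k]] \<eta>(1), of 2]
  have e1: "(LINT x|lebesgue. k * ?s x * \<eta> x) = (LINT x|lebesgue. ?c x * cgrad \<eta> x $ 2)"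
    using p1(1) by (simp add: axis_def mult_ac)
  have j1: "integrable lebesgue (\<lambda>x. k * ?s x * \<eta> x)" using p1(3) by (simp add: axis_def mult_ac)
  have e2: "(LINT x|lebesgue. k * ((?c x)\<^sup>2 - (?s x)\<^sup>2) * \<eta> x) = - (LINT x|lebesgue. ?s x * ?c x * cgrad \<eta> x $ 2)"
    using p2(1) by (simp add: axis_def algebra_simps power2_eq_square)
  have j2: "integrable lebesgue (\<lambda>x. k * ((?c x)\<^sup>2 - (?s x)\<^sup>2) * \<eta> x)"
    using p2(3) by (simp add: axis_def algebra_simps power2_eq_square)
  have b1: "- (LINT x|lebesgue. \<bar>cgrad \<eta> x $ 2\<bar>) \<le> (LINT x|lebesgue. f x * cgrad \<eta> x $ 2)"
    if "\<And>x. \<bar>f x\<bar> \<le> 1" "integrable lebesgue (\<lambda>x. f x * cgrad \<eta> x $ 2)" for f :: "R2 \<Rightarrow> real"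
  proof -
    have "(LINT x|lebesgue. - \<bar>cgrad \<eta> x $ 2\<bar>) \<le> (LINT x|lebesgue. f x * cgrad \<eta> x $ 2)"
    proof (rule integral_mono)
      fix x
      have "\<bar>f x * cgrad \<eta> x $ 2\<bar> \<le> 1 * \<bar>cgrad \<eta> x $ 2\<bar>"
        unfolding abs_mult by (intro mult_right_mono that) simp
      then show "- \<bar>cgrad \<eta> x $ 2\<bar> \<le> f x * cgrad \<eta> x $ 2" by linarith
    qed (use i3 that in auto)
    then show ?thesis by simp
  qed
  have b_c: "- (LINT x|lebesgue. \<bar>cgrad \<eta> x $ 2\<bar>) \<le> (LINT x|lebesgue. ?c x * cgrad \<eta> x $ 2)"
    using p1(2) by (intro b1) auto
  have b_sc: "- (LINT x|lebesgue. \<bar>cgrad \<eta> x $ 2\<bar>) \<le> (LINT x|lebesgue. ?s x * ?c x * cgrad \<eta> x $ 2)"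
    using p2(2) by (intro b1) (auto simp: abs_mult intro!: mult_le_one)
  have "(LINT x|lebesgue. 1/2 * (k * ?s x * \<eta> x) + (k / 4 * \<eta> x - 1/4 * (k * ((?c x)\<^sup>2 - (?s x)\<^sup>2) * \<eta> x)))
    \<le> (LINT x|lebesgue. k * max 0 (?s x) * \<eta> x)"
  proof (rule integral_mono)
    fix x
    define s where "s = ?s x"
    have s: "\<bar>s\<bar> \<le> 1" unfolding s_def by simp
    have c: "(?c x)\<^sup>2 = 1 - s\<^sup>2" unfolding s_def by (simp add: cos_squared_eq)
    have "s\<^sup>2 \<le> \<bar>s\<bar>" using s mult_left_le[of "\<bar>s\<bar>" "\<bar>s\<bar>"] by (simp add: power2_eq_square flip: abs_mult)
    then have "s / 2 + s\<^sup>2 / 2 \<le> max 0 s" by (simp add: max_def abs_if split: if_splits)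
    then have "k * (s / 2 + s\<^sup>2 / 2) * \<eta> x \<le> k * max 0 s * \<eta> x"
      using \<eta>(2) \<open>k > 0\<close> by (intro mult_right_mono mult_left_mono) auto
    moreover have "1/2 * (k * s * \<eta> x) + (k / 4 * \<eta> x - 1/4 * (k * ((?c x)\<^sup>2 - s\<^sup>2) * \<eta> x)) = k * (s / 2 + s\<^sup>2 / 2) * \<eta> x"
      unfolding c by (simp add: field_simps)
    ultimately show "1/2 * (k * ?s x * \<eta> x) + (k / 4 * \<eta> x - 1/4 * (k * ((?c x)\<^sup>2 - (?s x)\<^sup>2) * \<eta> x)) \<le> k * max 0 (?s x) * \<eta> x"
      unfolding s_def by simp
  qed (use i1 i2 j1 j2 in auto)
  moreover have "(LINT x|lebesgue. 1/2 * (k * ?s x * \<eta> x) + (k / 4 * \<eta> x - 1/4 * (k * ((?c x)\<^sup>2 - (?s x)\<^sup>2) * \<eta> x)))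
     = 1/2 * (LINT x|lebesgue. k * ?s x * \<eta> x) + (k / 4 * (LINT x|lebesgue. \<eta> x) - 1/4 * (LINT x|lebesgue. k * ((?c x)\<^sup>2 - (?s x)\<^sup>2) * \<eta> x))"
    using i2 j1 j2 by (simp only: Bochner_Integration.integral_add Bochner_Integration.integral_diff
        integral_mult_right_zero integrable_mult_right Bochner_Integration.integrable_diff)
  ultimately show "(LINT x|lebesgue. k * max 0 (?s x) * \<eta> x) \<ge>
     k / 4 * (LINT x|lebesgue. \<eta> x) - 3 / 4 * (LINT x|lebesgue. \<bar>cgrad \<eta> x $ 2\<bar>)"
    using e1 e2 b_c b_sc by (simp add: field_simps)
qed

section \<open>Admissible vector fields and a calibration of the stripes\<close>

lemma cdiv_2: "cdiv \<phi> x = cgrad (\<lambda>y. \<phi> y $ 1) x $ 1 + cgrad (\<lambda>y. \<phi> y $ 2) x $ 2"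
  by (simp add: cdiv_def sum_2)

definition unit_fields :: "R2 set \<Rightarrow> (R2 \<Rightarrow> R2) set" where
  "unit_fields \<Omega> = {\<phi>. (\<forall>j. C1c \<Omega> (\<lambda>x. \<phi> x $ j)) \<and> (\<forall>x. norm (\<phi> x) \<le> 1)}"

lemma unit_fields_support:
  assumes "\<phi> \<in> unit_fields \<Omega>"
  obtains K where "compact K" "K \<subseteq> \<Omega>" "\<And>x. x \<notin> K \<Longrightarrow> \<phi> x = 0" "\<And>x. x \<notin> K \<Longrightarrow> cdiv \<phi> x = 0"
    "continuous_on UNIV (cdiv \<phi>)" "\<And>j. C1c \<Omega> (\<lambda>x. \<phi> x $ j)"
proof -
  have C: "C1c \<Omega> (\<lambda>x. \<phi> x $ j)" for j using assms unfolding unit_fields_def by blast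
  obtain K where K: "compact K" "K \<subseteq> \<Omega>" "\<And>x. x \<notin> K \<Longrightarrow> \<phi> x $ 1 = 0" "\<And>x. x \<notin> K \<Longrightarrow> cgrad (\<lambda>x. \<phi> x $ 1) x = 0"
    using C1c_support[OF C[of 1]] by metis
  obtain L where L: "compact L" "L \<subseteq> \<Omega>" "\<And>x. x \<notin> L \<Longrightarrow> \<phi> x $ 2 = 0" "\<And>x. x \<notin> L \<Longrightarrow> cgrad (\<lambda>x. \<phi> x $ 2) x = 0"
    using C1c_support[OF C[of 2]] by metis
  show ?thesis
  proof (rule that[of "K \<union> L"])
    show "continuous_on UNIV (cdiv \<phi>)"
      unfolding cdiv_2[abs_def] using C by (intro continuous_intros continuous_cgrad[OF C1c_has_grad])
  qed (use K L C in \<open>auto simp: cdiv_2 vec_eq_iff forall_2 compact_Un\<close>)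
qed

lemma unit_fields_integrable:
  assumes "\<phi> \<in> unit_fields \<Omega>"
  shows "integrable lebesgue (cdiv \<phi>)"
  using unit_fields_support[OF assms] integrable_cont_compact_support by metis

abbreviation flux :: "R2 set \<Rightarrow> (R2 \<Rightarrow> R2) \<Rightarrow> real" where
  "flux X \<phi> \<equiv> LINT x|lebesgue. indicat_real X x * cdiv \<phi> x"

lemma unit_fields_set_integral:
  assumes "\<phi> \<in> unit_fields \<Omega>"
  shows "(LINT x:(X \<inter> \<Omega>)|lebesgue. cdiv \<phi> x) = flux X \<phi>"
proof -
  obtain K where "K \<subseteq> \<Omega>" "\<And>x. x \<notin> K \<Longrightarrow> cdiv \<phi> x = 0" using unit_fields_support[OF assms] by metis
  then have "(\<lambda>x. indicat_real (X \<inter> \<Omega>) x *\<^sub>R cdiv \<phi> x) = (\<lambda>x. indicat_real X x * cdiv \<phi> x)"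
    by (auto simp: fun_eq_iff indicator_def)
  then show ?thesis unfolding set_lebesgue_integral_def by simp
qed

text \<open>Restricting the set to the domain changes nothing, since the divergences of the
  admissible fields vanish outside it.\<close>

lemma Per1_eq:
  "Per1 X \<Omega> = (SUP \<phi>\<in>unit_fields \<Omega>. ennreal (flux X \<phi>))"
  unfolding Per1_def unit_fields_def[symmetric]
  by (intro SUP_cong refl) (simp add: unit_fields_set_integral)

text \<open>On the lines where the sine vanishes this field is \<eta> times the outward unit normal
  of the stripes, so its flux is their boundary length weighted by \<eta>.\<close>

lemma stripe_unit_field:
  fixes k :: real
  assumes \<eta>: "C1c \<Omega> \<eta>" "\<And>x. 0 \<le> \<eta> x" "\<And>x. \<eta> x \<le> 1"
  defines "\<phi> \<equiv> \<lambda>x. (- cos (k * x $ 2) * \<eta> x) *\<^sub>R (axis 2 1 :: R2)"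
  shows "\<phi> \<in> unit_fields \<Omega>"
    and "cdiv \<phi> x = k * sin (k * x $ 2) * \<eta> x - cos (k * x $ 2) * cgrad \<eta> x $ 2"
proof -
  have c: "has_C1_grad (\<lambda>x. - cos (k * x $ 2)) (\<lambda>x. - ((- k * sin (k * x $ 2)) *\<^sub>R axis 2 1))"
    by (rule has_C1_grad_minus[OF has_C1_grad_cos])
  have 1: "(\<lambda>x. \<phi> x $ 1) = (\<lambda>x. 0)" and 2: "(\<lambda>x. \<phi> x $ 2) = (\<lambda>x. - cos (k * x $ 2) * \<eta> x)"
    by (auto simp: \<phi>_def axis_def)
  have "C1c \<Omega> (\<lambda>x. \<phi> x $ j)" for j
    using exhaust_2[of j] C1c_mult[OF c \<eta>(1)] C1c_0 1 2 by auto
  moreover have "norm (\<phi> x) \<le> 1" for x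
    using \<eta>(2,3) by (simp add: \<phi>_def abs_mult mult_le_one)
  ultimately show "\<phi> \<in> unit_fields \<Omega>" unfolding unit_fields_def by blast
  show "cdiv \<phi> x = k * sin (k * x $ 2) * \<eta> x - cos (k * x $ 2) * cgrad \<eta> x $ 2"
    unfolding cdiv_2 1 2 has_C1_grad_cgrad[OF has_C1_grad_const]
      has_C1_grad_cgrad[OF has_C1_grad_mult[OF c C1c_has_grad[OF \<eta>(1)]]]
    by (simp add: axis_def)
qed

text \<open>Centre (L, 0), half side \<open>l\<close>; steepness \<open>2 / l\<close> makes the
  value 1 on the concentric square of half side \<open>l / 2\<close>. Its integral is of order
  \<open>l\<^sup>2\<close>, that of its derivative at most of order \<open>l\<close>; this gap lets
  the stripe perimeter win in large squares.\<close>

definition square_cutoff :: "real \<Rightarrow> real \<Rightarrow> R2 \<Rightarrow> real" where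
  "square_cutoff L l = box_cutoff (vector [L - l, - l]) (vector [L + l, l]) (2 / l)"

lemma square_cutoff:
  assumes "l > 0"
  shows "cbox (vector [L - l, - l]) (vector [L + l, l]) \<subseteq> \<Omega> \<Longrightarrow> C1c \<Omega> (square_cutoff L l)"
    and "0 \<le> square_cutoff L l x" "square_cutoff L l x \<le> 1"
    and "x \<notin> cbox (vector [L - l, - l]) (vector [L + l, l]) \<Longrightarrow> square_cutoff L l x = 0"
    and "\<bar>x $ 1 - L\<bar> \<le> l / 2 \<Longrightarrow> \<bar>x $ 2\<bar> \<le> l / 2 \<Longrightarrow> square_cutoff L l x = 1"
    and "(LINT x|lebesgue. square_cutoff L l x) \<ge> l\<^sup>2"
    and "(LINT x|lebesgue. square_cutoff L l x) \<le> 4 * l\<^sup>2"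
    and "(LINT x|lebesgue. \<bar>cgrad (square_cutoff L l) x $ 2\<bar>) \<le> 64 * l"
proof -
  let ?a = "vector [L - l, - l] :: R2" and ?b = "vector [L + l, l] :: R2"
  let ?\<eta> = "square_cutoff L l"
  have C: "C1c \<Omega> ?\<eta>" if "cbox ?a ?b \<subseteq> \<Omega>" for \<Omega>
    unfolding square_cutoff_def using assms that by (intro box_cutoff_C1c) auto
  then show "cbox ?a ?b \<subseteq> \<Omega> \<Longrightarrow> C1c \<Omega> ?\<eta>" .
  show b: "0 \<le> ?\<eta> x" "?\<eta> x \<le> 1" for x
    unfolding square_cutoff_def by (rule box_cutoff_bounds)+
  obtain K where K: "compact K" "K \<subseteq> cbox ?a ?b" "\<And>x. x \<notin> K \<Longrightarrow> ?\<eta> x = 0" "\<And>x. x \<notin> K \<Longrightarrow> cgrad ?\<eta> x = 0"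
    using C1c_support[OF C[OF subset_refl]] by metis
  show z: "?\<eta> x = 0" if "x \<notin> cbox ?a ?b" for x using that K by blast
  have z': "cgrad ?\<eta> x = 0" if "x \<notin> cbox ?a ?b" for x using that K by blast
  show one: "?\<eta> x = 1" if "\<bar>x $ 1 - L\<bar> \<le> l / 2" "\<bar>x $ 2\<bar> \<le> l / 2" for x
  proof -
    have "2 / l * t \<ge> 1" if "t \<ge> l / 2" for t using that assms by (simp add: field_simps)
    then have *: "sstep (2 / l * t) = 1" if "t \<ge> l / 2" for t using that sstep_eq_1 by blast
    show ?thesis unfolding square_cutoff_def box_cutoff_def using that by (subst (1 2 3 4) *; simp; linarith)
  qed
  note int = C1c_integrable(3,4)[OF C[OF subset_UNIV]]
  have area: "measure lebesgue (cbox p q) = (q $ 1 - p $ 1) * (q $ 2 - p $ 2)" "integrable lebesgue (indicat_real (cbox p q))"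
    if "p $ 1 \<le> q $ 1" "p $ 2 \<le> q $ 2" for p q :: R2
  proof -
    have "p \<in> cbox p q" using that by (simp add: mem_cbox_2)
    then have "cbox p q \<noteq> {}" by blast
    then show "measure lebesgue (cbox p q) = (q $ 1 - p $ 1) * (q $ 2 - p $ 2)"
      by (simp add: content_cbox_cart UNIV_2 measure_completion)
    show "integrable lebesgue (indicat_real (cbox p q))"
      using lmeasurable_cbox[of p q] by (simp add: fmeasurable_def)
  qed
  let ?p = "vector [L - l / 2, - l / 2] :: R2" and ?q = "vector [L + l / 2, l / 2] :: R2"
  have "(LINT x|lebesgue. indicat_real (cbox ?p ?q) x) \<le> (LINT x|lebesgue. ?\<eta> x)"
  proof (rule integral_mono)
    show "indicat_real (cbox ?p ?q) x \<le> ?\<eta> x" for x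
    proof (cases "x \<in> cbox ?p ?q")
      case True
      then have c: "L - l / 2 \<le> x $ 1 \<and> x $ 1 \<le> L + l / 2 \<and> - (l / 2) \<le> x $ 2 \<and> x $ 2 \<le> l / 2"
        by (simp add: mem_cbox_2)
      have "\<bar>x $ 1 - L\<bar> \<le> l / 2" using c by linarith
      moreover have "\<bar>x $ 2\<bar> \<le> l / 2" using c by linarith
      ultimately show ?thesis using one[of x] by (simp add: indicator_def)
    qed (use b in simp)
  qed (use area(2)[of ?p ?q] int(1) assms in auto)
  then show "(LINT x|lebesgue. ?\<eta> x) \<ge> l\<^sup>2"
    using area(1)[of ?p ?q] assms by (simp add: power2_eq_square)
  have ar: "measure lebesgue (cbox ?a ?b) = 4 * l\<^sup>2" "integrable lebesgue (indicat_real (cbox ?a ?b))"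
    using area[of ?a ?b] assms by (auto simp: power2_eq_square)
  have "(LINT x|lebesgue. ?\<eta> x) \<le> (LINT x|lebesgue. indicat_real (cbox ?a ?b) x)"
  proof (rule integral_mono)
    show "?\<eta> x \<le> indicat_real (cbox ?a ?b) x" for x
      using b(2)[of x] z[of x] by (auto simp: indicator_def)
  qed (fact int(1) ar(2))+
  then show "(LINT x|lebesgue. ?\<eta> x) \<le> 4 * l\<^sup>2" using ar(1) by simp
  \<comment> \<open>Two slopes of at most \<open>4 * m\<close> each, with \<open>m = 2 / l\<close>,
    add up to \<open>16 / l\<close>; times the area \<open>4 * l\<^sup>2\<close> of the support this
    becomes \<open>64 * l\<close>.\<close>
  have grad_le: "\<bar>cgrad ?\<eta> x $ 2\<bar> \<le> 16 / l" for x
  proof -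
    define m where "m = 2 / l"
    have m: "m > 0" unfolding m_def using assms by simp
    have up: "has_C1_grad (\<lambda>x. sstep (m * (x $ i - c))) (\<lambda>x. (sstep' (m * (x $ i - c)) * m) *\<^sub>R axis i 1)" for i c
      using has_C1_grad_sstep[OF has_C1_grad_affine[of m i c]] by simp
    have down: "has_C1_grad (\<lambda>x. sstep (m * (c - x $ i))) (\<lambda>x. (sstep' (m * (c - x $ i)) * - m) *\<^sub>R axis i 1)" for i c
      using has_C1_grad_sstep[OF has_C1_grad_affine[of "- m" i c]] by (simp add: algebra_simps)
    note pr = has_C1_grad_mult[OF has_C1_grad_mult[OF up[of 1 "?a $ 1"] down[of "?b $ 1" 1]] has_C1_grad_mult[OF up[of 2 "?a $ 2"] down[of "?b $ 2" 2]]]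
    have e: "cgrad ?\<eta> x $ 2 = sstep (m * (x $ 1 - ?a $ 1)) * sstep (m * (?b $ 1 - x $ 1)) *
       (sstep (m * (x $ 2 - ?a $ 2)) * (sstep' (m * (?b $ 2 - x $ 2)) * - m) +
        sstep (m * (?b $ 2 - x $ 2)) * (sstep' (m * (x $ 2 - ?a $ 2)) * m))"
      unfolding square_cutoff_def m_def[symmetric] box_cutoff_def[abs_def] has_C1_grad_cgrad[OF pr]
      by (simp add: axis_def)
    have d: "\<bar>sstep t * (sstep' t' * n)\<bar> \<le> 4 * m" if "\<bar>n\<bar> = m" for t t' n
    proof -
      have "\<bar>sstep t * (sstep' t' * n)\<bar> = sstep t * (sstep' t' * m)"
        using that sstep_nonneg[of t] sstep'_nonneg[of t'] by (simp add: abs_mult)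
      also have "\<dots> \<le> 1 * (4 * m)"
        using m by (intro mult_mono sstep_le_1 sstep'_le mult_nonneg_nonneg sstep'_nonneg) auto
      finally show ?thesis by simp
    qed
    have "\<bar>cgrad ?\<eta> x $ 2\<bar> \<le> 1 * (4 * m + 4 * m)"
      unfolding e abs_mult[of "sstep _ * sstep _"]
      using d[of "- m"] d[of m] m
      by (intro mult_mono order_trans[OF abs_triangle_ineq add_mono]) (auto simp: abs_mult sstep_nonneg sstep_le_1 intro!: mult_le_one)
    then show ?thesis unfolding m_def by simp
  qed
  have "(LINT x|lebesgue. \<bar>cgrad ?\<eta> x $ 2\<bar>) \<le> (LINT x|lebesgue. 16 / l * indicat_real (cbox ?a ?b) x)"
  proof (rule integral_mono)
    show "\<bar>cgrad ?\<eta> x $ 2\<bar> \<le> 16 / l * indicat_real (cbox ?a ?b) x" for x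
      using grad_le[of x] z'[of x] by (auto simp: indicator_def)
  qed (use ar(2) int(2) in auto)
  also have "\<dots> = 64 * l" using ar assms by (simp add: power2_eq_square)
  finally show "(LINT x|lebesgue. \<bar>cgrad ?\<eta> x $ 2\<bar>) \<le> 64 * l" .
qed

section \<open>Classical perimeter\<close>

lemma C1c_cutoff_ball:
  assumes "R > 0"
  obtains \<zeta> where "C1c UNIV \<zeta>" "\<And>x. 0 \<le> \<zeta> x" "\<And>x. x \<in> ball 0 R \<Longrightarrow> \<zeta> x = 1"
proof (rule that[of "square_cutoff 0 (2 * R)"])
  fix x :: R2 assume "x \<in> ball 0 R"
  then show "square_cutoff 0 (2 * R) x = 1"
    using assms component_le_norm_cart[of x 1] component_le_norm_cart[of x 2]
    by (intro square_cutoff) auto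
qed (use assms in \<open>auto intro!: square_cutoff\<close>)

text \<open>With \<open>sstep (n * sin)\<close> in place of the indicator, the derivative can be
  moved from the field to a C1 function. The resulting bound \<open>C\<close> depends neither on the
  field nor on n, so it survives the limit and bounds the supremum.\<close>

lemma Per1_stripes_finite:
  assumes "R > 0" "k > 0"
  shows "Per1 (stripes k) (ball 0 R) < \<infinity>"
proof -
  let ?s = "\<lambda>x::R2. sin (k * x $ 2)" and ?c = "\<lambda>x::R2. cos (k * x $ 2)"
  obtain \<zeta> where \<zeta>: "C1c UNIV \<zeta>" "\<And>x. 0 \<le> \<zeta> x" "\<And>x. x \<in> ball 0 R \<Longrightarrow> \<zeta> x = 1"
    using C1c_cutoff_ball[OF assms(1)] by metis
  define \<psi> where "\<psi> x = ?c x * \<zeta> x" for x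
  have \<psi>: "C1c UNIV \<psi>" unfolding \<psi>_def[abs_def] by (rule C1c_mult[OF has_C1_grad_cos \<zeta>(1)])
  note i\<psi> = C1c_integrable(4)[OF \<psi>, of 2]
  define C where "C = 2 * (LINT x|lebesgue. \<bar>cgrad \<psi> x $ 2\<bar>)"
  have "ennreal (flux (stripes k) \<phi>) \<le> ennreal C"
    if \<phi>: "\<phi> \<in> unit_fields (ball 0 R)" for \<phi>
  proof -
    obtain K where K: "compact K" "K \<subseteq> ball 0 R" "\<And>x. x \<notin> K \<Longrightarrow> \<phi> x = 0" "\<And>x. x \<notin> K \<Longrightarrow> cdiv \<phi> x = 0"
      "continuous_on UNIV (cdiv \<phi>)" "\<And>j. C1c (ball 0 R) (\<lambda>x. \<phi> x $ j)"
      using unit_fields_support[OF \<phi>] by metis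
    have i\<phi>: "integrable lebesgue (cdiv \<phi>)" using \<phi> by (rule unit_fields_integrable)
    let ?g = "\<lambda>n x. sstep (real n * ?s x)"
    define D where "D n x = sstep' (real n * ?s x) * (real n * (k * ?c x))" for n and x :: R2
    have g: "has_C1_grad (?g n) (\<lambda>x. D n x *\<^sub>R axis 2 1)" for n
    proof -
      have "has_C1_grad (\<lambda>x. real n * ?s x) (\<lambda>x. (real n * (k * ?c x)) *\<^sub>R axis 2 1)"
        using has_C1_grad_mult[OF has_C1_grad_const[of "real n"] has_C1_grad_sin[of k]] by simp
      from has_C1_grad_sstep[OF this] show ?thesis by (simp add: D_def)
    qed
    have "(\<lambda>n. LINT x|lebesgue. ?g n x * cdiv \<phi> x) \<longlonglongrightarrow> flux (stripes k) \<phi>"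
    proof (rule integral_dominated_convergence[where w = "\<lambda>x. norm (cdiv \<phi> x)"])
      show "(\<lambda>x. indicat_real (stripes k) x * cdiv \<phi> x) \<in> borel_measurable lebesgue"
        using integrable_mult_indicator[OF stripes_lebesgue i\<phi>, of k] by (auto dest: borel_measurable_integrable)
      show "(\<lambda>x. ?g n x * cdiv \<phi> x) \<in> borel_measurable lebesgue" for n
        by (intro borel_measurable_times lebesgue_measurable_continuous K(5) has_C1_grad_continuous[OF g])
      show "AE x in lebesgue. (\<lambda>n. ?g n x * cdiv \<phi> x) \<longlonglongrightarrow> indicat_real (stripes k) x * cdiv \<phi> x"
      proof (rule AE_I2)
        fix x
        have "(\<lambda>n. ?g n x * cdiv \<phi> x) \<longlonglongrightarrow> (if ?s x > 0 then 1 else 0) * cdiv \<phi> x"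
          by (intro tendsto_mult tendsto_const tendsto_sstep_mult)
        then show "(\<lambda>n. ?g n x * cdiv \<phi> x) \<longlonglongrightarrow> indicat_real (stripes k) x * cdiv \<phi> x"
          by (auto simp: stripes_def indicator_def split: if_splits)
      qed
      show "AE x in lebesgue. norm (?g n x * cdiv \<phi> x) \<le> norm (cdiv \<phi> x)" for n
        by (intro AE_I2) (simp add: abs_mult sstep_nonneg sstep_le_1 mult_left_le_one_le)
    qed (use i\<phi> in auto)
    moreover have "\<forall>\<^sub>F n in sequentially. (LINT x|lebesgue. ?g n x * cdiv \<phi> x) \<le> C"
      unfolding eventually_sequentially
    proof (intro exI[of _ 2] allI impI)
      fix n :: nat assume n: "2 \<le> n"
      note p1 = integral_by_parts[OF g[of n] K(6), of 1 1]
      note p2 = integral_by_parts[OF g[of n] K(6), of 2 2]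
      note p3 = integral_by_parts[OF g[of n] \<psi>, of 2]
      have "(LINT x|lebesgue. ?g n x * cdiv \<phi> x) = (LINT x|lebesgue. ?g n x * cgrad (\<lambda>x. \<phi> x $ 1) x $ 1 + ?g n x * cgrad (\<lambda>x. \<phi> x $ 2) x $ 2)"
        by (simp add: cdiv_2 algebra_simps)
      also have "\<dots> = (LINT x|lebesgue. ?g n x * cgrad (\<lambda>x. \<phi> x $ 1) x $ 1) + (LINT x|lebesgue. ?g n x * cgrad (\<lambda>x. \<phi> x $ 2) x $ 2)"
        using p1(2) p2(2) by (rule Bochner_Integration.integral_add)
      also have "\<dots> = (LINT x|lebesgue. - (D n x * \<phi> x $ 2))"
        unfolding p1(1) p2(1) by (simp add: axis_def)
      also have "\<dots> \<le> (LINT x|lebesgue. 2 * (D n x * \<psi> x))"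
      proof (rule integral_mono)
        show "integrable lebesgue (\<lambda>x. - (D n x * \<phi> x $ 2))" using p2(3) by (simp add: axis_def)
        show "integrable lebesgue (\<lambda>x. 2 * (D n x * \<psi> x))" using p3(3) by (simp add: axis_def)
        fix x
        have Dc: "0 \<le> D n x * ?c x"
        proof -
          have "D n x * ?c x = sstep' (real n * ?s x) * (real n * k) * (?c x)\<^sup>2"
            by (simp add: D_def power2_eq_square)
          then show ?thesis using sstep'_nonneg[of "real n * ?s x"] \<open>k > 0\<close> by simp
        qed
        show "- (D n x * \<phi> x $ 2) \<le> 2 * (D n x * \<psi> x)"
        proof (cases "x \<in> K")
          case True
          then have 1: "\<zeta> x = 1" using K(2) \<zeta>(3) by blast
          have "norm (\<phi> x) \<le> 1" using \<phi> unfolding unit_fields_def by blast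
          then have ph: "\<bar>\<phi> x $ 2\<bar> \<le> 1" using component_le_norm_cart[of "\<phi> x" 2] by linarith
          \<comment> \<open>The transition layers lie where \<open>sin < 1/2\<close>, so \<open>\<bar>cos\<bar> \<le> 2 cos\<^sup>2\<close>: multiplying by \<open>cos\<close>
            makes the sign of the derivative constant, and the total variation is bounded by parts.\<close>
          have "\<bar>D n x\<bar> \<le> 2 * (D n x * ?c x)"
          proof (cases "0 < real n * ?s x \<and> real n * ?s x < 1")
            case True
            have "2 * ?s x \<le> real n * ?s x" using n True by (intro mult_right_mono) (auto simp: zero_less_mult_iff)
            then have "?s x < 1/2" using True by linarith
            moreover have "?s x > 0" using True by (simp add: zero_less_mult_iff)
            ultimately have "(?s x)\<^sup>2 \<le> (1/2)\<^sup>2" by (intro power_mono) auto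
            then have "(1/2)\<^sup>2 \<le> (?c x)\<^sup>2" unfolding cos_squared_eq by (simp add: power_divide)
            then have "1/2 \<le> \<bar>?c x\<bar>" by (simp add: abs_le_square_iff[symmetric])
            then have "1 * \<bar>D n x\<bar> \<le> (2 * \<bar>?c x\<bar>) * \<bar>D n x\<bar>" by (intro mult_right_mono) auto
            also have "\<dots> = 2 * (D n x * ?c x)" using Dc by (simp add: mult_ac flip: abs_mult)
            finally show ?thesis by simp
          next
            case False
            then have "sstep' (real n * ?s x) = 0" by (intro sstep'_eq_0) auto
            then show ?thesis by (simp add: D_def)
          qed
          moreover have "- (D n x * \<phi> x $ 2) \<le> \<bar>D n x\<bar> * 1"
            using mult_left_mono[OF ph, of "\<bar>D n x\<bar>"] by (simp flip: abs_mult)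
          ultimately show ?thesis unfolding \<psi>_def 1 by simp
        next
          case False
          then show ?thesis using K(3) Dc \<zeta>(2)[of x] by (simp add: \<psi>_def mult.assoc[symmetric])
        qed
      qed
      also have "\<dots> = - (2 * (LINT x|lebesgue. ?g n x * cgrad \<psi> x $ 2))"
        using p3(1) by (simp add: axis_def)
      also have "\<dots> = 2 * (LINT x|lebesgue. - (?g n x * cgrad \<psi> x $ 2))" by simp
      also have "\<dots> \<le> 2 * (LINT x|lebesgue. \<bar>cgrad \<psi> x $ 2\<bar>)"
      proof (intro mult_left_mono integral_mono)
        fix x
        have "\<bar>?g n x * cgrad \<psi> x $ 2\<bar> \<le> 1 * \<bar>cgrad \<psi> x $ 2\<bar>"
          unfolding abs_mult by (intro mult_right_mono) (auto simp: sstep_nonneg sstep_le_1)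
        then show "- (?g n x * cgrad \<psi> x $ 2) \<le> \<bar>cgrad \<psi> x $ 2\<bar>" by linarith
      qed (use p3(2) i\<psi> in auto)
      finally show "(LINT x|lebesgue. ?g n x * cdiv \<phi> x) \<le> C" unfolding C_def .
    qed
    ultimately have "flux (stripes k) \<phi> \<le> C"
      by (rule tendsto_upperbound) simp
    then show ?thesis by (rule ennreal_leI)
  qed
  then have "Per1 (stripes k) (ball 0 R) \<le> ennreal C"
    unfolding Per1_eq by (rule SUP_least)
  then show ?thesis by (simp add: order_le_less_trans)
qed

text \<open>Fields supported in disjoint sets add up to a field of norm at most 1, which makes the
  perimeter superadditive.\<close>

lemma Per1_ge_disjoint:
  assumes X: "X \<in> sets lebesgue" and "\<psi> \<in> unit_fields \<Omega>'" "\<Omega>' \<subseteq> \<Omega>" "\<Omega>' \<inter> \<Omega>'' = {}" "\<Omega>'' \<subseteq> \<Omega>"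
    and pos: "0 \<le> flux X \<psi>"
  shows "Per1 X \<Omega>'' + ennreal (flux X \<psi>) \<le> Per1 X \<Omega>"
proof -
  let ?I = "flux X"
  have zero: "(\<lambda>x. 0) \<in> unit_fields A" for A by (simp add: unit_fields_def C1c_0)
  have int: "integrable lebesgue (\<lambda>x. indicat_real X x * cdiv \<phi> x)" if "\<phi> \<in> unit_fields A" for \<phi> A
    using integrable_mult_indicator[OF X unit_fields_integrable[OF that]] by simp
  have each: "ennreal (?I \<phi>) + ennreal (?I \<psi>) \<le> Per1 X \<Omega>" if \<phi>: "\<phi> \<in> unit_fields \<Omega>''" for \<phi>
  proof (cases "?I \<phi> \<ge> 0")
    case True
    let ?f = "\<lambda>x. \<phi> x + \<psi> x"
    obtain K where K: "K \<subseteq> \<Omega>''" "\<And>x. x \<notin> K \<Longrightarrow> \<phi> x = 0" using unit_fields_support[OF \<phi>] by metis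
    obtain L where L: "L \<subseteq> \<Omega>'" "\<And>x. x \<notin> L \<Longrightarrow> \<psi> x = 0" using unit_fields_support[OF assms(2)] by metis
    have C: "C1c \<Omega> (\<lambda>x. \<phi> x $ j)" "C1c \<Omega> (\<lambda>x. \<psi> x $ j)" for j
      using \<phi> assms unfolding unit_fields_def by (auto intro: C1c_mono)
    have "norm (?f x) \<le> 1" for x
    proof -
      have "\<phi> x = 0 \<or> \<psi> x = 0" using K L assms(4) by blast
      then show ?thesis using \<phi> assms(2) unfolding unit_fields_def by auto
    qed
    then have f: "?f \<in> unit_fields \<Omega>" unfolding unit_fields_def using C1c_add[OF C] by auto
    have "cdiv ?f x = cdiv \<phi> x + cdiv \<psi> x" for x
    proof -
      have "cgrad (\<lambda>x. \<phi> x $ j + \<psi> x $ j) = (\<lambda>x. cgrad (\<lambda>x. \<phi> x $ j) x + cgrad (\<lambda>x. \<psi> x $ j) x)" for j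
        by (rule has_C1_grad_cgrad[OF has_C1_grad_add[OF C1c_has_grad[OF C(1)] C1c_has_grad[OF C(2)]]])
      then show ?thesis by (simp add: cdiv_2)
    qed
    then have "?I ?f = ?I \<phi> + ?I \<psi>"
      using int[OF \<phi>] int[OF assms(2)] by (simp add: distrib_left)
    then have "ennreal (?I \<phi>) + ennreal (?I \<psi>) = ennreal (?I ?f)" using True pos by simp
    also have "\<dots> \<le> Per1 X \<Omega>" unfolding Per1_eq using f by (rule SUP_upper)
    finally show ?thesis .
  next
    case False
    \<comment> \<open>\<open>ennreal\<close> sends the negative flux of \<phi> to 0, so \<psi> alone
      is a sufficient field.\<close>
    have "\<psi> \<in> unit_fields \<Omega>" using assms(2,3) C1c_mono unfolding unit_fields_def by blast
    then have "ennreal (?I \<psi>) \<le> Per1 X \<Omega>" unfolding Per1_eq by (rule SUP_upper)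
    then show ?thesis using False by (simp add: ennreal_neg)
  qed
  have "Per1 X \<Omega>'' + ennreal (?I \<psi>) = (SUP \<phi>\<in>unit_fields \<Omega>''. ennreal (?I \<phi>) + ennreal (?I \<psi>))"
    unfolding Per1_eq using zero by (subst ennreal_SUP_add_left) auto
  also have "\<dots> \<le> Per1 X \<Omega>" using each by (rule SUP_least)
  finally show ?thesis .
qed

text \<open>For positive \<open>n\<close> it rises while t^2 goes from 1 + 1/n to 1 + 2/n. The final
  -1 keeps it 0 slightly beyond \<bar>t\<bar> = 1, so that fields cut off with it have compact
  support away from the closed square; the limit is the indicator of \<bar>t\<bar> > 1.\<close>

definition ramp :: "nat \<Rightarrow> real \<Rightarrow> real" where
  "ramp n t = sstep (real n * (t\<^sup>2 - 1) - 1)"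

definition ramp' :: "nat \<Rightarrow> real \<Rightarrow> real" where
  "ramp' n t = sstep' (real n * (t\<^sup>2 - 1) - 1) * (2 * real n * t)"

lemma ramp_deriv: "(ramp n has_real_derivative ramp' n t) (at t)"
  unfolding ramp_def[abs_def] ramp'_def
  by (rule DERIV_chain2[OF sstep_deriv]) (auto intro!: derivative_eq_intros)

lemma continuous_ramp': "continuous_on UNIV (ramp' n)"
  unfolding ramp'_def[abs_def]
  by (intro continuous_intros continuous_on_compose2[OF continuous_sstep']) auto

lemma ramp_bounds: "0 \<le> ramp n t" "ramp n t \<le> 1"
  by (auto simp: ramp_def sstep_nonneg sstep_le_1)

text \<open>The sign of \<open>ramp' n t * t\<close> is constant, so integration by parts against a cutoff bounds the
  total variation of \<open>ramp n\<close> uniformly in \<open>n\<close>.\<close>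
lemma abs_ramp'_le: "\<bar>ramp' n t\<bar> \<le> ramp' n t * t"
proof (cases "t\<^sup>2 \<le> 1")
  case True
  then have "real n * (t\<^sup>2 - 1) - 1 \<le> 0" using mult_nonneg_nonpos[of "real n" "t\<^sup>2 - 1"] by simp
  then show ?thesis by (simp add: ramp'_def sstep'_eq_0)
next
  case False
  then have "\<bar>t\<bar> \<ge> 1" using abs_square_le_1[of t] by auto
  then have "\<bar>ramp' n t\<bar> * 1 \<le> \<bar>ramp' n t\<bar> * \<bar>t\<bar>" by (intro mult_left_mono) auto
  also have "\<dots> = ramp' n t * t"
    using sstep'_nonneg[of "real n * (t\<^sup>2 - 1) - 1"] by (simp add: ramp'_def abs_mult mult.assoc) 
  finally show ?thesis by simp
qed

lemma tendsto_ramp: "(\<lambda>n. ramp n t) \<longlonglongrightarrow> (if \<bar>t\<bar> > 1 then 1 else 0)"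
proof (cases "\<bar>t\<bar> > 1")
  case True
  then have t: "t\<^sup>2 - 1 > 0" using abs_square_le_1[of t] by auto
  obtain N :: nat where N: "2 / (t\<^sup>2 - 1) < N" using reals_Archimedean2 by blast
  have "\<forall>\<^sub>F n in sequentially. ramp n t = 1"
    unfolding eventually_sequentially
  proof (intro exI allI impI)
    fix n assume "N \<le> n"
    then have "2 / (t\<^sup>2 - 1) \<le> real n" using N by linarith
    then have "2 \<le> real n * (t\<^sup>2 - 1)" using t by (simp add: pos_divide_le_eq)
    then show "ramp n t = 1" unfolding ramp_def by (intro sstep_eq_1) simp
  qed
  then show ?thesis using True by (simp add: tendsto_eventually)
next
  case False
  then have "t\<^sup>2 \<le> 1" using abs_square_le_1[of t] by auto
  then have "real n * (t\<^sup>2 - 1) - 1 \<le> 0" for n using mult_nonneg_nonpos[of "real n" "t\<^sup>2 - 1"] by simp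
  then show ?thesis using False by (simp add: ramp_def sstep_eq_0)
qed

text \<open>Any field on the ball is multiplied by a cutoff that vanishes near the square. The
  result is admissible outside the square, and the error is the gradient of the cutoff against a
  unit field, bounded by the total variation of the ramps. That bound knows nothing about
  \<open>X\<close>, so one \<open>C\<close> serves all sets.\<close>

lemma Per1_remove_square:
  obtains C :: real where "\<And>X. X \<in> sets lebesgue \<Longrightarrow>
    Per1 (X - cbox (- 1) 1) (ball 0 3) \<le> Per1 X (ball 0 3 - cbox (- 1) 1) + ennreal C"
proof -
  let ?B = "ball 0 3 :: R2 set" and ?Q = "cbox (- 1) 1 :: R2 set"
  obtain \<zeta> where \<zeta>: "C1c UNIV \<zeta>" "\<And>x. 0 \<le> \<zeta> x" "\<And>x. x \<in> ?B \<Longrightarrow> \<zeta> x = 1"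
    using C1c_cutoff_ball[of 3] by auto
  define \<psi> where "\<psi> i x = x $ i * \<zeta> x" for i x
  have \<psi>: "C1c UNIV (\<psi> i)" for i unfolding \<psi>_def[abs_def] by (rule C1c_mult[OF has_C1_grad_component \<zeta>(1)])
  note i\<psi> = C1c_integrable(4)[OF \<psi>]
  define C where "C = (LINT x|lebesgue. \<bar>cgrad (\<psi> 1) x $ 1\<bar>) + (LINT x|lebesgue. \<bar>cgrad (\<psi> 2) x $ 2\<bar>)"
  have C0: "C \<ge> 0" unfolding C_def by simp
  show ?thesis
  proof (rule that[of C])
    fix X :: "R2 set" assume X: "X \<in> sets lebesgue"
    show "Per1 (X - ?Q) ?B \<le> Per1 X (?B - ?Q) + ennreal C"
      unfolding Per1_eq[of "X - ?Q"]
    proof (rule SUP_least)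
      fix \<phi> assume \<phi>: "\<phi> \<in> unit_fields ?B"
      obtain K where K: "compact K" "K \<subseteq> ?B" "\<And>x. x \<notin> K \<Longrightarrow> \<phi> x = 0" "\<And>x. x \<notin> K \<Longrightarrow> cdiv \<phi> x = 0"
        "continuous_on UNIV (cdiv \<phi>)" "\<And>j. C1c ?B (\<lambda>x. \<phi> x $ j)"
        using unit_fields_support[OF \<phi>] by metis
      have n\<phi>: "norm (\<phi> x) \<le> 1" for x using \<phi> unfolding unit_fields_def by blast
      have i\<phi>: "integrable lebesgue (cdiv \<phi>)" using \<phi> by (rule unit_fields_integrable)
      \<comment> \<open>Tends to 1 as soon as one coordinate exceeds 1 in absolute value, and to 0
        on the closed square.\<close>
      define \<eta> where "\<eta> n x = 1 + - ((1 + - ramp n (x $ 1)) * (1 + - ramp n (x $ 2)))" for n and x :: R2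
      define G where "G n x = (ramp' n (x $ 1) * (1 - ramp n (x $ 2))) *\<^sub>R (axis 1 1 :: R2)
         + (ramp' n (x $ 2) * (1 - ramp n (x $ 1))) *\<^sub>R axis 2 1" for n and x :: R2
      have ga: "has_C1_grad (\<lambda>x. ramp n (x $ i)) (\<lambda>x. ramp' n (x $ i) *\<^sub>R axis i 1)" for n i
        by (rule has_C1_grad_of_coordinate[OF ramp_deriv continuous_ramp'])
      have g: "has_C1_grad (\<eta> n) (G n)" for n
      proof -
        note 1 = has_C1_grad_add[OF has_C1_grad_const[of 1] has_C1_grad_minus[OF ga[of n]]]
        note 2 = has_C1_grad_add[OF has_C1_grad_const[of 1] has_C1_grad_minus[OF has_C1_grad_mult[OF 1[of 1] 1[of 2]]]]
        show ?thesis using 2 unfolding \<eta>_def[abs_def] G_def[abs_def] by (simp add: algebra_simps)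
      qed
      have \<eta>01: "0 \<le> \<eta> n x" "\<eta> n x \<le> 1" for n x
        unfolding \<eta>_def using ramp_bounds[of n "x $ 1"] ramp_bounds[of n "x $ 2"] by (auto intro!: mult_le_one)
      have lim: "(\<lambda>n. LINT x|lebesgue. indicat_real X x * (\<eta> n x * cdiv \<phi> x)) \<longlonglongrightarrow>
          flux (X - ?Q) \<phi>"
      proof (rule integral_dominated_convergence[where w = "\<lambda>x. norm (cdiv \<phi> x)"])
        have "X - ?Q \<in> sets lebesgue" using X by auto
        from integrable_mult_indicator[OF this i\<phi>]
        show "(\<lambda>x. indicat_real (X - ?Q) x * cdiv \<phi> x) \<in> borel_measurable lebesgue"
          by (auto dest: borel_measurable_integrable)
        show "(\<lambda>x. indicat_real X x * (\<eta> n x * cdiv \<phi> x)) \<in> borel_measurable lebesgue" for n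
          by (intro borel_measurable_times borel_measurable_indicator X lebesgue_measurable_continuous K(5) has_C1_grad_continuous[OF g])
        show "AE x in lebesgue. (\<lambda>n. indicat_real X x * (\<eta> n x * cdiv \<phi> x)) \<longlonglongrightarrow> indicat_real (X - ?Q) x * cdiv \<phi> x"
        proof (rule AE_I2)
          fix x
          have "(\<lambda>n. indicat_real X x * (\<eta> n x * cdiv \<phi> x)) \<longlonglongrightarrow>
             indicat_real X x * ((1 + - ((1 + - (if \<bar>x $ 1\<bar> > 1 then 1 else 0)) * (1 + - (if \<bar>x $ 2\<bar> > 1 then 1 else 0)))) * cdiv \<phi> x)"
            unfolding \<eta>_def by (intro tendsto_intros tendsto_ramp)
          also have "indicat_real X x * ((1 + - ((1 + - (if \<bar>x $ 1\<bar> > 1 then 1 else 0)) * (1 + - (if \<bar>x $ 2\<bar> > 1 then 1 else 0)))) * cdiv \<phi> x)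
             = indicat_real (X - ?Q) x * cdiv \<phi> x"
            by (auto simp: indicator_def mem_cbox_2)
          finally show "(\<lambda>n. indicat_real X x * (\<eta> n x * cdiv \<phi> x)) \<longlonglongrightarrow> indicat_real (X - ?Q) x * cdiv \<phi> x" .
        qed
        show "AE x in lebesgue. norm (indicat_real X x * (\<eta> n x * cdiv \<phi> x)) \<le> norm (cdiv \<phi> x)" for n
          using \<eta>01 by (intro AE_I2) (auto simp: abs_mult indicator_def mult_left_le_one_le)
      qed (use i\<phi> in auto)
      have bound: "ennreal (LINT x|lebesgue. indicat_real X x * (\<eta> n x * cdiv \<phi> x)) \<le> Per1 X (?B - ?Q) + ennreal C"
        if n: "n > 0" for n
      proof -
        let ?f = "\<lambda>x. \<eta> n x *\<^sub>R \<phi> x"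
        \<comment> \<open>A closed set that misses the square and outside which the cutoff is 0; its
          intersection with \<open>K\<close> is the compact support required by
          \<open>C1c\<close>.\<close>
        define S where "S = {x::R2. (x $ 1)\<^sup>2 \<ge> 1 + 1 / real n} \<union> {x. (x $ 2)\<^sup>2 \<ge> 1 + 1 / real n}"
        have Scl: "closed S" unfolding S_def by (intro closed_Un closed_Collect_le continuous_intros)
        have SQ: "S \<inter> ?Q = {}"
        proof -
          have "x \<notin> ?Q" if "x \<in> S" for x
          proof -
            have "(x $ 1)\<^sup>2 > 1 \<or> (x $ 2)\<^sup>2 > 1"
              using that n unfolding S_def by (auto intro: less_le_trans[rotated])
            then show ?thesis using abs_square_le_1[of "x $ 1"] abs_square_le_1[of "x $ 2"] by (auto simp: mem_cbox_2)
          qed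
          then show ?thesis by blast
        qed
        have \<eta>0: "\<eta> n x = 0" if "x \<notin> S" for x
        proof -
          have "ramp n t = 0" if "t\<^sup>2 < 1 + 1 / real n" for t
          proof -
            have "real n * (t\<^sup>2 - 1) \<le> real n * (1 / real n)" using that by (intro mult_left_mono) auto
            then show ?thesis unfolding ramp_def using n by (intro sstep_eq_0) simp
          qed
          then show ?thesis using that unfolding S_def \<eta>_def by simp
        qed
        have f: "?f \<in> unit_fields (?B - ?Q)"
        proof -
          have "C1c (?B - ?Q) (\<lambda>x. ?f x $ j)" for j
          proof (rule C1cI[of _ _ "K \<inter> S"])
            show "has_C1_grad (\<lambda>x. ?f x $ j) (\<lambda>x. \<eta> n x *\<^sub>R cgrad (\<lambda>x. \<phi> x $ j) x + \<phi> x $ j *\<^sub>R G n x)"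
              using has_C1_grad_mult[OF g C1c_has_grad[OF K(6)]] by simp
            show "compact (K \<inter> S)" using K(1) Scl by (rule compact_Int_closed)
            show "?f x $ j = 0" if "x \<notin> K \<inter> S" for x using that K(3)[of x] \<eta>0[of x] by auto
          qed (use K(2) SQ in auto)
          moreover have "norm (?f x) \<le> 1" for x
            using \<eta>01[of n x] n\<phi>[of x] by (simp add: mult_le_one)
          ultimately show ?thesis unfolding unit_fields_def by blast
        qed
        have div: "cdiv ?f x = \<eta> n x * cdiv \<phi> x + G n x \<bullet> \<phi> x" for x
        proof -
          have "cgrad (\<lambda>x. \<eta> n x * \<phi> x $ j) = (\<lambda>x. \<eta> n x *\<^sub>R cgrad (\<lambda>x. \<phi> x $ j) x + \<phi> x $ j *\<^sub>R G n x)" for j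
            by (rule has_C1_grad_cgrad[OF has_C1_grad_mult[OF g C1c_has_grad[OF K(6)]]])
          then show ?thesis by (simp add: cdiv_2 inner_vec_def sum_2 algebra_simps)
        qed
        note p = integral_by_parts[OF ga[of n] \<psi>]
        have est: "\<bar>G n x \<bullet> \<phi> x\<bar> \<le> ramp' n (x $ 1) * \<psi> 1 x + ramp' n (x $ 2) * \<psi> 2 x" for x
        proof (cases "x \<in> K")
          case True
          then have 1: "\<zeta> x = 1" using K(2) \<zeta>(3) by blast
          have t: "\<bar>ramp' n t * (1 - ramp n t') * \<phi> x $ j\<bar> \<le> ramp' n t * t" for t t' j
          proof -
            have "\<bar>\<phi> x $ j\<bar> \<le> 1" using component_le_norm_cart[of "\<phi> x" j] n\<phi>[of x] by linarith
            then have "\<bar>ramp' n t * (1 - ramp n t') * \<phi> x $ j\<bar> \<le> \<bar>ramp' n t\<bar> * 1 * 1"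
              unfolding abs_mult using ramp_bounds[of n t'] by (intro mult_mono) auto
            then show ?thesis using abs_ramp'_le[of n t] by simp
          qed
          have "G n x \<bullet> \<phi> x = ramp' n (x $ 1) * (1 - ramp n (x $ 2)) * \<phi> x $ 1 + ramp' n (x $ 2) * (1 - ramp n (x $ 1)) * \<phi> x $ 2"
            unfolding G_def by (simp add: inner_add_left inner_axis')
          then show ?thesis
            using t[of "x $ 1" "x $ 2" 1] t[of "x $ 2" "x $ 1" 2] 1 unfolding \<psi>_def by (simp add: abs_le_iff)
        next
          case False
          have "0 \<le> ramp' n t * t" for t using abs_ramp'_le[of n t] by linarith
          then have "0 \<le> ramp' n (x $ i) * \<psi> i x" for i
            using \<zeta>(2)[of x] unfolding \<psi>_def by (simp add: mult.assoc[symmetric])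
          then show ?thesis using K(3)[OF False] by simp
        qed
        have ip: "(LINT x|lebesgue. ramp' n (x $ i) * \<psi> i x) \<le> (LINT x|lebesgue. \<bar>cgrad (\<psi> i) x $ i\<bar>)" for i
        proof -
          have "(LINT x|lebesgue. ramp' n (x $ i) * \<psi> i x) = (LINT x|lebesgue. - (ramp n (x $ i) * cgrad (\<psi> i) x $ i))"
            using p(1)[of i i i] by (simp add: axis_def)
          also have "\<dots> \<le> (LINT x|lebesgue. \<bar>cgrad (\<psi> i) x $ i\<bar>)"
          proof (rule integral_mono)
            fix x
            have "\<bar>ramp n (x $ i) * cgrad (\<psi> i) x $ i\<bar> \<le> 1 * \<bar>cgrad (\<psi> i) x $ i\<bar>"
              unfolding abs_mult using ramp_bounds[of n "x $ i"] by (intro mult_right_mono) auto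
            then show "- (ramp n (x $ i) * cgrad (\<psi> i) x $ i) \<le> \<bar>cgrad (\<psi> i) x $ i\<bar>" by linarith
          qed (use p(2)[of i i i] i\<psi>[of i] in auto)
          finally show ?thesis .
        qed
        have ii: "integrable lebesgue (\<lambda>x. ramp' n (x $ i) * \<psi> i x)" for i
          using p(3)[of i i i] by (simp add: axis_def)
        have iX: "integrable lebesgue (\<lambda>x. indicat_real X x * cdiv ?f x)"
          using integrable_mult_indicator[OF X unit_fields_integrable[OF f]] by simp
        have "integrable lebesgue (\<lambda>x. \<eta> n x * cdiv \<phi> x)"
          using K(4) by (intro integrable_cont_compact_support[OF _ K(1)] continuous_intros K(5) has_C1_grad_continuous[OF g]) auto
        from integrable_mult_indicator[OF X this]
        have iY: "integrable lebesgue (\<lambda>x. indicat_real X x * (\<eta> n x * cdiv \<phi> x))" by simp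
        have "(LINT x|lebesgue. indicat_real X x * (\<eta> n x * cdiv \<phi> x)) \<le>
           (LINT x|lebesgue. indicat_real X x * cdiv ?f x + (ramp' n (x $ 1) * \<psi> 1 x + ramp' n (x $ 2) * \<psi> 2 x))"
        proof (rule integral_mono)
          fix x
          show "indicat_real X x * (\<eta> n x * cdiv \<phi> x) \<le> indicat_real X x * cdiv ?f x + (ramp' n (x $ 1) * \<psi> 1 x + ramp' n (x $ 2) * \<psi> 2 x)"
            unfolding div using est[of x] by (auto simp: indicator_def)
        qed (use iX iY ii in auto)
        also have "\<dots> = flux X ?f + ((LINT x|lebesgue. ramp' n (x $ 1) * \<psi> 1 x) + (LINT x|lebesgue. ramp' n (x $ 2) * \<psi> 2 x))"
          using iX ii by simp
        also have "\<dots> \<le> flux X ?f + C"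
          unfolding C_def by (intro add_left_mono add_mono ip)
        \<comment> \<open>The flux may be negative, and \<open>ennreal\<close> is additive only on
          nonnegative numbers.\<close>
        also have "\<dots> \<le> max 0 (flux X ?f) + C" by simp
        finally have "ennreal (LINT x|lebesgue. indicat_real X x * (\<eta> n x * cdiv \<phi> x)) \<le> ennreal (max 0 (flux X ?f) + C)"
          by (rule ennreal_leI)
        also have "\<dots> = ennreal (flux X ?f) + ennreal C"
          using C0 by (subst ennreal_plus) (auto simp: max_def ennreal_neg)
        also have "ennreal (flux X ?f) \<le> Per1 X (?B - ?Q)"
          unfolding Per1_eq by (rule SUP_upper[OF f])
        finally show ?thesis by simp
      qed
      show "ennreal (flux (X - ?Q) \<phi>) \<le> Per1 X (?B - ?Q) + ennreal C"
      proof (rule tendsto_upperbound[OF tendsto_ennrealI[OF lim]])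
        show "\<forall>\<^sub>F n in sequentially. ennreal (LINT x|lebesgue. indicat_real X x * (\<eta> n x * cdiv \<phi> x)) \<le> Per1 X (?B - ?Q) + ennreal C"
          using bound by (auto simp: eventually_sequentially intro!: exI[of _ 1])
      qed simp
    qed
  qed
qed

text \<open>The function \<open>h\<close> absorbs the error made where \<open>X\<close> differs from the stripes.\<close>
lemma Per1_ge_stripe_flux:
  assumes \<eta>: "C1c \<Omega> \<eta>" "\<And>x. 0 \<le> \<eta> x" "\<And>x. \<eta> x \<le> 1" and "k > 0"
    and X: "X \<in> sets lebesgue" and h: "integrable lebesgue h"
    and ge: "\<And>x. k * max 0 (sin (k * x $ 2)) * \<eta> x - h x \<le> indicat_real X x * (k * sin (k * x $ 2) * \<eta> x)"
  obtains \<phi> where "\<phi> \<in> unit_fields \<Omega>"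
    "flux X \<phi> \<ge> k / 4 * (LINT x|lebesgue. \<eta> x)
       - 7 / 4 * (LINT x|lebesgue. \<bar>cgrad \<eta> x $ 2\<bar>) - (LINT x|lebesgue. h x)"
proof -
  define \<phi> where "\<phi> x = (- cos (k * x $ 2) * \<eta> x) *\<^sub>R (axis 2 1 :: R2)" for x
  note f = stripe_unit_field[OF \<eta>, of k, folded \<phi>_def[abs_def]]
  note s = C1c_stripe_sin_integral[OF \<eta>(1,2) \<open>k > 0\<close>]
  \<comment> \<open>The divergence also contains cos times the derivative of \<eta>, which raises
    the loss from 3/4 to 7/4 of the L1 norm.\<close>
  have "(LINT x|lebesgue. k * max 0 (sin (k * x $ 2)) * \<eta> x - h x - \<bar>cgrad \<eta> x $ 2\<bar>) \<le> flux X \<phi>"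
  proof (rule integral_mono)
    show "integrable lebesgue (\<lambda>x. indicat_real X x * cdiv \<phi> x)"
      using integrable_mult_indicator[OF X unit_fields_integrable[OF f(1)]] by simp
    fix x
    have "\<bar>cos (k * x $ 2) * cgrad \<eta> x $ 2\<bar> \<le> 1 * \<bar>cgrad \<eta> x $ 2\<bar>"
      unfolding abs_mult by (intro mult_right_mono) auto
    then show "k * max 0 (sin (k * x $ 2)) * \<eta> x - h x - \<bar>cgrad \<eta> x $ 2\<bar> \<le> indicat_real X x * cdiv \<phi> x"
      unfolding f(2) using ge[of x] by (auto simp: indicator_def)
  qed (use s h in auto)
  moreover have "(LINT x|lebesgue. k * max 0 (sin (k * x $ 2)) * \<eta> x - h x - \<bar>cgrad \<eta> x $ 2\<bar>) =
    (LINT x|lebesgue. k * max 0 (sin (k * x $ 2)) * \<eta> x) - (LINT x|lebesgue. h x) - (LINT x|lebesgue. \<bar>cgrad \<eta> x $ 2\<bar>)"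
    using s h by simp
  ultimately show ?thesis using s(1) by (intro that[OF f(1)]) simp
qed

text \<open>Both perimeters are compared with that of the stripes in the ball minus the square:
  cutting adds at most \<open>C\<close>, while the stripes inside the square add a flux that exceeds
  \<open>C\<close> for large \<open>k\<close>.\<close>

lemma Per1_stripes_remove_square:
  obtains k :: real where "k > 0" "Per1 (stripes k - cbox (- 1) 1) (ball 0 3) < Per1 (stripes k) (ball 0 3)"
proof -
  let ?B = "ball 0 3 :: R2 set" and ?Q = "cbox (- 1) 1 :: R2 set"
  obtain C where C: "\<And>X. X \<in> sets lebesgue \<Longrightarrow> Per1 (X - ?Q) ?B \<le> Per1 X (?B - ?Q) + ennreal C"
    using Per1_remove_square by metis
  \<comment> \<open>For \<open>l = 1/2\<close> the flux is at least k/4 * 1/4 - 7/4 * 32 = k/16 -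
    56, which this choice makes \<bar>C\<bar> + 1.\<close>
  define k where "k = 16 * (\<bar>C\<bar> + 57)"
  have k: "k > 0" unfolding k_def by simp
  let ?\<eta> = "square_cutoff 0 (1/2)" and ?P = "box (- 1) 1 :: R2 set"
  note sq = square_cutoff[of "1/2", where L = 0, simplified]
  have "cbox (vector [- (1/2), - (1/2)]) (vector [1/2, 1/2]) \<subseteq> ?P"
    by (auto simp: mem_box_2 mem_cbox_2)
  then have c: "C1c ?P ?\<eta>" by (intro square_cutoff(1)) auto
  obtain \<phi> where \<phi>: "\<phi> \<in> unit_fields ?P"
    "flux (stripes k) \<phi> \<ge> k / 4 * (LINT x|lebesgue. ?\<eta> x)
       - 7 / 4 * (LINT x|lebesgue. \<bar>cgrad ?\<eta> x $ 2\<bar>) - (LINT x|lebesgue. (\<lambda>x::R2. 0) x)"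
  proof (rule Per1_ge_stripe_flux[OF c sq(2,3) k stripes_lebesgue[of k], of "\<lambda>x. 0"])
    show "k * max 0 (sin (k * x $ 2)) * ?\<eta> x - 0 \<le> indicat_real (stripes k) x * (k * sin (k * x $ 2) * ?\<eta> x)" for x
      by (auto simp: indicator_def stripes_def)
  qed auto
  have "k / 4 * (LINT x|lebesgue. ?\<eta> x) \<ge> k / 4 * (1/4)"
    using sq(6) k by (intro mult_left_mono) (auto simp: power2_eq_square)
  moreover have "(LINT x|lebesgue. \<bar>cgrad ?\<eta> x $ 2\<bar>) \<le> 32" using sq(8) by simp
  ultimately have big: "flux (stripes k) \<phi> > \<bar>C\<bar>"
    using \<phi>(2) unfolding k_def by simp
  have fin: "Per1 (stripes k) ?B < \<infinity>" using k by (intro Per1_stripes_finite) auto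
  have ge: "Per1 (stripes k) (?B - ?Q) + ennreal (flux (stripes k) \<phi>) \<le> Per1 (stripes k) ?B"
  proof (rule Per1_ge_disjoint[OF stripes_lebesgue \<phi>(1)])
    show "?P \<subseteq> ?B"
    proof
      fix x :: R2 assume "x \<in> ?P"
      then have "\<bar>x $ 1\<bar> \<le> 1" "\<bar>x $ 2\<bar> \<le> 1" by (auto simp: mem_box_2)
      then show "x \<in> ?B" using norm_le_l1_cart[of x] by (simp add: sum_2)
    qed
    show "?P \<inter> (?B - ?Q) = {}" using box_subset_cbox by auto
  qed (use big in auto)
  have "Per1 (stripes k) (?B - ?Q) \<le> Per1 (stripes k) (?B - ?Q) + ennreal (flux (stripes k) \<phi>)"
    by simp
  also note ge
  finally have "Per1 (stripes k) (?B - ?Q) < \<infinity>" using fin by (rule le_less_trans)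
  \<comment> \<open>Strictness survives adding the common perimeter only because that perimeter was
    just shown to be finite.\<close>
  moreover have "ennreal C < ennreal (flux (stripes k) \<phi>)"
    using big by (intro ennreal_lessI) linarith+
  ultimately have "Per1 (stripes k) (?B - ?Q) + ennreal C < Per1 (stripes k) (?B - ?Q) + ennreal (flux (stripes k) \<phi>)"
    by (simp add: ennreal_add_left_cancel_less)
  then have "Per1 (stripes k - ?Q) ?B < Per1 (stripes k) ?B"
    using C[OF stripes_lebesgue[of k]] ge by (rule_tac le_less_trans[OF _ less_le_trans])
  then show ?thesis using k that by blast
qed

text \<open>The test square has centre (3 * l, 0) and half side \<open>l\<close> in the ball of
  radius \<open>5 * l\<close>. There the modulus of \<open>u\<close> is at least e^(2kl) times that
  of the sine, so adding \<open>w\<close> can change the sign only where \<bar>sin\<bar> is at most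
  e^(-2kl) \<bar>w\<bar>. The stripes contribute k/4 * l^2 to the flux; all losses are linear in
  \<open>l\<close>.\<close>

lemma Per1_competitor_large:
  assumes "k > 0" "M \<ge> 0"
  obtains R :: real where "R > 3"
    "\<And>w. w \<in> borel_measurable lebesgue \<Longrightarrow>
      (\<integral>\<^sup>+ x\<in>ball 0 R. ennreal ((w x)\<^sup>2) \<partial>lebesgue) \<le> ennreal (16 * R\<^sup>2 * (M + 1) + 2) \<Longrightarrow>
      ennreal a < Per1 {x. stripe_fun k x + w x > 0} (ball 0 R)"
proof -
  \<comment> \<open>The losses per unit of \<open>l\<close>: 112 = 7/4 * 64 from the cutoff and
    \<open>250 * (M + 2)\<close> from \<open>h\<close>; the remainder exceeds the target
    \<open>a\<close>. The choice of \<open>l\<close> makes \<open>k / 4 * l\<close> at least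
    \<open>B\<close>.\<close>
  define B where "B = 112 + 250 * (M + 2) + \<bar>a\<bar> + 1"
  define l where "l = 4 / k * B + 1"
  have B: "B > 0" unfolding B_def using assms by simp
  have l: "l \<ge> 1" unfolding l_def using assms B by simp
  show ?thesis
  proof (rule that[of "5 * l"])
    show "5 * l > 3" using l by simp
    fix w :: "R2 \<Rightarrow> real"
    assume wm: "w \<in> borel_measurable lebesgue"
      and wb: "(\<integral>\<^sup>+ x\<in>ball 0 (5 * l). ennreal ((w x)\<^sup>2) \<partial>lebesgue) \<le> ennreal (16 * (5 * l)\<^sup>2 * (M + 1) + 2)"
    let ?B = "ball 0 (5 * l) :: R2 set"
    let ?X = "{x. stripe_fun k x + w x > 0}"
    let ?\<eta> = "square_cutoff (3 * l) l"
    have l0: "l > 0" using l by simp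
    note sq = square_cutoff[OF l0, where L = "3 * l"]
    have sub: "cbox (vector [3 * l - l, - l]) (vector [3 * l + l, l]) \<subseteq> ?B"
    proof
      fix x :: R2 assume "x \<in> cbox (vector [3 * l - l, - l]) (vector [3 * l + l, l])"
      then have c: "2 * l \<le> x $ 1 \<and> x $ 1 \<le> 4 * l \<and> - l \<le> x $ 2 \<and> x $ 2 \<le> l" by (simp add: mem_cbox_2)
      have "(norm x)\<^sup>2 = (x $ 1)\<^sup>2 + (x $ 2)\<^sup>2"
        unfolding power2_norm_eq_inner by (simp add: inner_vec_def sum_2 power2_eq_square)
      also have "\<dots> \<le> (4 * l)\<^sup>2 + l\<^sup>2"
        using c l0 by (intro add_mono power2_le_iff_abs_le[THEN iffD2]) auto
      also have "\<dots> < (5 * l)\<^sup>2" using l0 by (simp add: power2_eq_square)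
      finally have "norm x < 5 * l" by (rule power2_less_imp_less) (use l0 in auto)
      then show "x \<in> ?B" by simp
    qed
    have c: "C1c ?B ?\<eta>" using sub by (rule sq(1))
    have Xm: "?X \<in> sets lebesgue"
    proof -
      have "stripe_fun k \<in> borel_measurable lebesgue"
        by (intro lebesgue_measurable_continuous has_C1_grad_continuous[OF has_C1_grad_stripe_fun])
      then have "(\<lambda>x. stripe_fun k x + w x) \<in> borel_measurable lebesgue" using wm by (rule borel_measurable_add)
      from borel_measurable_less[OF borel_measurable_const this, of 0] show ?thesis by simp
    qed
    define H where "H x = indicat_real ?B x * (w x)\<^sup>2" for x
    have nH: "(\<integral>\<^sup>+ x. ennreal (H x) \<partial>lebesgue) \<le> ennreal (16 * (5 * l)\<^sup>2 * (M + 1) + 2)"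
    proof -
      have "(\<integral>\<^sup>+ x. ennreal (H x) \<partial>lebesgue) = (\<integral>\<^sup>+ x\<in>?B. ennreal ((w x)\<^sup>2) \<partial>lebesgue)"
        by (intro nn_integral_cong) (auto simp: H_def indicator_def)
      then show ?thesis using wb by simp
    qed
    have H0: "0 \<le> H x" for x by (simp add: H_def)
    have iH: "integrable lebesgue H"
    proof (rule integrableI_bounded)
      show "H \<in> borel_measurable lebesgue"
        unfolding H_def[abs_def] using wm by (intro borel_measurable_times borel_measurable_indicator borel_measurable_power) auto
      show "(\<integral>\<^sup>+ x. ennreal (norm (H x)) \<partial>lebesgue) < \<infinity>" using nH H0 by (simp add: order_le_less_trans)
    qed
    have IH: "(LINT x|lebesgue. H x) \<le> 16 * (5 * l)\<^sup>2 * (M + 1) + 2"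
    proof (rule ennreal_le_iff[THEN iffD1])
      show "ennreal (LINT x|lebesgue. H x) \<le> ennreal (16 * (5 * l)\<^sup>2 * (M + 1) + 2)"
        using nH nn_integral_eq_integral[OF iH] H0 by simp
    qed (use assms in \<open>simp add: add_nonneg_nonneg\<close>)
    \<comment> \<open>Exponential decay is used only as \<open>e * (2 * k * l) \<le> 1\<close>: it
      removes one power of \<open>l\<close> from the quadratic bound on \<open>w\<close>, which is
      all that is needed against \<open>l\<^sup>2\<close>.\<close>
    define e where "e = exp (- (2 * k * l))"
    have e: "0 < e" "e * (2 * k * l) \<le> 1"
    proof -
      show "0 < e" unfolding e_def by simp
      have "2 * k * l \<le> exp (2 * k * l)" using exp_ge_add_one_self[of "2 * k * l"] by linarith
      then have "e * (2 * k * l) \<le> e * exp (2 * k * l)" by (intro mult_left_mono) (auto simp: e_def)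
      then show "e * (2 * k * l) \<le> 1" unfolding e_def by (simp add: exp_minus)
    qed
    \<comment> \<open>The pointwise error is \<open>k * e * \<eta> * \<bar>w\<bar>\<close>; the
      estimate \<bar>w\<bar> \<le> 1 + w^2 trades it for terms controlled by the area and the L2
      bound.\<close>
    define h where "h x = k * e * (?\<eta> x + H x)" for x
    have i\<eta>: "integrable lebesgue ?\<eta>" using C1c_stripe_sin_integral(3)[OF c sq(2) \<open>k > 0\<close>] .
    have ih: "integrable lebesgue h" unfolding h_def[abs_def] using i\<eta> iH by simp
    have "(LINT x|lebesgue. h x) = k * e * ((LINT x|lebesgue. ?\<eta> x) + (LINT x|lebesgue. H x))"
      unfolding h_def using i\<eta> iH by simp
    also have "\<dots> \<le> k * e * (4 * l\<^sup>2 + (16 * (5 * l)\<^sup>2 * (M + 1) + 2))"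
      using \<open>k > 0\<close> e by (intro mult_left_mono add_mono sq(7) IH) auto
    also have "\<dots> \<le> k * e * (500 * l\<^sup>2 * (M + 2))"
    proof -
      have "l\<^sup>2 \<ge> 1" using l by simp
      moreover have "0 \<le> M * l\<^sup>2" using assms by simp
      ultimately have "4 * l\<^sup>2 + (16 * (5 * l)\<^sup>2 * (M + 1) + 2) \<le> 500 * l\<^sup>2 * (M + 2)"
        by (simp add: power_mult_distrib algebra_simps)
      then show ?thesis using \<open>k > 0\<close> e by (intro mult_left_mono) auto
    qed
    also have "\<dots> = (e * (2 * k * l)) * (250 * l * (M + 2))" by (simp add: power2_eq_square algebra_simps)
    also have "\<dots> \<le> 1 * (250 * l * (M + 2))" using e l0 assms by (intro mult_right_mono) auto
    finally have Ih: "(LINT x|lebesgue. h x) \<le> 250 * l * (M + 2)" by simp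
    obtain \<phi> where \<phi>: "\<phi> \<in> unit_fields ?B"
      "flux ?X \<phi> \<ge> k / 4 * (LINT x|lebesgue. ?\<eta> x)
         - 7 / 4 * (LINT x|lebesgue. \<bar>cgrad ?\<eta> x $ 2\<bar>) - (LINT x|lebesgue. h x)"
    proof (rule Per1_ge_stripe_flux[OF c sq(2,3) \<open>k > 0\<close> Xm ih])
      fix x :: R2
      define s where "s = sin (k * x $ 2)"
      show "k * max 0 s * ?\<eta> x - h x \<le> indicat_real ?X x * (k * s * ?\<eta> x)"
      proof (cases "x \<in> cbox (vector [3 * l - l, - l]) (vector [3 * l + l, l])")
        case True
        then have xB: "x \<in> ?B" using sub by blast
        have x1: "x $ 1 \<ge> 2 * l" using True by (simp add: mem_cbox_2)
        have "\<bar>w x\<bar> \<le> 1 + (w x)\<^sup>2"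
          using zero_le_power2[of "\<bar>w x\<bar> - 1"] by (simp add: power2_eq_square algebra_simps)
        then have h1: "k * e * (?\<eta> x * \<bar>w x\<bar>) \<le> h x"
        proof -
          have "?\<eta> x * \<bar>w x\<bar> \<le> ?\<eta> x * 1 + 1 * (w x)\<^sup>2"
            using sq(2,3)[of x] mult_left_mono[OF \<open>\<bar>w x\<bar> \<le> 1 + (w x)\<^sup>2\<close> sq(2)[of x]]
              mult_right_mono[OF sq(3)[of x], of "(w x)\<^sup>2"] by (simp add: algebra_simps)
          then show ?thesis unfolding h_def H_def using xB \<open>k > 0\<close> e by (simp add: mult_left_mono)
        qed
        have ex: "exp (- (k * x $ 1)) \<le> e"
          unfolding e_def using mult_left_mono[OF x1, of k] \<open>k > 0\<close> by simp
        \<comment> \<open>Unless \<bar>u\<bar> \<le> \<bar>w\<bar>, the sum has the sign of the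
          sine; in the exceptional case the sine itself is at most \<open>e * \<bar>w\<bar>\<close>
          in modulus.\<close>
        have sm: "max 0 s - e * \<bar>w x\<bar> \<le> indicat_real ?X x * s"
        proof -
          have "\<bar>s\<bar> \<le> e * \<bar>w x\<bar>" if "\<bar>stripe_fun k x\<bar> \<le> \<bar>w x\<bar>"
          proof -
            have "\<bar>s\<bar> = exp (- (k * x $ 1)) * \<bar>stripe_fun k x\<bar>"
              by (simp add: stripe_fun_def s_def abs_mult exp_minus)
            also have "\<dots> \<le> e * \<bar>w x\<bar>" using ex that e by (intro mult_mono) auto
            finally show ?thesis .
          qed
          moreover have "0 \<le> e * \<bar>w x\<bar>" using e by simp
          moreover have "stripe_fun k x > 0 \<longleftrightarrow> s > 0" "stripe_fun k x < 0 \<longleftrightarrow> s < 0"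
            by (auto simp: stripe_fun_def s_def zero_less_mult_iff mult_less_0_iff)
          ultimately show ?thesis
            by (cases "x \<in> ?X"; cases "s > 0"; cases "\<bar>stripe_fun k x\<bar> \<le> \<bar>w x\<bar>") auto
        qed
        have "k * ?\<eta> x * (max 0 s - e * \<bar>w x\<bar>) \<le> k * ?\<eta> x * (indicat_real ?X x * s)"
          using sm sq(2)[of x] \<open>k > 0\<close> by (intro mult_left_mono) auto
        then show ?thesis using h1 by (simp add: algebra_simps)
      next
        case False
        then have "?\<eta> x = 0" by (rule sq(4))
        then show ?thesis using H0[of x] \<open>k > 0\<close> e by (simp add: h_def)
      qed
    qed
    have "k / 4 * (LINT x|lebesgue. ?\<eta> x) \<ge> k / 4 * l\<^sup>2"
      using sq(6) \<open>k > 0\<close> by (intro mult_left_mono) auto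
    moreover have "7 / 4 * (LINT x|lebesgue. \<bar>cgrad ?\<eta> x $ 2\<bar>) \<le> 7 / 4 * (64 * l)"
      by (intro mult_left_mono sq(8)) simp
    ultimately have low: "k / 4 * l\<^sup>2 - 112 * l - 250 * l * (M + 2) \<le> flux ?X \<phi>"
      using \<phi>(2) Ih by linarith
    have "k / 4 * l \<ge> B" unfolding l_def using \<open>k > 0\<close> by (simp add: field_simps)
    then have "l * (k / 4 * l) \<ge> l * B" using l0 by (intro mult_left_mono) auto
    moreover have "l * (\<bar>a\<bar> + 1) \<ge> 1 * (\<bar>a\<bar> + 1)" using l by (intro mult_right_mono) auto
    ultimately have "\<bar>a\<bar> + 1 \<le> k / 4 * l\<^sup>2 - 112 * l - 250 * l * (M + 2)"
      unfolding B_def by (simp add: power2_eq_square algebra_simps)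
    then have big: "\<bar>a\<bar> < flux ?X \<phi>" using low by linarith
    then have "ennreal a < ennreal (flux ?X \<phi>)"
      by (intro ennreal_lessI) linarith+
    also have "\<dots> \<le> Per1 ?X ?B" unfolding Per1_eq by (rule SUP_upper[OF \<phi>(1)])
    finally show "ennreal a < Per1 ?X ?B" .
  qed
qed

section \<open>Fractional perimeter\<close>

definition kern :: "real \<Rightarrow> R2 \<Rightarrow> R2 \<Rightarrow> ennreal" where
  "kern \<sigma> x y = ennreal (dist x y powr (- (2 + \<sigma>)))"

text \<open>Passes from Lebesgue to Borel measure, where Tonelli is available for Borel
  sets.\<close>

lemma Sint_eq:
  "Sint \<sigma> E F = ennreal (\<sigma> * (1 - \<sigma>)) *
    (\<integral>\<^sup>+ x. \<integral>\<^sup>+ y. indicator E x * indicator F y * kern \<sigma> x y \<partial>lborel \<partial>lborel)"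
  unfolding Sint_def kern_def nn_integral_completion ..

lemma kern_measurable [measurable]:
  "(\<lambda>z. kern \<sigma> (fst z) (snd z)) \<in> borel_measurable (lborel \<Otimes>\<^sub>M lborel)"
  unfolding kern_def by measurable

lemma Sint_integrand_measurable:
  assumes [measurable]: "E \<in> sets borel" "F \<in> sets borel"
  shows "(\<lambda>(x, y). indicator E x * indicator F y * kern \<sigma> x y) \<in> borel_measurable (lborel \<Otimes>\<^sub>M lborel)"
proof -
  have "(\<lambda>z. indicator E (fst z) * indicator F (snd z) * kern \<sigma> (fst z) (snd z)) \<in> borel_measurable (lborel \<Otimes>\<^sub>M lborel)"
    by measurable
  then show ?thesis by (simp add: case_prod_beta')
qed

lemma Sint_inner_measurable:
  assumes "E \<in> sets borel" "F \<in> sets borel"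
  shows "(\<lambda>x. \<integral>\<^sup>+ y. indicator E x * indicator F y * kern \<sigma> x y \<partial>lborel) \<in> borel_measurable lborel"
  using lborel.borel_measurable_nn_integral[OF Sint_integrand_measurable[OF assms, of \<sigma>]] by simp

lemma kern_commute: "kern \<sigma> x y = kern \<sigma> y x"
  by (simp add: kern_def dist_commute)

lemma Sint_commute:
  assumes "E \<in> sets borel" "F \<in> sets borel"
  shows "Sint \<sigma> E F = Sint \<sigma> F E"
proof -
  have "(\<integral>\<^sup>+ x. \<integral>\<^sup>+ y. indicator E x * indicator F y * kern \<sigma> x y \<partial>lborel \<partial>lborel)
    = (\<integral>\<^sup>+ y. \<integral>\<^sup>+ x. indicator E x * indicator F y * kern \<sigma> x y \<partial>lborel \<partial>lborel)"
    by (rule lborel_pair.Fubini'[symmetric, OF Sint_integrand_measurable[OF assms, of \<sigma>]])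
  then show ?thesis unfolding Sint_eq by (simp add: kern_commute mult_ac)
qed

lemma Sint_mono: "E \<subseteq> E' \<Longrightarrow> F \<subseteq> F' \<Longrightarrow> Sint \<sigma> E F \<le> Sint \<sigma> E' F'"
  unfolding Sint_eq by (intro mult_left_mono nn_integral_mono mult_right_mono mult_mono) (auto simp: indicator_def)

lemma Sint_Un_left:
  assumes "E \<in> sets borel" "E' \<in> sets borel" "F \<in> sets borel" "E \<inter> E' = {}"
  shows "Sint \<sigma> (E \<union> E') F = Sint \<sigma> E F + Sint \<sigma> E' F"
proof -
  have "(\<integral>\<^sup>+ x. \<integral>\<^sup>+ y. indicator (E \<union> E') x * indicator F y * kern \<sigma> x y \<partial>lborel \<partial>lborel)
    = (\<integral>\<^sup>+ x. (\<integral>\<^sup>+ y. indicator E x * indicator F y * kern \<sigma> x y \<partial>lborel) +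
        (\<integral>\<^sup>+ y. indicator E' x * indicator F y * kern \<sigma> x y \<partial>lborel) \<partial>lborel)"
    using assms(4) by (intro nn_integral_cong) (auto simp: indicator_def)
  also have "\<dots> = (\<integral>\<^sup>+ x. \<integral>\<^sup>+ y. indicator E x * indicator F y * kern \<sigma> x y \<partial>lborel \<partial>lborel) +
      (\<integral>\<^sup>+ x. \<integral>\<^sup>+ y. indicator E' x * indicator F y * kern \<sigma> x y \<partial>lborel \<partial>lborel)"
    by (rule nn_integral_add[OF Sint_inner_measurable Sint_inner_measurable]) (use assms in auto)
  finally show ?thesis unfolding Sint_eq by (simp add: distrib_left)
qed

lemma Sint_Un_right:
  assumes "E \<in> sets borel" "F \<in> sets borel" "F' \<in> sets borel" "F \<inter> F' = {}"
  shows "Sint \<sigma> E (F \<union> F') = Sint \<sigma> E F + Sint \<sigma> E F'"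
  using assms Sint_Un_left[of F F' E \<sigma>] Sint_commute[of E] by simp

section \<open>Finiteness of interactions by dyadic decomposition\<close>

lemma dyadic_scale:
  fixes t :: real
  assumes "1 \<le> t"
  obtains j :: nat where "2 powr real j \<le> t" "t < 2 powr (real j + 1)"
proof -
  define n where "n = nat \<lfloor>log 2 t\<rfloor>"
  have "log 2 t \<ge> 0" using assms by simp
  then have n: "real n \<le> log 2 t" "log 2 t < real n + 1" unfolding n_def by linarith+
  have t: "2 powr (log 2 t) = t" using assms by simp
  show ?thesis
  proof (rule that[of n])
    show "2 powr real n \<le> t" using n(1) t powr_mono[of "real n" "log 2 t" 2] by simp
    show "t < 2 powr (real n + 1)" using n(2) t powr_less_mono[of "log 2 t" "real n + 1" 2] by simp
  qed
qed

definition slab :: "real \<Rightarrow> 2 \<Rightarrow> real \<Rightarrow> real \<Rightarrow> R2 set" where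
  "slab R i c t = cbox (\<chi> j. - R) (\<chi> j. R) \<inter> {x. \<bar>x $ i - c\<bar> \<le> t}"

lemma slab_borel: "slab R i c t \<in> sets borel"
  unfolding slab_def by (intro borel_closed closed_Int closed_cbox closed_Collect_le continuous_intros)

lemma emeasure_slab:
  assumes "t \<ge> 0" "R \<ge> 0"
  shows "emeasure lborel (slab R i c t) \<le> ennreal (4 * R * t)"
proof -
  let ?a = "(\<chi> j. if j = i then c - t else - R) :: R2" and ?b = "(\<chi> j. if j = i then c + t else R) :: R2"
  have "emeasure lborel (slab R i c t) \<le> emeasure lborel (cbox ?a ?b)"
    by (rule emeasure_mono) (auto simp: slab_def mem_box_cart abs_le_iff)
  also have "\<dots> = ennreal (measure lborel (cbox ?a ?b))"
    using emeasure_lborel_cbox_finite[of ?a ?b] by (simp add: emeasure_eq_ennreal_measure less_top)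
  also have "measure lborel (cbox ?a ?b) = 4 * R * t"
  proof -
    have "?a \<in> cbox ?a ?b" using assms by (auto simp: mem_box_cart)
    then have "cbox ?a ?b \<noteq> {}" by blast
    then show ?thesis using exhaust_2[of i] by (auto simp: content_cbox_cart UNIV_2)
  qed
  finally show ?thesis .
qed

lemma suminf_ennreal_geometric:
  assumes "0 \<le> c" "0 \<le> q" "q < 1"
  shows "(\<Sum>j. ennreal (c * q ^ j)) < \<infinity>"
proof -
  have "summable (\<lambda>j. c * q ^ j)" using assms by (intro summable_mult summable_geometric) auto
  then show ?thesis using assms by (subst suminf_ennreal2) auto
qed

lemma nn_integral_two_indicator_series:
  fixes c d :: "nat \<Rightarrow> ennreal"
  assumes [measurable]: "\<And>j. A j \<in> sets M" "\<And>j. B j \<in> sets M"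
  shows "(\<integral>\<^sup>+ x. (\<Sum>j. c j * indicator (A j) x) + (\<Sum>j. d j * indicator (B j) x) \<partial>M)
     = (\<Sum>j. c j * emeasure M (A j)) + (\<Sum>j. d j * emeasure M (B j))"
proof -
  have 1: "(\<lambda>x. c j * indicator (A j) x) \<in> borel_measurable M"
    "(\<lambda>x. d j * indicator (B j) x) \<in> borel_measurable M" for j
    using assms by (auto intro!: borel_measurable_times_ennreal borel_measurable_indicator)
  then have "(\<lambda>x. \<Sum>j. c j * indicator (A j) x) \<in> borel_measurable M"
    "(\<lambda>x. \<Sum>j. d j * indicator (B j) x) \<in> borel_measurable M"
    by (auto intro: borel_measurable_suminf_order)
  then show ?thesis using 1 assms
    by (simp add: nn_integral_add nn_integral_suminf nn_integral_cmult_indicator)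
qed

text \<open>If close pairs are separated by finitely many lines, then only a strip of width of order
  2^-j of \<open>X\<close> takes part at distance 2^-j. Kernel, ball and strip give
  2^((2+\<sigma>)j) * 2^(-2j) * 2^(-j) = 2^((\<sigma>-1)j), summable as \<sigma> < 1; distances of
  order 2^j give 2^(-(2+\<sigma>)j) * 2^(2j) = 2^(-\<sigma> j), summable as \<sigma> > 0.\<close>

lemma Sint_finite:
  assumes \<sigma>: "0 < \<sigma>" "\<sigma> < 1" and X: "X \<in> sets borel" and Y: "Y \<in> sets borel"
    and XR: "X \<subseteq> cbox (\<chi> i. - R) (\<chi> i. R)" "R \<ge> 0" and L: "finite L"
    and sep: "\<And>x y. x \<in> X \<Longrightarrow> y \<in> Y \<Longrightarrow> dist x y \<le> 1 \<Longrightarrow> \<exists>(i, c)\<in>L. \<bar>x $ i - c\<bar> \<le> dist x y"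
  shows "Sint \<sigma> X Y < \<infinity>"
proof -
  let ?p = "2 + \<sigma>"
  let ?N = "\<lambda>j::nat. \<Union>(i, c)\<in>L. slab R i c (2 powr (- real j))"
  define V where "V = unit_ball_vol (real (DIM(R2)))"
  have V0: "V \<ge> 0" unfolding V_def by simp
  have ballV: "emeasure lborel (cball x r) = ennreal (V * r\<^sup>2)" if "r \<ge> 0" for x :: R2 and r
    using emeasure_cball[OF that, of x] unfolding V_def by simp
  have Nmeas: "?N j \<in> sets borel" for j
    using L by (intro sets.finite_UN) (auto intro!: slab_borel)
  have N: "emeasure lborel (?N j) \<le> ennreal (real (card L) * (4 * R) * 2 powr (- real j))" for j
  proof -
    have "emeasure lborel (?N j) \<le> (\<Sum>(i, c)\<in>L. emeasure lborel (slab R i c (2 powr (- real j))))"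
      using L unfolding case_prod_beta' by (intro emeasure_subadditive_finite) (auto simp: slab_borel)
    also have "\<dots> \<le> (\<Sum>(i, c)\<in>L. ennreal (4 * R * 2 powr (- real j)))"
      using XR(2) by (intro sum_mono) (auto intro!: emeasure_slab)
    also have "\<dots> = ennreal (real (card L) * (4 * R) * 2 powr (- real j))"
      using XR(2) by (simp add: case_prod_beta' ennreal_of_nat_eq_real_of_nat ennreal_mult'' mult.assoc)
    finally show ?thesis .
  qed
  have pp: "(2 powr q) ^ n = 2 powr (q * real n)" for q :: real and n :: nat
    by (simp add: powr_powr flip: powr_realpow)
  have ts: "f j \<le> (\<Sum>j. f j)" for f :: "nat \<Rightarrow> ennreal" and j
    using sum_le_suminf[of f "{j}"] by simp
  define a where "a j = 2 powr (?p * (real j + 1))" for j :: nat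
  define b where "b j = 2 powr (- ?p * real j)" for j :: nat
  let ?f = "\<lambda>x y j. ennreal (a j) * indicator (?N j) x * indicator (cball x (2 powr (- real j))) y"
  let ?g = "\<lambda>x y j. ennreal (b j) * indicator X x * indicator (cball x (2 powr (real j + 1))) y"
  let ?v = "\<lambda>j. V * (2 powr (- real j))\<^sup>2" and ?w = "\<lambda>j. V * (2 powr (real j + 1))\<^sup>2"
  \<comment> \<open>Split the kernel dyadically in the distance; \<open>X\<close> meets the scale \<open>2\<^bsup>-j\<^esup>\<close> only close to a separating line.\<close>
  have ptw: "indicator X x * indicator Y y * kern \<sigma> x y \<le>
     (\<Sum>j. ?f x y j) +
     (\<Sum>j. ?g x y j)" for x y
  proof (cases "x \<in> X \<and> y \<in> Y \<and> x \<noteq> y")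
    case False
    then have "indicator X x * indicator Y y * kern \<sigma> x y = 0" by (auto simp: indicator_def kern_def)
    then show ?thesis by (simp only: zero_le)
  next
    case True
    define d where "d = dist x y"
    have d: "d > 0" using True by (simp add: d_def)
    have le: "indicator X x * indicator Y y * kern \<sigma> x y = ennreal (d powr (- ?p))"
      using True by (simp add: kern_def d_def)
    show ?thesis
    proof (cases "d \<le> 1")
      case d1: True
      then have "1 \<le> 1 / d" using d by simp
      then obtain j where j: "2 powr real j \<le> 1 / d" "1 / d < 2 powr (real j + 1)"
        using dyadic_scale by blast
      have dj: "d \<le> 2 powr (- real j)" using j(1) d by (simp add: powr_minus field_simps)
      have dj': "2 powr (- (real j + 1)) \<le> d" using j(2) d unfolding powr_minus by (simp add: field_simps)
      obtain i c where ic: "(i, c) \<in> L" "\<bar>x $ i - c\<bar> \<le> d"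
        using sep[of x y] True d1 unfolding d_def by blast
      have "x \<in> ?N j"
        using ic dj True XR(1) by (auto simp: slab_def intro!: bexI[of _ "(i, c)"])
      then have "ennreal (d powr (- ?p)) \<le> ?f x y j"
      proof -
        have "d powr (- ?p) \<le> (2 powr (- (real j + 1))) powr (- ?p)"
          using dj' \<sigma> by (intro powr_mono2') auto
        also have "\<dots> = a j" by (simp add: a_def powr_powr algebra_simps)
        finally show ?thesis using \<open>x \<in> ?N j\<close> dj by (simp add: d_def ennreal_leI)
      qed
      also have "\<dots> \<le> (\<Sum>j. ?f x y j)"
        by (rule ts[of "?f x y"])
      finally show ?thesis unfolding le by (rule order_trans) simp
    next
      case d1: False
      then obtain j where j: "2 powr real j \<le> d" "d < 2 powr (real j + 1)"
        using dyadic_scale[of d] by auto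
      have "ennreal (d powr (- ?p)) \<le> ?g x y j"
      proof -
        have "d powr (- ?p) \<le> (2 powr (real j)) powr (- ?p)"
          using j(1) \<sigma> by (intro powr_mono2') auto
        also have "\<dots> = b j" by (simp add: b_def powr_powr algebra_simps)
        finally show ?thesis using True j(2) by (simp add: d_def ennreal_leI)
      qed
      also have "\<dots> \<le> (\<Sum>j. ?g x y j)"
        by (rule ts[of "?g x y"])
      finally show ?thesis unfolding le by (rule order_trans) simp
    qed
  qed
  \<comment> \<open>Integrating in \<open>y\<close> replaces each ball by its area and leaves two
    series of indicators in \<open>x\<close>, to be integrated by the same lemma again.\<close>
  have inner: "(\<integral>\<^sup>+ y. indicator X x * indicator Y y * kern \<sigma> x y \<partial>lborel) \<le>
     (\<Sum>j. ennreal (a j * ?v j) * indicator (?N j) x) +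
     (\<Sum>j. ennreal (b j * ?w j) * indicator X x)" for x
  proof -
    have "(\<integral>\<^sup>+ y. indicator X x * indicator Y y * kern \<sigma> x y \<partial>lborel) \<le>
      (\<integral>\<^sup>+ y. (\<Sum>j. ?f x y j) +
     (\<Sum>j. ?g x y j) \<partial>lborel)"
      by (intro nn_integral_mono ptw)
    also have "\<dots> = (\<Sum>j. ennreal (a j) * indicator (?N j) x * ennreal (?v j)) +
      (\<Sum>j. ennreal (b j) * indicator X x * ennreal (?w j))"
      by (subst nn_integral_two_indicator_series) (simp_all add: ballV)
    finally show ?thesis using V0 by (simp add: ennreal_mult mult_ac a_def b_def)
  qed
  have "(\<integral>\<^sup>+ x. \<integral>\<^sup>+ y. indicator X x * indicator Y y * kern \<sigma> x y \<partial>lborel \<partial>lborel) \<le>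
     (\<integral>\<^sup>+ x. (\<Sum>j. ennreal (a j * ?v j) * indicator (?N j) x) +
     (\<Sum>j. ennreal (b j * ?w j) * indicator X x) \<partial>lborel)"
    by (intro nn_integral_mono inner)
  also have "\<dots> = (\<Sum>j. ennreal (a j * ?v j) * emeasure lborel (?N j)) +
     (\<Sum>j. ennreal (b j * ?w j) * emeasure lborel X)"
    using Nmeas X by (subst nn_integral_two_indicator_series) simp_all
  also have "\<dots> < \<infinity>"
  proof -
    let ?K = "real (card L) * (4 * R)"
    have "(\<Sum>j. ennreal (a j * ?v j) * emeasure lborel (?N j)) \<le>
       (\<Sum>j. ennreal ((2 powr ?p * V * ?K) * (2 powr (\<sigma> - 1)) ^ j))"
    proof (rule suminf_le)
      fix j
      have "ennreal (a j * ?v j) * emeasure lborel (?N j) \<le>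
         ennreal (a j * ?v j) * ennreal (?K * 2 powr (- real j))"
        by (intro mult_left_mono N) simp
      also have "\<dots> = ennreal ((2 powr ?p * V * ?K) * (2 powr (\<sigma> - 1)) ^ j)"
      proof -
        have e: "a j * (2 powr (- real j))\<^sup>2 * 2 powr (- real j) = 2 powr ?p * (2 powr (\<sigma> - 1)) ^ j"
          unfolding a_def power2_eq_square pp by (simp only: powr_add[symmetric]) (simp add: algebra_simps)
        have "(a j * ?v j) * (?K * 2 powr (- real j)) = (a j * (2 powr (- real j))\<^sup>2 * 2 powr (- real j)) * (V * ?K)"
          by (simp add: algebra_simps)
        also have "\<dots> = (2 powr ?p * V * ?K) * (2 powr (\<sigma> - 1)) ^ j" unfolding e by (simp add: algebra_simps)
        finally show ?thesis using V0 XR(2) by (simp add: ennreal_mult[symmetric] a_def)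
      qed
      finally show "ennreal (a j * ?v j) * emeasure lborel (?N j) \<le> ennreal ((2 powr ?p * V * ?K) * (2 powr (\<sigma> - 1)) ^ j)" .
    qed auto
    also have "\<dots> < \<infinity>"
    proof (rule suminf_ennreal_geometric)
      show "2 powr (\<sigma> - 1) < (1::real)" using \<sigma> powr_less_mono[of "\<sigma> - 1" 0 2] by simp
    qed (use V0 XR(2) in auto)
    finally have f1: "(\<Sum>j. ennreal (a j * ?v j) * emeasure lborel (?N j)) < \<infinity>" .
    have beq: "b j * ?w j = ((4 * V) * (2 powr (- \<sigma>)) ^ j)" for j
    proof -
      have "b j * (2 powr (real j + 1))\<^sup>2 = 2 powr 2 * (2 powr (- \<sigma>)) ^ j"
        unfolding b_def power2_eq_square pp by (simp only: powr_add[symmetric]) (simp add: algebra_simps)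
      then show ?thesis by (simp add: algebra_simps)
    qed
    have "2 powr (- \<sigma>) < (1::real)" using \<sigma> powr_less_mono[of "- \<sigma>" 0 2] by simp
    then have "(\<Sum>j. ennreal (b j * ?w j)) < \<infinity>"
      unfolding beq using V0 by (intro suminf_ennreal_geometric) auto
    moreover have "emeasure lborel X < \<infinity>"
    proof -
      have "emeasure lborel X \<le> emeasure lborel (cbox (\<chi> i. - R) (\<chi> i. R) :: R2 set)"
        by (rule emeasure_mono[OF XR(1)]) simp
      then show ?thesis using emeasure_lborel_cbox_finite by (rule le_less_trans)
    qed
    ultimately have "(\<Sum>j. ennreal (b j * ?w j) * emeasure lborel X) < \<infinity>"
      by (simp add: ennreal_mult_less_top)
    with f1 show ?thesis by simp
  qed
  finally show ?thesis unfolding Sint_eq by (simp add: ennreal_mult_less_top)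
qed

lemma emeasure_box_2:
  assumes "p $ 1 \<le> q $ 1" "p $ 2 \<le> (q::R2) $ 2"
  shows "emeasure lborel (box p q) = ennreal ((q $ 1 - p $ 1) * (q $ 2 - p $ 2))"
proof -
  have "p \<in> cbox p q" using assms by (simp add: mem_cbox_2)
  then have ne: "cbox p q \<noteq> {}" by blast
  have "measure lborel (box p q) = measure lborel (cbox p q)"
    by (simp add: measure_lborel_box_eq measure_lborel_cbox_eq)
  also have "\<dots> = (q $ 1 - p $ 1) * (q $ 2 - p $ 2)"
    using content_cbox_cart[OF ne] by (simp add: UNIV_2)
  finally show ?thesis
    using emeasure_lborel_box_finite[of p q] by (simp add: emeasure_eq_ennreal_measure less_top)
qed

lemma sin_zero_between:
  assumes "sin (k * a) > 0 \<and> sin (k * b) \<le> 0 \<or> sin (k * a) \<le> 0 \<and> sin (k * b) > 0"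
  obtains c :: real where "sin (k * c) = 0" "\<bar>a - c\<bar> \<le> \<bar>a - b\<bar>"
proof -
  let ?I = "(\<lambda>t. sin (k * t)) ` closed_segment a b"
  have "connected ?I" by (intro connected_continuous_image continuous_intros) auto
  moreover have "sin (k * a) \<in> ?I" "sin (k * b) \<in> ?I" by auto
  ultimately have "0 \<in> ?I" using assms connectedD_interval[of ?I] by (metis less_imp_le)
  then obtain c where c: "c \<in> closed_segment a b" "sin (k * c) = 0" by auto
  then have "\<bar>a - c\<bar> \<le> \<bar>a - b\<bar>"
    using dist_in_closed_segment[of c a b] by (simp add: dist_real_def abs_minus_commute)
  then show ?thesis using c that by blast
qed

text \<open>The sine changes sign between the second coordinates of \<open>x\<close> and
  \<open>y\<close>, so a zero lies between them and serves as the separating line.\<close>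

lemma Sint_stripes_finite:
  assumes "0 < \<sigma>" "\<sigma> < 1" "k > 0" "R > 0" "X \<in> sets borel" "Y \<in> sets borel" "X \<subseteq> ball 0 R"
    and opp: "\<And>x y. x \<in> X \<Longrightarrow> y \<in> Y \<Longrightarrow> x \<in> stripes k \<longleftrightarrow> y \<notin> stripes k"
  shows "Sint \<sigma> X Y < \<infinity>"
proof -
  \<comment> \<open>A separating zero lies within distance 1 of a point of the ball, hence
    \<open>R + 1\<close> and finitely many multiples of pi / k.\<close>
  define N where "N = \<lceil>(R + 1) * k / pi\<rceil>"
  have comp: "\<bar>x $ i\<bar> < R" if "x \<in> X" for x i
    using that assms(7) component_le_norm_cart[of x i] by fastforce
  show ?thesis
  proof (rule Sint_finite[where R = R and L = "(\<lambda>m::int. (2, of_int m * pi / k)) ` {- N..N}"])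
    show "X \<subseteq> cbox (\<chi> i. - R) (\<chi> i. R)"
    proof
      fix x assume "x \<in> X"
      then have "- R \<le> x $ i \<and> x $ i \<le> R" for i using comp[of x i] by linarith
      then show "x \<in> cbox (\<chi> i. - R) (\<chi> i. R)" by (simp add: mem_box_cart)
    qed
    fix x y assume xy: "x \<in> X" "y \<in> Y" "dist x y \<le> 1"
    have "sin (k * x $ 2) > 0 \<and> sin (k * y $ 2) \<le> 0 \<or> sin (k * x $ 2) \<le> 0 \<and> sin (k * y $ 2) > 0"
      using opp[OF xy(1,2)] by (auto simp: stripes_def)
    then obtain c where c: "sin (k * c) = 0" "\<bar>x $ 2 - c\<bar> \<le> \<bar>x $ 2 - y $ 2\<bar>"
      by (rule sin_zero_between)
    have "\<bar>x $ 2 - y $ 2\<bar> \<le> dist x y" using component_le_norm_cart[of "x - y" 2] by (simp add: dist_norm)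
    then have d: "\<bar>x $ 2 - c\<bar> \<le> dist x y" using c(2) by linarith
    obtain m :: int where m: "k * c = of_int m * pi" using c(1) sin_zero_iff_int2 by auto
    then have cm: "c = of_int m * pi / k" using assms(3) by (simp add: field_simps)
    have "\<bar>c\<bar> \<le> R + 1" using d xy(3) comp[OF xy(1), of 2] by linarith
    then have "\<bar>k * c\<bar> \<le> k * (R + 1)" using assms(3) by (simp add: abs_mult)
    then have "\<bar>of_int m\<bar> * pi \<le> k * (R + 1)" unfolding m by (simp add: abs_mult)
    then have "\<bar>of_int m\<bar> \<le> (R + 1) * k / pi" by (simp add: field_simps)
    then have "\<bar>m\<bar> \<le> N" unfolding N_def by linarith
    then have "(2, c) \<in> (\<lambda>m::int. (2::2, of_int m * pi / k)) ` {- N..N}"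
      unfolding cm by (intro imageI) auto
    then show "\<exists>(i, c)\<in>(\<lambda>m::int. (2, of_int m * pi / k)) ` {- N..N}. \<bar>x $ i - c\<bar> \<le> dist x y"
      using d by (intro bexI[of _ "(2, c)"]) auto
  qed (use assms in auto)
qed

lemma Per_frac_stripes_finite:
  assumes "0 < \<sigma>" "\<sigma> < 1" "k > 0" "R > 0"
  shows "Per_frac \<sigma> (stripes k) (ball 0 R) < \<infinity>"
proof -
  let ?E = "stripes k" and ?B = "ball 0 R :: R2 set"
  have m: "?E \<in> sets borel" "?E \<inter> ?B \<in> sets borel" "- ?E \<in> sets borel" "- ?E \<inter> ?B \<in> sets borel"
    using stripes_borel[of k] by (auto simp: Compl_in_sets_lebesgue intro: borel_comp)
  have "Sint \<sigma> ?E (- ?E \<inter> ?B) = Sint \<sigma> (- ?E \<inter> ?B) ?E" using m by (intro Sint_commute)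
  also have "\<dots> < \<infinity>" using assms m by (intro Sint_stripes_finite[of _ k R]) auto
  finally have 1: "Sint \<sigma> ?E (- ?E \<inter> ?B) < \<infinity>" .
  have "Sint \<sigma> (?E \<inter> ?B) (- ?E \<inter> - ?B) \<le> Sint \<sigma> (?E \<inter> ?B) (- ?E)" by (intro Sint_mono) auto
  also have "\<dots> < \<infinity>" using assms m by (intro Sint_stripes_finite[of _ k R]) auto
  finally show ?thesis using 1 unfolding Per_frac_def by simp
qed

lemma Sint_square_finite:
  assumes "0 < \<sigma>" "\<sigma> < 1"
  shows "Sint \<sigma> (- cbox (- 1) 1) (cbox (- 1) 1) < \<infinity>"
proof -
  let ?Q = "cbox (- 1) 1 :: R2 set"
  have "Sint \<sigma> (- ?Q) ?Q = Sint \<sigma> ?Q (- ?Q)" by (intro Sint_commute) (auto intro: borel_comp)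
  also have "\<dots> < \<infinity>"
  \<comment> \<open>The separating lines carry the four sides: a point outside the square violates
    one of the four inequalities that \<open>x\<close> satisfies.\<close>
  proof (rule Sint_finite[where R = 1 and L = "{(1, 1), (1, - 1), (2, 1), (2, - 1)}"])
    show "?Q \<subseteq> cbox (\<chi> i. - 1) (\<chi> i. 1)" by (auto simp: mem_box_cart)
    fix x y assume xy: "x \<in> ?Q" "y \<in> - ?Q"
    have le: "\<bar>x $ i - y $ i\<bar> \<le> dist x y" for i
      using component_le_norm_cart[of "x - y" i] by (simp add: dist_norm)
    show "\<exists>(i, c)\<in>{(1, 1), (1, - 1), (2, 1), (2, - 1)}. \<bar>x $ i - c\<bar> \<le> dist x y"
      using xy le[of 1] le[of 2] by (auto simp: mem_cbox_2)
  qed (use assms in \<open>auto intro: borel_comp\<close>)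
  finally show ?thesis .
qed

section \<open>Lower bounds for interactions\<close>

lemma measure_stripes_square:
  assumes "k \<ge> 1536"
  shows "emeasure lborel (stripes k \<inter> cbox (vector [- 1/4, - 1/4]) (vector [1/4, 1/4])) \<ge> ennreal (1/128)"
proof -
  let ?\<eta> = "square_cutoff 0 (1/4)"
  let ?S = "stripes k \<inter> cbox (vector [- 1/4, - 1/4]) (vector [1/4, 1/4])"
  have k: "k > 0" using assms by simp
  have l: "(1/4::real) > 0" by simp
  note sq = square_cutoff[OF l, where L = 0]
  have c: "C1c UNIV ?\<eta>" by (rule sq(1)) simp
  note s = C1c_stripe_sin_integral[OF c sq(2) k]
  have Sm: "?S \<in> sets borel" using stripes_borel by auto
  have fin: "emeasure lborel ?S < \<infinity>"
    using emeasure_mono[of ?S "cbox (vector [- 1/4, - 1/4]) (vector [1/4, 1/4])" lborel]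
      emeasure_lborel_cbox_finite[of "vector [- 1/4, - 1/4] :: R2" "vector [1/4, 1/4]"]
    by (simp add: le_less_trans)
  have Sf: "?S \<in> fmeasurable lebesgue"
    using Sm fin by (auto simp: fmeasurable_def)
  have "(LINT x|lebesgue. k * max 0 (sin (k * x $ 2)) * ?\<eta> x) \<le> (LINT x|lebesgue. k * indicat_real ?S x)"
  proof (rule integral_mono)
    have "integrable lebesgue (indicat_real ?S)"
      using Sf unfolding fmeasurable_def by (intro integrable_real_indicator) auto
    then show "integrable lebesgue (\<lambda>x. k * indicat_real ?S x)" by (rule integrable_mult_right)
    fix x :: R2
    show "k * max 0 (sin (k * x $ 2)) * ?\<eta> x \<le> k * indicat_real ?S x"
    proof (cases "x \<in> ?S")
      case True
      have "k * max 0 (sin (k * x $ 2)) * ?\<eta> x \<le> k * 1 * 1"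
        using k sq(2,3)[of x] by (intro mult_mono) auto
      then show ?thesis using True by simp
    next
      case False
      then have "max 0 (sin (k * x $ 2)) = 0 \<or> ?\<eta> x = 0"
        using sq(4)[of x] by (auto simp: stripes_def)
      then show ?thesis using k by auto
    qed
  qed (use s in auto)
  also have "\<dots> = k * measure lborel ?S" using Sm by (simp add: measure_completion)
  finally have 1: "(LINT x|lebesgue. k * max 0 (sin (k * x $ 2)) * ?\<eta> x) \<le> k * measure lborel ?S" .
  \<comment> \<open>The integral of the sine part is at least k/64 - 3/4 * 16 = k/64 - 12, and this
    is at least k/128 exactly when k \<ge> 1536.\<close>
  have "k / 4 * (LINT x|lebesgue. ?\<eta> x) \<ge> k / 4 * (1/16)"
    using sq(6) k by (intro mult_left_mono) (auto simp: power2_eq_square)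
  moreover have "(LINT x|lebesgue. \<bar>cgrad ?\<eta> x $ 2\<bar>) \<le> 16" using sq(8) by simp
  ultimately have "k * measure lborel ?S \<ge> k / 64 - 12" using s(1) 1 by simp
  then have "k * measure lborel ?S \<ge> k * (1/128)" using assms by linarith
  then have "measure lborel ?S \<ge> 1/128" using k by simp
  moreover have "emeasure lborel ?S = ennreal (measure lborel ?S)"
    using fin by (simp add: emeasure_eq_ennreal_measure less_top)
  ultimately show ?thesis by (simp only: ennreal_leI)
qed

text \<open>In row m of height \<open>h\<close> the sine has the sign of cos(m pi), which flips in
  the next row; so directly above each stripe there is a row of gap.\<close>

lemma stripes_next_cell:
  assumes "h > 0" "x \<in> stripes (pi / h)"
  defines "m \<equiv> \<lfloor>x $ 2 / h\<rfloor>"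
  assumes "(of_int m + 1) * h < y $ 2" "y $ 2 < (of_int m + 2) * h"
  shows "y \<notin> stripes (pi / h)"
proof -
  have sinm: "sin (of_int m * pi) = 0" using sin_npi_int[of m] by (simp add: mult.commute)
  have m: "of_int m \<le> x $ 2 / h" "x $ 2 / h < of_int m + 1" unfolding m_def by linarith+
  define \<theta> where "\<theta> = (x $ 2 / h - of_int m) * pi"
  have "\<theta> \<ge> 0" unfolding \<theta>_def using m by simp
  moreover have "\<theta> \<le> 1 * pi" unfolding \<theta>_def using m by (intro mult_right_mono) auto
  ultimately have "sin \<theta> \<ge> 0" by (intro sin_ge_zero) auto
  have "pi / h * x $ 2 = \<theta> + of_int m * pi" unfolding \<theta>_def by (simp add: algebra_simps)
  then have "sin (pi / h * x $ 2) = sin \<theta> * cos (of_int m * pi)" by (simp add: sin_add sinm)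
  then have "sin \<theta> * cos (of_int m * pi) > 0" using assms(2) by (simp add: stripes_def)
  then have cpos: "cos (of_int m * pi) > 0" using \<open>sin \<theta> \<ge> 0\<close> by (simp add: zero_less_mult_iff)
  define \<tau> where "\<tau> = (y $ 2 / h - of_int m - 1) * pi"
  have y: "of_int m + 1 < y $ 2 / h" "y $ 2 / h < of_int m + 2" using assms(1,4,5) by (auto simp: field_simps)
  have "\<tau> \<ge> 0" unfolding \<tau>_def using y by simp
  moreover have "\<tau> \<le> 1 * pi" unfolding \<tau>_def using y by (intro mult_right_mono) auto
  ultimately have "sin \<tau> \<ge> 0" by (intro sin_ge_zero) auto
  have "pi / h * y $ 2 = (\<tau> + of_int m * pi) + pi" unfolding \<tau>_def by (simp add: algebra_simps)
  then have "sin (pi / h * y $ 2) = - (sin \<tau> * cos (of_int m * pi))"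
    by (simp only: sin_periodic_pi) (simp add: sin_add sinm)
  moreover have "0 \<le> sin \<tau> * cos (of_int m * pi)" using \<open>sin \<tau> \<ge> 0\<close> cpos by (intro mult_nonneg_nonneg) auto
  ultimately have "\<not> 0 < sin (pi / h * y $ 2)" by linarith
  then show ?thesis unfolding stripes_def by (simp only: mem_Collect_eq not_False_eq_True)
qed

text \<open>Each stripe point of the small square sees an h by h box of gap at distance at most
  \<open>3 * h\<close>, worth (3h)^(-2-\<sigma>) * h^2, a multiple of h^(-\<sigma>). The area of
  such points stays above 1/128 while h tends to 0.\<close>

lemma Sint_stripes_large:
  assumes \<sigma>: "0 < \<sigma>" "\<sigma> < 1"
  obtains k :: real where "k > 0" "ennreal C < Sint \<sigma> (stripes k \<inter> cbox (- 1) 1) (cbox (- 1) 1 - stripes k)"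
proof -
  let ?Q = "cbox (- 1) 1 :: R2 set" and ?p = "2 + \<sigma>"
  \<comment> \<open>Collects the factors independent of \<open>h\<close>; the interaction is at
    least \<open>c0 * h powr (- \<sigma>)\<close>, and \<open>T\<close> is the value of the power
    that pushes it beyond \<open>C\<close>.\<close>
  define c0 where "c0 = \<sigma> * (1 - \<sigma>) * (1/128) * 3 powr (- ?p)"
  have c0: "c0 > 0" unfolding c0_def using \<sigma> by simp
  define T where "T = \<bar>C\<bar> / c0 + 1"
  have T: "T \<ge> 1" "c0 * T > C"
  proof -
    show "T \<ge> 1" unfolding T_def using c0 by simp
    have "c0 * T = \<bar>C\<bar> + c0" unfolding T_def using c0 by (simp add: field_simps)
    then show "c0 * T > C" using c0 by linarith
  qed
  define k where "k = max 1536 (pi * T powr (1 / \<sigma>))"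
  define h where "h = pi / k"
  have k: "k \<ge> 1536" "k \<ge> pi * T powr (1 / \<sigma>)" unfolding k_def by auto
  have h0: "h > 0" unfolding h_def using k by simp
  have h1: "h \<le> 1/4" unfolding h_def using k pi_less_4 by (simp add: field_simps)
  have kh: "k = pi / h" unfolding h_def using k by simp
  have hT: "h powr (- \<sigma>) \<ge> T"
  proof -
    have "1 / h \<ge> T powr (1 / \<sigma>)" unfolding h_def using k(2) by (simp add: field_simps)
    then have "(1 / h) powr \<sigma> \<ge> (T powr (1 / \<sigma>)) powr \<sigma>" using \<sigma> by (intro powr_mono2) auto
    also have "(T powr (1 / \<sigma>)) powr \<sigma> = T" using \<sigma> T by (simp add: powr_powr)
    finally show ?thesis using h0 by (simp add: powr_minus powr_divide inverse_eq_divide)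
  qed
  let ?S = "stripes k \<inter> cbox (vector [- 1/4, - 1/4]) (vector [1/4, 1/4])"
  define w where "w = ennreal ((3 * h) powr (- ?p)) * ennreal (h * h)"
  have inner: "(\<integral>\<^sup>+ y. indicator (stripes k \<inter> ?Q) x * indicator (?Q - stripes k) y * kern \<sigma> x y \<partial>lborel) \<ge> w * indicator ?S x" for x
  proof (cases "x \<in> ?S")
    case True
    then have xs: "x \<in> stripes (pi / h)" and xq: "\<bar>x $ 1\<bar> \<le> 1/4" "\<bar>x $ 2\<bar> \<le> 1/4"
      using kh by (auto simp: mem_cbox_2 abs_le_iff)
    define m where "m = \<lfloor>x $ 2 / h\<rfloor>"
    have m: "of_int m * h \<le> x $ 2" "x $ 2 < (of_int m + 1) * h"
    proof -
      have "of_int m \<le> x $ 2 / h" "x $ 2 / h < of_int m + 1" unfolding m_def by linarith+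
      then show "of_int m * h \<le> x $ 2" "x $ 2 < (of_int m + 1) * h" using h0 by (auto simp: field_simps)
    qed
    \<comment> \<open>One row above the row of \<open>x\<close>: horizontal distance below
      \<open>h\<close>, vertical below \<open>2 * h\<close>. As \<open>x\<close> has coordinates in
      [-1/4, 1/4] and \<open>h\<close> is at most 1/4, the box stays in the unit square.\<close>
    let ?P = "box (vector [x $ 1, (of_int m + 1) * h]) (vector [x $ 1 + h, (of_int m + 2) * h]) :: R2 set"
    have P: "y \<in> ?Q - stripes k \<and> 0 < dist x y \<and> dist x y \<le> 3 * h" if "y \<in> ?P" for y
    proof -
      have y: "x $ 1 < y $ 1" "y $ 1 < x $ 1 + h" "(of_int m + 1) * h < y $ 2" "y $ 2 < (of_int m + 2) * h"
        using that by (auto simp: mem_box_2)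
      have ns: "y \<notin> stripes k" unfolding kh using y by (intro stripes_next_cell[OF h0 xs]) (auto simp: m_def)
      have y2: "x $ 2 < y $ 2" "y $ 2 < x $ 2 + 2 * h" using y m by (auto simp: algebra_simps)
      have "- 1 \<le> y $ 1 \<and> y $ 1 \<le> 1 \<and> - 1 \<le> y $ 2 \<and> y $ 2 \<le> 1"
        using y(1,2) y2 xq h1 h0 by (intro conjI; linarith)
      then have "y \<in> ?Q" by (simp add: mem_cbox_2)
      moreover have "dist x y \<le> \<bar>(x - y) $ 1\<bar> + \<bar>(x - y) $ 2\<bar>"
        using norm_le_l1_cart[of "x - y"] by (simp add: dist_norm sum_2)
      then have "dist x y \<le> 3 * h" using y y2 by simp
      moreover have "x \<noteq> y" using ns True by auto
      ultimately show ?thesis using ns by simp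
    qed
    have "w = (\<integral>\<^sup>+ y. ennreal ((3 * h) powr (- ?p)) * indicator ?P y \<partial>lborel)"
    proof -
      have "emeasure lborel ?P = ennreal (h * h)"
        using h0 by (subst emeasure_box_2) (simp_all add: algebra_simps)
      then show ?thesis unfolding w_def by (simp add: nn_integral_cmult_indicator)
    qed
    also have "\<dots> \<le> (\<integral>\<^sup>+ y. indicator (stripes k \<inter> ?Q) x * indicator (?Q - stripes k) y * kern \<sigma> x y \<partial>lborel)"
    proof (rule nn_integral_mono)
      fix y
      have xQ: "x \<in> stripes k \<inter> ?Q" using True xq by (auto simp: mem_cbox_2)
      show "ennreal ((3 * h) powr (- ?p)) * indicator ?P y \<le> indicator (stripes k \<inter> ?Q) x * indicator (?Q - stripes k) y * kern \<sigma> x y"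
      proof (cases "y \<in> ?P")
        case yP: True
        have "(3 * h) powr (- ?p) \<le> dist x y powr (- ?p)" using P[OF yP] \<sigma> by (intro powr_mono2') auto
        then show ?thesis using xQ P[OF yP] yP by (simp add: kern_def ennreal_leI)
      qed simp
    qed
    finally show ?thesis using True by simp
  qed simp
  have Sm: "?S \<in> sets borel" using stripes_borel by auto
  have "w * ennreal (1/128) \<le> w * emeasure lborel ?S"
    by (intro mult_left_mono measure_stripes_square k) simp
  also have "\<dots> = (\<integral>\<^sup>+ x. w * indicator ?S x \<partial>lborel)" using Sm by (simp add: nn_integral_cmult_indicator)
  also have "\<dots> \<le> (\<integral>\<^sup>+ x. \<integral>\<^sup>+ y. indicator (stripes k \<inter> ?Q) x * indicator (?Q - stripes k) y * kern \<sigma> x y \<partial>lborel \<partial>lborel)"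
    by (intro nn_integral_mono inner)
  finally have "ennreal (\<sigma> * (1 - \<sigma>)) * (w * ennreal (1/128)) \<le> Sint \<sigma> (stripes k \<inter> ?Q) (?Q - stripes k)"
    unfolding Sint_eq by (intro mult_left_mono) auto
  moreover have "ennreal C < ennreal (\<sigma> * (1 - \<sigma>)) * (w * ennreal (1/128))"
  proof -
    have "(3 * h) powr (- ?p) * (h * h) = 3 powr (- ?p) * h powr (- \<sigma>)"
    proof -
      have "h * h = h powr 2" using h0 by (simp add: power2_eq_square)
      moreover have "(3 * h) powr (- ?p) = 3 powr (- ?p) * h powr (- ?p)" using h0 by (simp add: powr_mult)
      moreover have "h powr (- ?p) * h powr 2 = h powr (- \<sigma>)" by (simp only: powr_add[symmetric]) simp
      ultimately show ?thesis by (simp add: mult.assoc)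
    qed
    then have "ennreal (\<sigma> * (1 - \<sigma>)) * (w * ennreal (1/128)) = ennreal (c0 * h powr (- \<sigma>))"
      unfolding w_def c0_def using \<sigma> h0 by (simp add: ennreal_mult[symmetric] mult_ac)
    moreover have "c0 * T \<le> c0 * h powr (- \<sigma>)" using c0 hT by (intro mult_left_mono) auto
    then have "C < c0 * h powr (- \<sigma>)" using T(2) by linarith
    moreover have "0 < c0 * h powr (- \<sigma>)" using c0 h0 by simp
    ultimately show ?thesis by (simp only: ennreal_lessI)
  qed
  ultimately show ?thesis using k that[of k] by (simp add: less_le_trans)
qed

text \<open>After the common part \<open>a\<close> is set aside, cutting creates the interaction of
  the remaining stripes with the removed ones, bounded by that of the square with its complement. It
  destroys the interaction of stripes and gaps inside the square, which is larger for suitable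
  \<open>k\<close>.\<close>

lemma Per_frac_stripes_remove_square:
  assumes \<sigma>: "0 < \<sigma>" "\<sigma> < 1"
  obtains k :: real where "k > 0" "Per_frac \<sigma> (stripes k - cbox (- 1) 1) (ball 0 3) < Per_frac \<sigma> (stripes k) (ball 0 3)"
proof -
  let ?Q = "cbox (- 1) 1 :: R2 set" and ?B = "ball 0 3 :: R2 set"
  have "Sint \<sigma> (- ?Q) ?Q < \<infinity>" using \<sigma> by (rule Sint_square_finite)
  then obtain C where C: "Sint \<sigma> (- ?Q) ?Q = ennreal C" by (cases "Sint \<sigma> (- ?Q) ?Q") auto
  obtain k where k: "k > 0" "ennreal C < Sint \<sigma> (stripes k \<inter> ?Q) (?Q - stripes k)"
    using Sint_stripes_large[OF \<sigma>] by metis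
  let ?E = "stripes k"
  have QB: "?Q \<subseteq> ?B"
  proof
    fix x :: R2 assume "x \<in> ?Q"
    then have "\<bar>x $ 1\<bar> \<le> 1" "\<bar>x $ 2\<bar> \<le> 1" by (auto simp: mem_cbox_2)
    then show "x \<in> ?B" using norm_le_l1_cart[of x] by (simp add: sum_2)
  qed
  have m: "?E \<in> sets borel" "- ?E \<in> sets borel" "?Q \<in> sets borel" "?B \<in> sets borel" "- ?B \<in> sets borel"
    using stripes_borel[of k] by (auto intro: borel_comp)
  \<comment> \<open>The interactions that do not involve the removed piece; they occur in both
    perimeters and must be finite for a strict comparison.\<close>
  define a where "a = Sint \<sigma> (?E - ?Q) (- ?E \<inter> ?B) + Sint \<sigma> ((?E - ?Q) \<inter> ?B) (- ?E \<inter> - ?B)"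
  have s1: "- (?E - ?Q) \<inter> ?B = (- ?E \<inter> ?B) \<union> (?E \<inter> ?Q)" and s2: "- (?E - ?Q) \<inter> - ?B = - ?E \<inter> - ?B"
    using QB by auto
  have "Per_frac \<sigma> (?E - ?Q) ?B = a + Sint \<sigma> (?E - ?Q) (?E \<inter> ?Q)"
    unfolding Per_frac_def s1 s2 a_def using m by (subst Sint_Un_right) (auto simp: add_ac)
  also have "Sint \<sigma> (?E - ?Q) (?E \<inter> ?Q) \<le> Sint \<sigma> (- ?Q) ?Q" by (intro Sint_mono) auto
  finally have up: "Per_frac \<sigma> (?E - ?Q) ?B \<le> a + ennreal C" unfolding C by simp
  have "Per_frac \<sigma> ?E ?B \<ge> a + Sint \<sigma> (?E \<inter> ?Q) (?Q - ?E)"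
  proof -
    have "Sint \<sigma> ?E (- ?E \<inter> ?B) = Sint \<sigma> ((?E - ?Q) \<union> (?E \<inter> ?Q)) (- ?E \<inter> ?B)"
      by (rule arg_cong[where f = "\<lambda>X. Sint \<sigma> X _"]) auto
    also have "\<dots> = Sint \<sigma> (?E - ?Q) (- ?E \<inter> ?B) + Sint \<sigma> (?E \<inter> ?Q) (- ?E \<inter> ?B)"
      using m by (intro Sint_Un_left) auto
    finally have e: "Sint \<sigma> ?E (- ?E \<inter> ?B) = Sint \<sigma> (?E - ?Q) (- ?E \<inter> ?B) + Sint \<sigma> (?E \<inter> ?Q) (- ?E \<inter> ?B)" .
    have "Sint \<sigma> (?E \<inter> ?Q) (?Q - ?E) \<le> Sint \<sigma> (?E \<inter> ?Q) (- ?E \<inter> ?B)" using QB by (intro Sint_mono) auto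
    moreover have "Sint \<sigma> ((?E - ?Q) \<inter> ?B) (- ?E \<inter> - ?B) \<le> Sint \<sigma> (?E \<inter> ?B) (- ?E \<inter> - ?B)" by (intro Sint_mono) auto
    ultimately have "Sint \<sigma> (?E - ?Q) (- ?E \<inter> ?B) + Sint \<sigma> (?E \<inter> ?Q) (?Q - ?E) + Sint \<sigma> ((?E - ?Q) \<inter> ?B) (- ?E \<inter> - ?B)
      \<le> Sint \<sigma> (?E - ?Q) (- ?E \<inter> ?B) + Sint \<sigma> (?E \<inter> ?Q) (- ?E \<inter> ?B) + Sint \<sigma> (?E \<inter> ?B) (- ?E \<inter> - ?B)"
      by (intro add_mono order_refl)
    then show ?thesis unfolding Per_frac_def e a_def by (simp add: add_ac)
  qed
  moreover have "a < \<infinity>"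
  proof -
    have "a \<le> Per_frac \<sigma> ?E ?B" unfolding a_def Per_frac_def by (intro add_mono Sint_mono) auto
    also have "\<dots> < \<infinity>" using \<sigma> k by (intro Per_frac_stripes_finite) auto
    finally show ?thesis .
  qed
  then have "a + ennreal C < a + Sint \<sigma> (?E \<inter> ?Q) (?Q - ?E)"
    using k(2) by (simp add: ennreal_add_left_cancel_less)
  ultimately have "Per_frac \<sigma> (?E - ?Q) ?B < Per_frac \<sigma> ?E ?B" using up by (meson le_less_trans less_le_trans)
  then show ?thesis using k that by blast
qed

text \<open>Stated for Lebesgue sets because the positivity set of a competitor is known to be
  measurable only in that sense.\<close>

lemma Sint_ge_product:
  assumes "E \<in> sets lebesgue" "F \<in> sets lebesgue" "\<sigma> > 0"
    and d: "\<And>x y. x \<in> E \<Longrightarrow> y \<in> F \<Longrightarrow> 0 < dist x y \<and> dist x y \<le> D"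
  shows "ennreal (\<sigma> * (1 - \<sigma>)) * (ennreal (D powr (- (2 + \<sigma>))) * emeasure lebesgue F * emeasure lebesgue E) \<le> Sint \<sigma> E F"
proof -
  let ?c = "ennreal (D powr (- (2 + \<sigma>)))"
  have "?c * emeasure lebesgue F * emeasure lebesgue E = (\<integral>\<^sup>+ x. ?c * emeasure lebesgue F * indicator E x \<partial>lebesgue)"
    by (subst nn_integral_cmult_indicator[OF assms(1)]) (rule refl)
  also have "\<dots> \<le> (\<integral>\<^sup>+ x. \<integral>\<^sup>+ y. indicator E x * indicator F y * ennreal (dist x y powr (- (2 + \<sigma>))) \<partial>lebesgue \<partial>lebesgue)"
  proof (rule nn_integral_mono)
    fix x
    have "?c * emeasure lebesgue F * indicator E x = (\<integral>\<^sup>+ y. ?c * indicator E x * indicator F y \<partial>lebesgue)"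
      by (subst nn_integral_cmult_indicator[OF assms(2)]) (simp only: mult_ac)
    also have "\<dots> \<le> (\<integral>\<^sup>+ y. indicator E x * indicator F y * ennreal (dist x y powr (- (2 + \<sigma>))) \<partial>lebesgue)"
    proof (rule nn_integral_mono)
      fix y
      show "?c * indicator E x * indicator F y \<le> indicator E x * indicator F y * ennreal (dist x y powr (- (2 + \<sigma>)))"
      proof (cases "x \<in> E \<and> y \<in> F")
        case True
        then have "D powr (- (2 + \<sigma>)) \<le> dist x y powr (- (2 + \<sigma>))" using d[of x y] assms(3) by (intro powr_mono2') auto
        then show ?thesis using True by (simp add: ennreal_leI)
      qed auto
    qed
    finally show "?c * emeasure lebesgue F * indicator E x \<le> (\<integral>\<^sup>+ y. indicator E x * indicator F y * ennreal (dist x y powr (- (2 + \<sigma>))) \<partial>lebesgue)" .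
  qed
  finally show ?thesis unfolding Sint_def by (intro mult_left_mono) auto
qed

text \<open>Whatever \<open>X\<close> does in the ball, its points there interact with the gap box
  \<open>?T2\<close> outside, and the points of the complement with the stripe box
  \<open>?T1\<close>. Both boxes have the same area, so the two contributions add up to a multiple
  of the area of the ball.\<close>

lemma Per_frac_competitor_large:
  assumes \<sigma>: "0 < \<sigma>" "\<sigma> < 1" and "k > 0"
  obtains R :: real where "R > 3"
    "\<And>X. X \<in> sets lebesgue \<Longrightarrow> X - ball 0 R = stripes k - ball 0 R \<Longrightarrow> ennreal a < Per_frac \<sigma> X (ball 0 R)"
proof -
  define h where "h = pi / k"
  have h: "h > 0" unfolding h_def using assms by simp
  define V where "V = unit_ball_vol (real (DIM(R2)))"
  have V: "V > 0" unfolding V_def by simp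
  define A where "A = \<sigma> * (1 - \<sigma>) * h * V * 4 powr (- (2 + \<sigma>))"
  have A: "A > 0" unfolding A_def using \<sigma> h V by simp
  \<comment> \<open>\<open>b\<close> plays the role of R^(1-\<sigma>): the first summand brings
    \<open>A * b\<close> up to \<bar>a\<bar>, \<open>h\<close> keeps the boxes in the ball of radius
    \<open>3 * R\<close>, and 4 makes the radius exceed 3.\<close>
  define b where "b = \<bar>a\<bar> / A + h + 4"
  have b: "b \<ge> 4" "b \<ge> h" unfolding b_def using A h by (auto simp: field_simps)
  define R where "R = b powr (1 / (1 - \<sigma>))"
  have Rb: "R powr (1 - \<sigma>) = b" unfolding R_def using \<sigma> b by (simp add: powr_powr)
  have "b powr 1 \<le> R" unfolding R_def using \<sigma> b by (intro powr_mono) (auto simp: field_simps)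
  then have R: "R \<ge> b" using b by simp
  have R0: "R > 0" using R b by linarith
  let ?B = "ball 0 R :: R2 set"
  show ?thesis
  proof (rule that[of R])
    show "R > 3" using R b by linarith
    fix X :: "R2 set" assume X: "X \<in> sets lebesgue" and out: "X - ?B = stripes k - ?B"
    let ?T1 = "box (vector [R, 0]) (vector [2 * R, h]) :: R2 set" and ?T2 = "box (vector [R, - h]) (vector [2 * R, 0]) :: R2 set"
    have kh: "k * h = pi" unfolding h_def using assms by simp
    have T1: "x \<in> stripes k" if "x \<in> ?T1" for x
    proof -
      have x: "0 < x $ 2" "x $ 2 < h" using that by (auto simp: mem_box_2)
      then have "k * x $ 2 < pi" "0 < k * x $ 2" using kh mult_strict_left_mono[of "x $ 2" h k] assms by auto
      then show ?thesis unfolding stripes_def by (simp add: sin_gt_zero)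
    qed
    have T2: "x \<notin> stripes k" if "x \<in> ?T2" for x
    proof -
      have x: "0 < - x $ 2" "- x $ 2 < h" using that by (auto simp: mem_box_2)
      then have "k * (- x $ 2) < pi" "0 < k * (- x $ 2)" using kh mult_strict_left_mono[of "- x $ 2" h k] assms
        by (auto simp: mult_less_0_iff)
      then have "0 < sin (k * (- x $ 2))" by (rule sin_gt_zero[rotated])
      then show ?thesis unfolding stripes_def by simp
    qed
    have notB: "x \<notin> ?B" and nle: "norm x \<le> 3 * R" if "x \<in> ?T1 \<union> ?T2" for x
    proof -
      have x: "R < x $ 1" "x $ 1 < 2 * R" "\<bar>x $ 2\<bar> < h" using that h by (auto simp: mem_box_2)
      show "x \<notin> ?B" using x(1) component_le_norm_cart[of x 1] by simp
      show "norm x \<le> 3 * R" using norm_le_l1_cart[of x] x R b R0 by (simp add: sum_2)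
    qed
    have dst: "0 < dist x y \<and> dist x y \<le> 4 * R" if "x \<in> ?T1 \<union> ?T2" "y \<in> ?B" for x y
    proof -
      have "x \<noteq> y" using notB[OF that(1)] that(2) by blast
      moreover have "dist x y \<le> norm x + norm y" by (simp add: dist_norm norm_triangle_ineq4)
      ultimately show ?thesis using nle[OF that(1)] that(2) by simp
    qed
    have area: "emeasure lebesgue (box p q) = ennreal (R * h)"
      if pq: "q $ 1 - p $ 1 = R" "q $ 2 - p $ 2 = h" for p q :: R2
    proof -
      have "emeasure lborel (box p q) = ennreal (R * h)"
        using pq R0 h by (subst emeasure_box_2) simp_all
      then show ?thesis by simp
    qed
    let ?c = "ennreal (\<sigma> * (1 - \<sigma>))" and ?d = "ennreal ((4 * R) powr (- (2 + \<sigma>)))"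
    have X1: "- X \<inter> ?B \<in> sets lebesgue" "X \<inter> ?B \<in> sets lebesgue" using X by (auto simp: Compl_in_sets_lebesgue)
    have "?c * (?d * emeasure lebesgue (- X \<inter> ?B) * emeasure lebesgue ?T1) \<le> Sint \<sigma> ?T1 (- X \<inter> ?B)"
      using X1 \<sigma> dst by (intro Sint_ge_product) auto
    also have "\<dots> \<le> Sint \<sigma> X (- X \<inter> ?B)"
    proof (intro Sint_mono)
      show "?T1 \<subseteq> X"
      proof
        fix x assume "x \<in> ?T1"
        then have "x \<in> stripes k - ?B" using T1[of x] notB[of x] by blast
        then show "x \<in> X" using out by blast
      qed
    qed auto
    finally have l1: "?c * (?d * emeasure lebesgue (- X \<inter> ?B) * ennreal (R * h)) \<le> Sint \<sigma> X (- X \<inter> ?B)"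
      by (subst (asm) area) auto
    have "?c * (?d * emeasure lebesgue ?T2 * emeasure lebesgue (X \<inter> ?B)) \<le> Sint \<sigma> (X \<inter> ?B) ?T2"
    proof (rule Sint_ge_product)
      show "0 < dist x y \<and> dist x y \<le> 4 * R" if "x \<in> X \<inter> ?B" "y \<in> ?T2" for x y
        using dst[of y x] that by (simp add: dist_commute)
    qed (use X1 \<sigma> in auto)
    also have "\<dots> \<le> Sint \<sigma> (X \<inter> ?B) (- X \<inter> - ?B)"
    proof (intro Sint_mono)
      show "?T2 \<subseteq> - X \<inter> - ?B"
      proof
        fix x assume "x \<in> ?T2"
        then have "x \<notin> stripes k" "x \<notin> ?B" using T2[of x] notB[of x] by blast+
        then show "x \<in> - X \<inter> - ?B" using out by blast
      qed
    qed auto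
    finally have l2: "?c * (?d * ennreal (R * h) * emeasure lebesgue (X \<inter> ?B)) \<le> Sint \<sigma> (X \<inter> ?B) (- X \<inter> - ?B)"
      by (subst (asm) area) auto
    have split: "emeasure lebesgue (- X \<inter> ?B) + emeasure lebesgue (X \<inter> ?B) = ennreal (V * R\<^sup>2)"
    proof -
      have "emeasure lebesgue (- X \<inter> ?B) + emeasure lebesgue (X \<inter> ?B) = emeasure lebesgue ((- X \<inter> ?B) \<union> (X \<inter> ?B))"
        using X1 by (intro plus_emeasure) auto
      also have "(- X \<inter> ?B) \<union> (X \<inter> ?B) = ?B" by auto
      also have "emeasure lebesgue ?B = ennreal (V * R\<^sup>2)"
        using emeasure_ball[of R "0::R2"] R0 unfolding V_def by simp
      finally show ?thesis .
    qed
    \<comment> \<open>The kernel at distance \<open>4 * R\<close> times box area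
      \<open>R * h\<close> times ball area \<open>V * R\<^sup>2\<close>: the powers of
      \<open>R\<close> combine to 1 - \<sigma>.\<close>
    have "ennreal (A * b) = ?c * (?d * ennreal (R * h) * ennreal (V * R\<^sup>2))"
    proof -
      have "(4 * R) powr (- (2 + \<sigma>)) * R * R\<^sup>2 = 4 powr (- (2 + \<sigma>)) * R powr (1 - \<sigma>)"
      proof -
        have "R * R\<^sup>2 = R powr 3" using R0 by (simp add: power2_eq_square power3_eq_cube)
        moreover have "(4 * R) powr (- (2 + \<sigma>)) = 4 powr (- (2 + \<sigma>)) * R powr (- (2 + \<sigma>))" using R0 by (simp add: powr_mult)
        moreover have "R powr (- (2 + \<sigma>)) * R powr 3 = R powr (1 - \<sigma>)" by (simp only: powr_add[symmetric]) simp
        ultimately show ?thesis by (simp add: mult.assoc)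
      qed
      then have "A * b = (\<sigma> * (1 - \<sigma>)) * (((4 * R) powr (- (2 + \<sigma>)) * (R * h)) * (V * R\<^sup>2))"
        unfolding A_def Rb[symmetric] by (simp add: mult_ac)
      also have "ennreal \<dots> = ?c * (?d * ennreal (R * h) * ennreal (V * R\<^sup>2))"
        using \<sigma> R0 h V by (simp only: ennreal_mult mult_nonneg_nonneg powr_ge_zero zero_le_power2 less_imp_le diff_gt_0_iff_gt diff_ge_0_iff_ge)
      finally show ?thesis .
    qed
    also have "\<dots> = ?c * (?d * emeasure lebesgue (- X \<inter> ?B) * ennreal (R * h)) + ?c * (?d * ennreal (R * h) * emeasure lebesgue (X \<inter> ?B))"
      unfolding split[symmetric] by (simp only: distrib_left mult_ac)
    also have "\<dots> \<le> Per_frac \<sigma> X ?B" unfolding Per_frac_def using l1 l2 by (rule add_mono)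
    finally have "ennreal (A * b) \<le> Per_frac \<sigma> X ?B" .
    moreover have "a < A * b"
    proof -
      have "A * b = \<bar>a\<bar> + A * (h + 4)" unfolding b_def using A by (simp add: field_simps)
      moreover have "A * (h + 4) > 0" using A h by simp
      ultimately show ?thesis by linarith
    qed
    then have "ennreal a < ennreal (A * b)" using A b by (intro ennreal_lessI) auto
    ultimately show "ennreal a < Per_frac \<sigma> X ?B" by simp
  qed
qed

section \<open>The counterexample\<close>

text \<open>A C1 bump that equals 1 exactly on the closed square and is smaller elsewhere, so
  multiplying by \<open>1 - hole\<close> removes precisely that square from a positivity
  set.\<close>

definition hole :: "R2 \<Rightarrow> real" where
  "hole x = (1 + - sstep ((x $ 1)\<^sup>2 - 1)) * (1 + - sstep ((x $ 2)\<^sup>2 - 1))"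

lemma sstep_square_deriv:
  "((\<lambda>t. sstep (t\<^sup>2 - 1)) has_real_derivative sstep' (t\<^sup>2 - 1) * (2 * t)) (at t)"
  by (rule DERIV_chain2[OF sstep_deriv]) (auto intro!: derivative_eq_intros)

lemma hole_C1c: "C1c (ball 0 3) hole"
proof (rule C1cI)
  have "continuous_on UNIV (\<lambda>t. sstep' (t\<^sup>2 - 1) * (2 * t))"
    by (intro continuous_intros continuous_on_compose2[OF continuous_sstep']) auto
  note g = has_C1_grad_of_coordinate[OF sstep_square_deriv this]
  note a = has_C1_grad_add[OF has_C1_grad_const[of 1] has_C1_grad_minus[OF g]]
  show "has_C1_grad hole (cgrad hole)"
    unfolding hole_def[abs_def] by (rule has_C1_grad_imp_cgrad[OF has_C1_grad_mult[OF a a]])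
  \<comment> \<open>The step reaches 1 at \<bar>t\<bar> = sqrt 2, and 29/20 is slightly
    larger.\<close>
  let ?K = "cbox (vector [- 29/20, - 29/20]) (vector [29/20, 29/20]) :: R2 set"
  show "compact ?K" by simp
  show "?K \<subseteq> ball 0 3"
  proof
    fix x assume "x \<in> ?K"
    then have "- 29/20 \<le> x $ 1 \<and> x $ 1 \<le> 29/20 \<and> - 29/20 \<le> x $ 2 \<and> x $ 2 \<le> 29/20" by (simp add: mem_cbox_2)
    then have "\<bar>x $ 1\<bar> + \<bar>x $ 2\<bar> < 3" by linarith
    then show "x \<in> ball 0 3" using norm_le_l1_cart[of x] by (simp add: sum_2)
  qed
  fix x assume "x \<notin> ?K"
  then have "\<bar>x $ 1\<bar> \<ge> 29/20 \<or> \<bar>x $ 2\<bar> \<ge> 29/20" by (auto simp: mem_cbox_2)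
  moreover have "sstep (t\<^sup>2 - 1) = 1" if "\<bar>t\<bar> \<ge> 29/20" for t
  proof -
    have "(29/20)\<^sup>2 \<le> \<bar>t\<bar>\<^sup>2" using that by (intro power_mono) auto
    then show ?thesis by (intro sstep_eq_1) (simp add: power2_eq_square)
  qed
  ultimately show "hole x = 0" unfolding hole_def by auto
qed

lemma hole_eq_1_iff: "hole x \<le> 1" "hole x = 1 \<longleftrightarrow> x \<in> cbox (- 1) 1"
proof -
  have z: "sstep (t\<^sup>2 - 1) = 0 \<longleftrightarrow> \<bar>t\<bar> \<le> 1" for t
    using sstep_pos[of "t\<^sup>2 - 1"] sstep_eq_0[of "t\<^sup>2 - 1"] abs_square_le_1[of t] by force
  define p q where "p = sstep ((x $ 1)\<^sup>2 - 1)" and "q = sstep ((x $ 2)\<^sup>2 - 1)"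
  have b: "0 \<le> p" "p \<le> 1" "0 \<le> q" "q \<le> 1" unfolding p_def q_def by (auto simp: sstep_nonneg sstep_le_1)
  have h: "hole x = (1 - p) * (1 - q)" unfolding hole_def p_def q_def by simp
  show "hole x \<le> 1" unfolding h using b by (intro mult_le_one) auto
  have "(1 - p) * (1 - q) \<le> 1 - p" "(1 - p) * (1 - q) \<le> 1 - q"
    using b mult_left_le[of "1 - q" "1 - p"] mult_right_le_one_le[of "1 - q" "1 - p"] by (auto simp: mult.commute)
  then have "hole x = 1 \<longleftrightarrow> p = 0 \<and> q = 0" unfolding h using b by auto
  then show "hole x = 1 \<longleftrightarrow> x \<in> cbox (- 1) 1"
    unfolding p_def q_def z by (auto simp: mem_cbox_2 abs_le_iff)
qed

definition dug_fun :: "real \<Rightarrow> R2 \<Rightarrow> real" where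
  "dug_fun k x = stripe_fun k x + - (stripe_fun k x * hole x)"

lemma dug_fun_pos: "{x. dug_fun k x > 0} = stripes k - cbox (- 1) 1"
proof -
  have "dug_fun k x > 0 \<longleftrightarrow> x \<in> stripes k \<and> x \<notin> cbox (- 1) 1" for x
  proof -
    have "dug_fun k x = stripe_fun k x * (1 - hole x)" by (simp add: dug_fun_def algebra_simps)
    moreover have "0 < 1 - hole x \<longleftrightarrow> x \<notin> cbox (- 1) 1"
      using hole_eq_1_iff[of x] by linarith
    moreover have "\<not> 1 - hole x < 0" using hole_eq_1_iff(1)[of x] by linarith
    ultimately show ?thesis using stripe_fun_pos[of k] by (auto simp: zero_less_mult_iff)
  qed
  then show ?thesis by blast
qed

lemma dug_fun_C1: "has_C1_grad (dug_fun k) (cgrad (dug_fun k))"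
  unfolding dug_fun_def[abs_def]
  by (rule has_C1_grad_imp_cgrad[OF has_C1_grad_add[OF has_C1_grad_stripe_fun
        has_C1_grad_minus[OF has_C1_grad_mult[OF has_C1_grad_stripe_fun C1c_has_grad[OF hole_C1c]]]]])

lemma dug_fun_diff_C1c: "C1c (ball 0 3) (\<lambda>x. dug_fun k x - stripe_fun k x)"
  unfolding dug_fun_def using C1c_minus[OF C1c_mult[OF has_C1_grad_stripe_fun hole_C1c]] by simp

lemma stripe_fun_measurable: "stripe_fun k \<in> borel_measurable lebesgue"
  by (intro lebesgue_measurable_continuous has_C1_grad_continuous[OF has_C1_grad_stripe_fun])

section \<open>The classical and the fractional case together\<close>

lemma Per_stripes_finite:
  assumes "0 < \<sigma>" "\<sigma> \<le> 1" "k > 0" "R > 0"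
  shows "Per \<sigma> (stripes k) (ball 0 R) < \<infinity>"
  unfolding Per_def using assms Per1_stripes_finite[of R k] Per_frac_stripes_finite[of \<sigma> k R]
  by (cases "\<sigma> = 1") simp_all

lemma Per_stripes_remove_square:
  assumes "0 < \<sigma>" "\<sigma> \<le> 1"
  obtains k :: real where "k > 0" "Per \<sigma> (stripes k - cbox (- 1) 1) (ball 0 3) < Per \<sigma> (stripes k) (ball 0 3)"
proof (cases "\<sigma> = 1")
  case True
  then show ?thesis using Per1_stripes_remove_square that unfolding Per_def by auto
next
  case False
  then show ?thesis using assms Per_frac_stripes_remove_square[of \<sigma>] that unfolding Per_def by auto
qed

text \<open>For \<sigma> < 1 the perimeter alternative holds for every competitor. For \<sigma> = 1
  it holds when the added Dirichlet energy is below \<open>M\<close>, since that energy provides the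
  L2 bound on the perturbation.\<close>

lemma Per_competitor_large:
  assumes "0 < \<sigma>" "\<sigma> \<le> 1" "k > 0" "M \<ge> 0"
  obtains R :: real where "R > 3"
    "\<forall>v. H10 (ball 0 R) (\<lambda>x. v x - stripe_fun k x) \<and> (\<sigma> < 1 \<longrightarrow> (\<forall>x. x \<notin> ball 0 R \<longrightarrow> v x = stripe_fun k x)) \<longrightarrow>
      dirichlet (ball 0 R) (stripe_fun k) \<le> dirichlet (ball 0 R) v \<and>
      (dirichlet (ball 0 R) (stripe_fun k) + ennreal M \<le> dirichlet (ball 0 R) v \<or>
       ennreal a < Per \<sigma> {x. v x > 0} (ball 0 R))"
proof -
  let ?U = "stripe_fun k"
  have energy: "\<exists>D\<ge>0. dirichlet (ball 0 R) v = dirichlet (ball 0 R) ?U + ennreal D \<and>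
      (\<integral>\<^sup>+ x\<in>ball 0 R. ennreal ((v x - ?U x)\<^sup>2) \<partial>lebesgue) \<le> ennreal (16 * R\<^sup>2 * (D + 1) + 2)"
    if "H10 (ball 0 R) (\<lambda>x. v x - ?U x)" "R > 0" for R v
  proof (rule H10_competitor_energy[OF has_C1_grad_stripe_fun stripe_fun_harmonic that])
    fix D :: real
    assume "D \<ge> 0" "dirichlet (ball 0 R) (\<lambda>x. ?U x + (v x - ?U x)) = dirichlet (ball 0 R) ?U + ennreal D"
      "(\<integral>\<^sup>+ x\<in>ball 0 R. ennreal ((v x - ?U x)\<^sup>2) \<partial>lebesgue) \<le> ennreal (16 * R\<^sup>2 * (D + 1) + 2)"
    then show ?thesis by (intro exI[of _ D]) simp
  qed
  show ?thesis
  proof (cases "\<sigma> = 1")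
    case True
    obtain R where R: "R > 3"
      "\<And>w. w \<in> borel_measurable lebesgue \<Longrightarrow>
        (\<integral>\<^sup>+ x\<in>ball 0 R. ennreal ((w x)\<^sup>2) \<partial>lebesgue) \<le> ennreal (16 * R\<^sup>2 * (M + 1) + 2) \<Longrightarrow>
        ennreal a < Per1 {x. ?U x + w x > 0} (ball 0 R)"
      using Per1_competitor_large[OF assms(3,4), of a] by blast
    show ?thesis
    proof (rule that[OF R(1)], intro allI impI)
      fix v assume "H10 (ball 0 R) (\<lambda>x. v x - ?U x) \<and> (\<sigma> < 1 \<longrightarrow> (\<forall>x. x \<notin> ball 0 R \<longrightarrow> v x = ?U x))"
      then have v: "H10 (ball 0 R) (\<lambda>x. v x - ?U x)" ..
      obtain D where D: "D \<ge> 0" "dirichlet (ball 0 R) v = dirichlet (ball 0 R) ?U + ennreal D"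
        "(\<integral>\<^sup>+ x\<in>ball 0 R. ennreal ((v x - ?U x)\<^sup>2) \<partial>lebesgue) \<le> ennreal (16 * R\<^sup>2 * (D + 1) + 2)"
        using energy[OF v] R(1) by auto
      show "dirichlet (ball 0 R) ?U \<le> dirichlet (ball 0 R) v \<and>
        (dirichlet (ball 0 R) ?U + ennreal M \<le> dirichlet (ball 0 R) v \<or> ennreal a < Per \<sigma> {x. v x > 0} (ball 0 R))"
      proof (cases "D \<ge> M")
        case False
        have "ennreal (16 * R\<^sup>2 * (D + 1) + 2) \<le> ennreal (16 * R\<^sup>2 * (M + 1) + 2)"
          using False by (intro ennreal_leI add_right_mono mult_left_mono) auto
        moreover have "(\<lambda>x. v x - ?U x) \<in> borel_measurable lebesgue" using v unfolding H10_def by blast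
        ultimately have "ennreal a < Per1 {x. ?U x + (v x - ?U x) > 0} (ball 0 R)"
          using D(3) by (intro R(2)) auto
        then show ?thesis using D(2) True by (simp add: Per_def)
      qed (use D(2) in \<open>auto intro!: add_left_mono ennreal_leI\<close>)
    qed
  next
    case False
    then have \<sigma>: "\<sigma> < 1" using assms by simp
    obtain R where R: "R > 3"
      "\<And>X. X \<in> sets lebesgue \<Longrightarrow> X - ball 0 R = stripes k - ball 0 R \<Longrightarrow> ennreal a < Per_frac \<sigma> X (ball 0 R)"
      using Per_frac_competitor_large[OF assms(1) \<sigma> assms(3), of a] by blast
    show ?thesis
    proof (rule that[OF R(1)], intro allI impI)
      fix v assume "H10 (ball 0 R) (\<lambda>x. v x - ?U x) \<and> (\<sigma> < 1 \<longrightarrow> (\<forall>x. x \<notin> ball 0 R \<longrightarrow> v x = ?U x))"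
      then have v: "H10 (ball 0 R) (\<lambda>x. v x - ?U x)" "\<forall>x. x \<notin> ball 0 R \<longrightarrow> v x = ?U x" using \<sigma> by auto
      obtain D where D: "D \<ge> 0" "dirichlet (ball 0 R) v = dirichlet (ball 0 R) ?U + ennreal D"
        using energy[OF v(1)] R(1) by auto
      have "(\<lambda>x. v x - ?U x) \<in> borel_measurable lebesgue" using v(1) unfolding H10_def by blast
      from borel_measurable_add[OF this stripe_fun_measurable[of k]]
      have "v \<in> borel_measurable lebesgue" by simp
      from borel_measurable_less[OF borel_measurable_const this, of 0]
      have "{x. v x > 0} \<in> sets lebesgue" by simp
      moreover have "{x. v x > 0} - ball 0 R = stripes k - ball 0 R"
        using v(2) unfolding stripe_fun_pos[of k, symmetric] by auto
      ultimately have "ennreal a < Per_frac \<sigma> {x. v x > 0} (ball 0 R)" by (rule R(2))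
      then show "dirichlet (ball 0 R) ?U \<le> dirichlet (ball 0 R) v \<and>
        (dirichlet (ball 0 R) ?U + ennreal M \<le> dirichlet (ball 0 R) v \<or> ennreal a < Per \<sigma> {x. v x > 0} (ball 0 R))"
        using D(2) False by (simp add: Per_def)
    qed
  qed
qed

text \<open>The value at the jump itself is 0, as lower semicontinuity demands. Growth starts only
  beyond \<open>T\<close>, so the cost at \<open>T\<close> is at most \<open>M\<close> while the
  limit at infinity is still infinite.\<close>

definition jump_cost :: "real \<Rightarrow> real \<Rightarrow> real \<Rightarrow> real \<Rightarrow> real" where
  "jump_cost a M T t = (if t \<le> a then 0 else M + max 0 (t - T))"

lemma jump_cost_nonneg: "M \<ge> 0 \<Longrightarrow> jump_cost a M T t \<ge> 0"
  by (simp add: jump_cost_def)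

lemma jump_cost_mono: "M \<ge> 0 \<Longrightarrow> mono_on {0..} (jump_cost a M T)"
  by (rule mono_onI) (auto simp: jump_cost_def)

lemma jump_cost_lsc:
  assumes "M \<ge> 0"
  shows "lsc_on {0..} (jump_cost a M T)"
  unfolding lsc_on_def
proof (intro ballI allI impI)
  fix x e :: real assume "x \<in> {0..}" "e > 0"
  show "\<forall>\<^sub>F y in at x within {0..}. jump_cost a M T x - e < jump_cost a M T y"
  proof (cases "x \<le> a")
    case True
    have "jump_cost a M T x - e < jump_cost a M T y" for y
      using jump_cost_nonneg[OF assms, of a T y] True \<open>e > 0\<close> by (simp add: jump_cost_def)
    then show ?thesis by simp
  next
    case False
    have "jump_cost a M T x - e < jump_cost a M T y" if "dist y x < min e (x - a)" for y
      using that False by (auto simp: jump_cost_def dist_real_def max_def)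
    then show ?thesis
      unfolding eventually_at using False \<open>e > 0\<close> by (intro exI[of _ "min e (x - a)"]) auto
  qed
qed

lemma jump_cost_at_top:
  assumes "M \<ge> 0"
  shows "filterlim (jump_cost a M T) at_top at_top"
  unfolding filterlim_at_top
proof
  fix Z
  show "\<forall>\<^sub>F t in at_top. Z \<le> jump_cost a M T t"
    unfolding eventually_at_top_linorder
    by (intro exI[of _ "max (a + 1) (Z + T)"]) (use assms in \<open>auto simp: jump_cost_def\<close>)
qed

theorem theorem4p1:
  fixes \<sigma> :: real
  assumes "0 < \<sigma>" and "\<sigma> \<le> 1"
  shows "\<exists>(\<Phi>0 :: real \<Rightarrow> real) R0 r0.
           (\<forall>t\<ge>0. \<Phi>0 t \<ge> 0) \<and> mono_on {0..} \<Phi>0 \<and> lsc_on {0..} \<Phi>0 \<and>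
           filterlim \<Phi>0 at_top at_top \<and>
           R0 > r0 \<and> r0 > 0 \<and>
           (\<exists>u. minimizer \<Phi>0 \<sigma> (ball 0 R0) u \<and> \<not> minimizer \<Phi>0 \<sigma> (ball 0 r0) u)"
proof -
  obtain k :: real where k: "k > 0"
    "Per \<sigma> (stripes k - cbox (- 1) 1) (ball 0 3) < Per \<sigma> (stripes k) (ball 0 3)"
    using Per_stripes_remove_square[OF assms] by metis
  let ?U = "stripe_fun k" and ?V = "dug_fun k"
  note fin = Per_stripes_finite[OF assms k(1)]
  define a where "a = enn2real (Per \<sigma> (stripes k - cbox (- 1) 1) (ball 0 3))"
  have Pa: "Per \<sigma> (stripes k - cbox (- 1) 1) (ball 0 3) = ennreal a" and a0: "a \<ge> 0"
  proof -
    have "Per \<sigma> (stripes k - cbox (- 1) 1) (ball 0 3) < top" using k(2) by (rule less_le_trans) simp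
    then show "Per \<sigma> (stripes k - cbox (- 1) 1) (ball 0 3) = ennreal a" unfolding a_def by simp
  qed (simp add: a_def)
  \<comment> \<open>The added 1 makes \<open>M\<close> strictly larger than the Dirichlet energy of
    the dug function.\<close>
  define M where "M = enn2real (dirichlet (ball 0 3) ?V) + 1"
  have M: "M \<ge> 0" unfolding M_def by simp
  have dV: "dirichlet (ball 0 3) ?V < ennreal M"
  proof -
    have "dirichlet (ball 0 3) ?V < \<infinity>" by (rule dirichlet_C1_ball(2)[OF dug_fun_C1])
    then have "dirichlet (ball 0 3) ?V = ennreal (enn2real (dirichlet (ball 0 3) ?V))" by simp
    also have "\<dots> < ennreal M" unfolding M_def by (intro ennreal_lessI) (auto simp: add_nonneg_pos)
    finally show ?thesis .
  qed
  obtain R where R: "R > 3"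
    and large: "\<forall>v. H10 (ball 0 R) (\<lambda>x. v x - ?U x) \<and> (\<sigma> < 1 \<longrightarrow> (\<forall>x. x \<notin> ball 0 R \<longrightarrow> v x = ?U x)) \<longrightarrow>
      dirichlet (ball 0 R) ?U \<le> dirichlet (ball 0 R) v \<and>
      (dirichlet (ball 0 R) ?U + ennreal M \<le> dirichlet (ball 0 R) v \<or>
       ennreal a < Per \<sigma> {x. v x > 0} (ball 0 R))"
    by (rule Per_competitor_large[OF assms k(1) M, of a])
  define T where "T = enn2real (Per \<sigma> (stripes k) (ball 0 R))"
  define \<Phi> where "\<Phi> = jump_cost a M T"
  \<comment> \<open>An infinite perimeter costs infinity in \<open>energy\<close>; a finite one
    above \<open>a\<close> lies past the jump.\<close>
  have \<Phi>_ge: "ennreal M \<le> (if P = \<infinity> then \<infinity> else ennreal (\<Phi> (enn2real P)))" if "ennreal a < P" for P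
  proof (cases P)
    case (real r)
    then have "a < r" using that a0 by (simp add: ennreal_less_iff)
    then show ?thesis using real M by (simp add: \<Phi>_def jump_cost_def ennreal_leI)
  qed simp
  have "minimizer \<Phi> \<sigma> (ball 0 R) ?U"
    unfolding minimizer_def
  proof (intro conjI allI impI)
    show "?U \<in> borel_measurable lebesgue" by (rule stripe_fun_measurable)
    have e: "energy \<Phi> \<sigma> (ball 0 R) ?U = dirichlet (ball 0 R) ?U + ennreal (\<Phi> T)"
      using fin[of R] R unfolding energy_def stripe_fun_pos T_def by (auto simp: Let_def)
    show "energy \<Phi> \<sigma> (ball 0 R) ?U < \<infinity>"
      unfolding e using dirichlet_C1_ball(2)[OF has_C1_grad_stripe_fun] by simp
    fix v assume v: "H10 (ball 0 R) (\<lambda>x. v x - ?U x) \<and> (\<sigma> < 1 \<longrightarrow> (\<forall>x. x \<notin> ball 0 R \<longrightarrow> v x = ?U x))"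
    have "\<Phi> T \<le> M" using M by (simp add: \<Phi>_def jump_cost_def)
    then have "energy \<Phi> \<sigma> (ball 0 R) ?U \<le> dirichlet (ball 0 R) ?U + ennreal M"
      unfolding e by (intro add_left_mono ennreal_leI)
    also have "\<dots> \<le> energy \<Phi> \<sigma> (ball 0 R) v"
    \<comment> \<open>A competitor pays \<open>M\<close> in one of two ways: through its gradient,
      or by a perimeter beyond the jump.\<close>
    proof (cases "dirichlet (ball 0 R) ?U + ennreal M \<le> dirichlet (ball 0 R) v")
      case True
      then show ?thesis unfolding energy_def by (rule order_trans) simp
    next
      case False
      then have "dirichlet (ball 0 R) ?U \<le> dirichlet (ball 0 R) v" "ennreal a < Per \<sigma> {x. v x > 0} (ball 0 R)"
        using large[rule_format, OF v] by auto
      then show ?thesis unfolding energy_def Let_def by (intro add_mono \<Phi>_ge)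
    qed
    finally show "energy \<Phi> \<sigma> (ball 0 R) ?U \<le> energy \<Phi> \<sigma> (ball 0 R) v" .
  qed
  moreover have "\<not> minimizer \<Phi> \<sigma> (ball 0 3) ?U"
  proof
    assume min: "minimizer \<Phi> \<sigma> (ball 0 3) ?U"
    \<comment> \<open>Needed for admissibility when \<sigma> < 1; it holds because the difference
      has its support inside the ball.\<close>
    have "?V x = ?U x" if "x \<notin> ball 0 3" for x
      using C1c_support[OF dug_fun_diff_C1c[of k]] that by (metis eq_iff_diff_eq_0 subsetD)
    then have "energy \<Phi> \<sigma> (ball 0 3) ?U \<le> energy \<Phi> \<sigma> (ball 0 3) ?V"
      using min H10_C1c[OF dug_fun_diff_C1c] unfolding minimizer_def by blast
    also have "\<dots> = dirichlet (ball 0 3) ?V"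
      unfolding energy_def dug_fun_pos Let_def Pa using a0 by (simp add: \<Phi>_def jump_cost_def)
    also have "\<dots> < ennreal M" by (rule dV)
    \<comment> \<open>In the small ball the stripes have perimeter above \<open>a\<close>, so their
      cost alone reaches \<open>M\<close>, whereas the dug function sits at \<open>a\<close>, where
      the cost is 0.\<close>
    also have "\<dots> \<le> energy \<Phi> \<sigma> (ball 0 3) ?U"
      unfolding energy_def stripe_fun_pos Let_def
      using \<Phi>_ge[OF k(2)[unfolded Pa]] by (rule order_trans) simp
    finally show False by simp
  qed
  ultimately show ?thesis
    unfolding \<Phi>_def using M R jump_cost_nonneg jump_cost_mono jump_cost_lsc jump_cost_at_top
    by (intro exI[of _ "jump_cost a M T"] exI[of _ R] exI[of _ 3]) auto
qed

end
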